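(* Consider the infinite-mode exact-integration Galerkin (I–EIG) system on an element $\Omega$ in its $H$-orthogonalized form, with all quantities as defined in the context, and assume $U^{(o)}\neq0$. Let $$K_H:=\frac{C_HU^{(o)}(U^{(o)})^\top-U^{(o)}(U^{(o)})^\top C_H}{\|U^{(o)}\|^2},\qquad B_{H(G)}^{(o)}:=B_H^{(o)}+B_{H,\Delta}^{(o)},\qquad E_\alpha:=\tfrac12\|U^{(o)}_\alpha\|_2^2 .$$ Then for every $\alpha\in\mathbb N$, $$\dot U^{(o)}_\alpha=-\sum_{\beta=1}^\infty\big(N^{(o)}_{H,\mathrm{skw}}-S_{\mathrm{skw}}-K_H\big)_{\alpha\beta}U^{(o)}_\beta-\tfrac12\sum_{\beta=1}^\infty (B_{H(G)}^{(o)})_{\alpha\beta}U^{(o)}_\beta,$$ $$\dot E_\alpha=\sum_{\beta=1}^\infty P_{\alpha\beta}-\tfrac12\sum_{\beta=1}^\infty (U^{(o)}_\alpha)^\top (B_{H(G)}^{(o)})_{\alpha\beta}U^{(o)}_\beta,$$ where $P_{\alpha\beta}:=-(U^{(o)}_\alpha)^\top\big(N^{(o)}_{H,\mathrm{skw}}-S_{\mathrm{skw}}-K_H\big)_{\alpha\beta}U^{(o)}_\beta$. Moreover $P_{\alpha\beta}=-P_{\beta\alpha}$ and $\sum_{\alpha,\beta=1}^\infty P_{\alpha\beta}=0$. Consequently the total energy $E:=\sum_{\alpha=1}^\infty E_\alpha$ satisfies $$\dot E=-\tfrac12\sum_{\alpha=1}^\infty\sum_{\beta=1}^\infty (U^{(o)}_\alpha)^\top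 (B_{H(G)}^{(o)})_{\alpha\beta}U^{(o)}_\beta .$$
   Context: Physical setting. Repeated spatial indices $k$ are summed over $1,\dots,d$. The system is $\partial_tu+A_k(u)\partial_{x_k}u=0$, $x\in\mathbb R^d$, $u\in\mathbb R^m$ with values in an admissible set $\mathcal U$, $A_k=\partial_uF_k$ the Jacobian of a smooth flux. A smooth energy pair $(e,g_k)$ satisfies $\nabla_ue^\top A_k=\nabla_ug_k^\top$. On $\mathcal U$, $e>0$ and $\mathcal H_e=\nabla_u^2e$ is symmetric positive definite (SPD). Put $H(u)=\frac{2e(u)}{u^\top\mathcal H_e(u)u}\mathcal H_e(u)$, so $e=\tfrac12u^\top Hu$. Let $G_k(u)$ be a smooth symmetric matrix field with $g_k=\tfrac12u^\top G_ku$, and define $\Delta A_k$ by $G_k=H(A_k+\Delta A_k)$. All eigenvalues of $H$ lie in a fixed interval $[c_H,C_H]$, $0<c_H\le C_H<\infty$. Modal setting. On an element $\Omega\subset\mathbb R^d$ with outward unit normal $n$, let $\{\phi_\alpha\}_{\alpha\in\mathbb N}$ be a time-independent $L^2(\Omega)$-orthonormal polynomial basis (the union of the bases of the spaces of polynomials of degree at most $p$, $p\to\infty$), and let $\Phi_\alpha=\phi_\alpha I_m$. In the I–EIG system the state $u=\sum_{\alpha}\Phi_\alpha U_\alpha$, $U_\alpha(t)\in\mathbb R^m$, is a smooth solution of the PDE, and all integrals are exact. Matrices are block matrices with $m\times m$ blocks; $(X^\top)_{\alpha\beta}=(X_{\beta\alpha})^\top$, $X_{\mathrm{skw}}=\tfrac12(X-X^\top)$.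 Define, with fields evaluated at $u$, - $(M_H)_{\alpha\beta}=\int_\Omega\Phi_\alpha^\top H\Phi_\beta\,dV$, - $(N_H)_{\alpha\beta}=\int_\Omega\Phi_\alpha^\top HA_k\partial_{x_k}\Phi_\beta\,dV$, - $(V_H)_{\alpha\beta}=\int_\Omega\Phi_\alpha^\top\partial_{x_k}(HA_k)\Phi_\beta\,dV$, - $(B_H)_{\alpha\beta}=\int_{\partial\Omega}\Phi_\alpha^\top HA_k\Phi_\beta n_k\,dS$, - $(B_{H,\Delta})_{\alpha\beta}=\int_{\partial\Omega}\Phi_\alpha^\top H\Delta A_k\Phi_\beta n_k\,dS$. The I–EIG coefficient equation is $\sum_\beta (M_H)_{\alpha\beta}\dot U_\beta+\sum_\beta (N_H)_{\alpha\beta}U_\beta=0$, $\alpha\in\mathbb N$. $H$-orthogonalization. $M_H=R^\top R$ with $R=R(t)$ the upper triangular Cholesky factor; $U^{(o)}:=RU$, $X^{(o)}:=R^{-\top}XR^{-1}$ for a matrix $X$, and $S:=\dot RR^{-1}$. Set $C_H:=\tfrac12\big(S+S^\top+V_H^{(o)}+B_{H,\Delta}^{(o)}\big)$. Convention: the infinite-mode system is the $p\to\infty$ limit; the infinite matrices, their Cholesky factor, products and sums are taken to be well defined and convergent, and series may be rearranged, differentiated termwise and interchanged with integration. *)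

theory Defs
  imports "HOL-Analysis.Analysis"
begin

section \<open>Calculus\<close>

text \<open>
  The first argument of a partial derivative is the coordinate.  It is used both for the
  state variable \<open>u\<close> (coordinates \<open>'m\<close>) and for the space variable \<open>x\<close> (coordinates \<open>'d\<close>).
\<close>

definition pd :: "'n::finite \<Rightarrow> (real^'n \<Rightarrow> 'b::real_normed_vector) \<Rightarrow> real^'n \<Rightarrow> 'b" where
  "pd i f x = frechet_derivative f (at x) (axis i 1)"

definition grad :: "(real^'n::finite \<Rightarrow> real) \<Rightarrow> real^'n \<Rightarrow> real^'n" where
  "grad f x = (\<chi> i. pd i f x)"

definition hessian :: "(real^'n::finite \<Rightarrow> real) \<Rightarrow> real^'n \<Rightarrow> real^'n^'n" where
  "hessian f x = (\<chi> i j. pd j (pd i f) x)"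

text \<open>\<open>C^k\<close> regularity, meant for open sets \<open>S\<close> of a finite-dimensional space.\<close>

primrec Ck_on :: "nat \<Rightarrow> 'a::real_normed_vector set \<Rightarrow> ('a \<Rightarrow> 'b::real_normed_vector) \<Rightarrow> bool" where
  "Ck_on 0 S f = continuous_on S f"
| "Ck_on (Suc k) S f =
     ((\<forall>x\<in>S. f differentiable (at x)) \<and> (\<forall>v. Ck_on k S (\<lambda>x. frechet_derivative f (at x) v)))"

definition smooth_on :: "'a::real_normed_vector set \<Rightarrow> ('a \<Rightarrow> 'b::real_normed_vector) \<Rightarrow> bool" where
  "smooth_on S f \<longleftrightarrow> (\<forall>k. Ck_on k S f)"

definition spd :: "real^'n^'n::finite \<Rightarrow> bool" where
  "spd X \<longleftrightarrow> transpose X = X \<and> (\<forall>v. v \<noteq> 0 \<longrightarrow> 0 < v \<bullet> (X *v v))"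


section \<open>Elements, surface measure and outward unit normal\<close>

text \<open>
  \<open>s\<close>-dimensional Hausdorff (outer) measure, normalised so that it is the usual \<open>s\<close>-dimensional
  area; for \<open>s = 0\<close> it is the counting measure.
\<close>

definition hausdorff_outer :: "nat \<Rightarrow> 'a::metric_space set \<Rightarrow> ennreal" where
  "hausdorff_outer s A =
     (SUP \<delta>\<in>{0<..}. INF E\<in>{E :: nat \<Rightarrow> 'a set. A \<subseteq> (\<Union>i. E i) \<and>
                                 (\<forall>i. bounded (E i) \<and> diameter (E i) \<le> \<delta>)}.
        (\<Sum>i. ennreal (if E i = {} then 0 else unit_ball_vol (real s) * (diameter (E i) / 2) ^ s)))"

definition hausdorff_measure :: "nat \<Rightarrow> 'a::metric_space measure" where
  "hausdorff_measure s = measure_of UNIV (sets borel) (hausdorff_outer s)"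

definition surface_measure :: "(real^'d::finite) set \<Rightarrow> (real^'d) measure" where
  "surface_measure \<Omega> = restrict_space (hausdorff_measure (CARD('d) - 1)) (frontier \<Omega>)"

text \<open>
  The exterior unit normal in the sense of Federer: blowing up \<open>\<Omega>\<close> at \<open>x\<close> gives the half space
  \<open>{y. (y - x) \<bullet> \<nu> < 0}\<close>.  At a point where the boundary is a \<open>C^1\<close> hypersurface with \<open>\<Omega>\<close> on
  one side this is the classical outward unit normal.
\<close>

definition outward_unit_normal_at :: "(real^'d::finite) set \<Rightarrow> real^'d \<Rightarrow> real^'d \<Rightarrow> bool" where
  "outward_unit_normal_at \<Omega> x \<nu> \<longleftrightarrow> norm \<nu> = 1 \<and>
     ((\<lambda>r. measure lebesgue {y \<in> ball x r \<inter> \<Omega>. 0 < (y - x) \<bullet> \<nu>} / r ^ CARD('d)) \<longlongrightarrow> 0) (at_right 0) \<and>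
     ((\<lambda>r. measure lebesgue {y \<in> ball x r - \<Omega>. (y - x) \<bullet> \<nu> < 0} / r ^ CARD('d)) \<longlongrightarrow> 0) (at_right 0)"

text \<open>
  An element is a bounded open set with finite boundary area that has an outward unit normal at
  almost every boundary point.  By the De Giorgi--Federer theorem these properties already imply
  the divergence theorem (last clause).  It is listed since the libraries provide no divergence
  theorem; it involves no choice, because surface measure and normal are fixed geometrically by
  the other clauses.
\<close>

definition element :: "(real^'d::finite) set \<Rightarrow> (real^'d \<Rightarrow> real^'d) \<Rightarrow> bool" where
  "element \<Omega> n \<longleftrightarrow>
     open \<Omega> \<and> bounded \<Omega> \<and> \<Omega> \<noteq> {} \<and>
     finite_measure (surface_measure \<Omega>) \<and>
     n \<in> borel_measurable borel \<and>
     (AE x in surface_measure \<Omega>. outward_unit_normal_at \<Omega> x (n x)) \<and>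
     (\<forall>W Y. open W \<and> closure \<Omega> \<subseteq> W \<and> Ck_on 1 W Y \<longrightarrow>
        (LINT x|lebesgue_on \<Omega>. (\<Sum>k\<in>UNIV. pd k (\<lambda>y. Y y $ k) x))
          = (LINT x|surface_measure \<Omega>. Y x \<bullet> n x))"


section \<open>Polynomial bases\<close>

definition poly_space :: "nat \<Rightarrow> (real^'d::finite \<Rightarrow> real) set" where
  "poly_space p = {f. \<exists>c :: ('d \<Rightarrow> nat) \<Rightarrow> real.
     \<forall>x. f x = (\<Sum>a\<in>{a. (\<Sum>k\<in>UNIV. a k) \<le> p}. c a * (\<Prod>k\<in>UNIV. x $ k ^ a k))}"

text \<open>
  Linear independence follows from orthonormality.  The last clause says that, for every \<open>p\<close>, the
  basis functions of degree at most \<open>p\<close> span \<open>poly_space p\<close>, so that the family is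
  the union of bases of these spaces.
\<close>

definition orthonormal_poly_basis :: "(real^'d::finite) set \<Rightarrow> (nat \<Rightarrow> real^'d \<Rightarrow> real) \<Rightarrow> bool" where
  "orthonormal_poly_basis \<Omega> \<phi> \<longleftrightarrow>
     (\<forall>\<alpha>. \<exists>p. \<phi> \<alpha> \<in> poly_space p) \<and>
     (\<forall>\<alpha> \<beta>. (LINT x|lebesgue_on \<Omega>. \<phi> \<alpha> x * \<phi> \<beta> x) = (if \<alpha> = \<beta> then 1 else 0)) \<and>
     (\<forall>p. \<forall>f\<in>poly_space p. \<exists>I c. finite I \<and> (\<forall>\<alpha>\<in>I. \<phi> \<alpha> \<in> poly_space p) \<and>
        (\<forall>x. f x = (\<Sum>\<alpha>\<in>I. c \<alpha> * \<phi> \<alpha> x)))"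


section \<open>Infinite block matrices\<close>

text \<open>
  Sums over \<open>nat\<close> are unconditional sums (\<open>infsum\<close>, \<open>has_sum\<close>, \<open>summable_on\<close>); for values in a
  finite-dimensional space unconditional and absolute summability coincide.
\<close>

type_synonym 'm bvec = "nat \<Rightarrow> real^'m"
type_synonym 'm bmat = "nat \<Rightarrow> nat \<Rightarrow> real^'m^'m"

definition bmult :: "'m::finite bmat \<Rightarrow> 'm bmat \<Rightarrow> 'm bmat" where
  "bmult X Y = (\<lambda>\<alpha> \<beta>. \<Sum>\<^sub>\<infinity>\<gamma>. X \<alpha> \<gamma> ** Y \<gamma> \<beta>)"

definition bapp :: "'m::finite bmat \<Rightarrow> 'm bvec \<Rightarrow> 'm bvec" where
  "bapp X v = (\<lambda>\<alpha>. \<Sum>\<^sub>\<infinity>\<beta>. X \<alpha> \<beta> *v v \<beta>)"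

definition btrans :: "'m::finite bmat \<Rightarrow> 'm bmat" where
  "btrans X = (\<lambda>\<alpha> \<beta>. transpose (X \<beta> \<alpha>))"

definition bskw :: "'m::finite bmat \<Rightarrow> 'm bmat" where
  "bskw X = (\<lambda>\<alpha> \<beta>. (1/2) *\<^sub>R (X \<alpha> \<beta> - btrans X \<alpha> \<beta>))"

definition bid :: "'m::finite bmat" where
  "bid = (\<lambda>\<alpha> \<beta>. if \<alpha> = \<beta> then mat 1 else 0)"

definition bouter :: "'m::finite bvec \<Rightarrow> 'm bvec \<Rightarrow> 'm bmat" where
  "bouter v w = (\<lambda>\<alpha> \<beta>. \<chi> i j. v \<alpha> $ i * w \<beta> $ j)"

definition bnorm :: "'m::finite bvec \<Rightarrow> real" where
  "bnorm v = sqrt (\<Sum>\<^sub>\<infinity>\<alpha>. (norm (v \<alpha>))\<^sup>2)"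

definition bupper :: "'m::finite bmat \<Rightarrow> bool" where
  "bupper X \<longleftrightarrow> (\<forall>\<alpha> \<beta>. \<beta> < \<alpha> \<longrightarrow> X \<alpha> \<beta> = 0)"

text \<open>
  The inverse of an upper triangular infinite matrix is the upper triangular two-sided inverse; it
  is unique, and exists if all diagonal blocks are invertible.  All products of upper triangular
  matrices are finite sums.
\<close>

definition binv :: "'m::finite bmat \<Rightarrow> 'm bmat" where
  "binv X = (THE Y. bupper Y \<and> bmult X Y = bid \<and> bmult Y X = bid)"

text \<open>
  Upper triangularity of the Cholesky factor is meant for scalar entries, the index pairs
  \<open>(\<alpha>, i)\<close> being ordered lexicographically.
\<close>

definition cholesky_factor :: "'m::{finite,linorder} bmat \<Rightarrow> 'm bmat \<Rightarrow> bool" where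
  "cholesky_factor M R \<longleftrightarrow>
     bupper R \<and>
     (\<forall>\<alpha> i j. j < i \<longrightarrow> R \<alpha> \<alpha> $ i $ j = 0) \<and>
     (\<forall>\<alpha> i. 0 < R \<alpha> \<alpha> $ i $ i) \<and>
     M = bmult (btrans R) R"


section \<open>The I--EIG system\<close>

record ('d, 'm) ieig =
  Adm :: "(real^'m::finite) set"
  flux :: "'d::finite \<Rightarrow> real^'m \<Rightarrow> real^'m"
  energy :: "real^'m \<Rightarrow> real"
  eflux :: "'d \<Rightarrow> real^'m \<Rightarrow> real"
  Gfield :: "'d \<Rightarrow> real^'m \<Rightarrow> real^'m^'m"
  DA :: "'d \<Rightarrow> real^'m \<Rightarrow> real^'m^'m"
  Elt :: "(real^'d) set"
  normal :: "real^'d \<Rightarrow> real^'d"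
  phi :: "nat \<Rightarrow> real^'d \<Rightarrow> real"
  times :: "real set"
  state :: "real \<Rightarrow> real^'d \<Rightarrow> real^'m"
  coeffs :: "real \<Rightarrow> nat \<Rightarrow> real^'m"
  chol :: "real \<Rightarrow> nat \<Rightarrow> nat \<Rightarrow> real^'m^'m"

subsection \<open>Physical setting\<close>

definition Amat :: "('d::finite, 'm::finite) ieig \<Rightarrow> 'd \<Rightarrow> real^'m \<Rightarrow> real^'m^'m" where
  "Amat s k w = jacobian (flux s k) (at w)"

definition Hmat :: "('d::finite, 'm::finite) ieig \<Rightarrow> real^'m \<Rightarrow> real^'m^'m" where
  "Hmat s w = (2 * energy s w / (w \<bullet> (hessian (energy s) w *v w))) *\<^sub>R hessian (energy s) w"

definition physical_setting :: "('d::finite, 'm::finite) ieig \<Rightarrow> bool" where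
  "physical_setting s \<longleftrightarrow>
     open (Adm s) \<and>
     smooth_on (Adm s) (energy s) \<and>
     (\<forall>k. smooth_on (Adm s) (flux s k) \<and> smooth_on (Adm s) (eflux s k) \<and>
          smooth_on (Adm s) (Gfield s k)) \<and>
     (\<forall>w\<in>Adm s. 0 < energy s w \<and> spd (hessian (energy s) w)) \<and>
     (\<forall>k. \<forall>w\<in>Adm s. grad (energy s) w v* Amat s k w = grad (eflux s k) w) \<and>
     (\<forall>k. \<forall>w\<in>Adm s. transpose (Gfield s k w) = Gfield s k w \<and>
          eflux s k w = 1/2 * (w \<bullet> (Gfield s k w *v w)) \<and>
          Gfield s k w = Hmat s w ** (Amat s k w + DA s k w)) \<and>
     (\<exists>c C. 0 < c \<and> c \<le> C \<and>
        (\<forall>w\<in>Adm s. \<forall>l. (\<exists>v. v \<noteq> 0 \<and> Hmat s w *v v = l *\<^sub>R v) \<longrightarrow> c \<le> l \<and> l \<le> C))"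

subsection \<open>Modal matrices\<close>

definition Phi :: "('d::finite, 'm::finite) ieig \<Rightarrow> nat \<Rightarrow> real^'d \<Rightarrow> real^'m^'m" where
  "Phi s \<alpha> x = phi s \<alpha> x *\<^sub>R mat 1"

definition Hx :: "('d::finite, 'm::finite) ieig \<Rightarrow> real \<Rightarrow> real^'d \<Rightarrow> real^'m^'m" where
  "Hx s t x = Hmat s (state s t x)"

definition HAx :: "('d::finite, 'm::finite) ieig \<Rightarrow> 'd \<Rightarrow> real \<Rightarrow> real^'d \<Rightarrow> real^'m^'m" where
  "HAx s k t x = Hmat s (state s t x) ** Amat s k (state s t x)"

definition HDAx :: "('d::finite, 'm::finite) ieig \<Rightarrow> 'd \<Rightarrow> real \<Rightarrow> real^'d \<Rightarrow> real^'m^'m" where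
  "HDAx s k t x = Hmat s (state s t x) ** DA s k (state s t x)"

definition MH :: "('d::finite, 'm::finite) ieig \<Rightarrow> real \<Rightarrow> 'm bmat" where
  "MH s t = (\<lambda>\<alpha> \<beta>. LINT x|lebesgue_on (Elt s).
     transpose (Phi s \<alpha> x) ** Hx s t x ** Phi s \<beta> x)"

definition NH :: "('d::finite, 'm::finite) ieig \<Rightarrow> real \<Rightarrow> 'm bmat" where
  "NH s t = (\<lambda>\<alpha> \<beta>. LINT x|lebesgue_on (Elt s).
     (\<Sum>k\<in>UNIV. transpose (Phi s \<alpha> x) ** HAx s k t x ** pd k (Phi s \<beta>) x))"

definition divHA :: "('d::finite, 'm::finite) ieig \<Rightarrow> real \<Rightarrow> real^'d \<Rightarrow> real^'m^'m" where
  "divHA s t x = (\<Sum>k\<in>UNIV. pd k (HAx s k t) x)"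

definition VH :: "('d::finite, 'm::finite) ieig \<Rightarrow> real \<Rightarrow> 'm bmat" where
  "VH s t = (\<lambda>\<alpha> \<beta>. LINT x|lebesgue_on (Elt s).
     transpose (Phi s \<alpha> x) ** divHA s t x ** Phi s \<beta> x)"

definition BH :: "('d::finite, 'm::finite) ieig \<Rightarrow> real \<Rightarrow> 'm bmat" where
  "BH s t = (\<lambda>\<alpha> \<beta>. LINT x|surface_measure (Elt s).
     (\<Sum>k\<in>UNIV. normal s x $ k *\<^sub>R (transpose (Phi s \<alpha> x) ** HAx s k t x ** Phi s \<beta> x)))"

definition normalHDA :: "('d::finite, 'm::finite) ieig \<Rightarrow> real \<Rightarrow> real^'d \<Rightarrow> real^'m^'m" where
  "normalHDA s t x = (\<Sum>k\<in>UNIV. normal s x $ k *\<^sub>R HDAx s k t x)"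

definition BHD :: "('d::finite, 'm::finite) ieig \<Rightarrow> real \<Rightarrow> 'm bmat" where
  "BHD s t = (\<lambda>\<alpha> \<beta>. LINT x|surface_measure (Elt s).
     transpose (Phi s \<alpha> x) ** normalHDA s t x ** Phi s \<beta> x)"

subsection \<open>H-orthogonalization\<close>

definition Udot :: "('d::finite, 'm::finite) ieig \<Rightarrow> real \<Rightarrow> 'm bvec" where
  "Udot s t = (\<lambda>\<alpha>. vector_derivative (\<lambda>r. coeffs s r \<alpha>) (at t))"

definition Rdot :: "('d::finite, 'm::finite) ieig \<Rightarrow> real \<Rightarrow> 'm bmat" where
  "Rdot s t = (\<lambda>\<alpha> \<beta>. vector_derivative (\<lambda>r. chol s r \<alpha> \<beta>) (at t))"

definition Uo :: "('d::finite, 'm::finite) ieig \<Rightarrow> real \<Rightarrow> 'm bvec" where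
  "Uo s t = bapp (chol s t) (coeffs s t)"

definition orth :: "('d::finite, 'm::finite) ieig \<Rightarrow> real \<Rightarrow> 'm bmat \<Rightarrow> 'm bmat" where
  "orth s t X = bmult (bmult (btrans (binv (chol s t))) X) (binv (chol s t))"

definition Smat :: "('d::finite, 'm::finite) ieig \<Rightarrow> real \<Rightarrow> 'm bmat" where
  "Smat s t = bmult (Rdot s t) (binv (chol s t))"

definition CH :: "('d::finite, 'm::finite) ieig \<Rightarrow> real \<Rightarrow> 'm bmat" where
  "CH s t = (\<lambda>\<alpha> \<beta>. (1/2) *\<^sub>R (Smat s t \<alpha> \<beta> + btrans (Smat s t) \<alpha> \<beta>
       + orth s t (VH s t) \<alpha> \<beta> + orth s t (BHD s t) \<alpha> \<beta>))"

definition KH :: "('d::finite, 'm::finite) ieig \<Rightarrow> real \<Rightarrow> 'm bmat" where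
  "KH s t = (\<lambda>\<alpha> \<beta>. (1 / (bnorm (Uo s t))\<^sup>2) *\<^sub>R
      (bmult (CH s t) (bouter (Uo s t) (Uo s t)) \<alpha> \<beta>
       - bmult (bouter (Uo s t) (Uo s t)) (CH s t) \<alpha> \<beta>))"

definition BHGo :: "('d::finite, 'm::finite) ieig \<Rightarrow> real \<Rightarrow> 'm bmat" where
  "BHGo s t = (\<lambda>\<alpha> \<beta>. orth s t (BH s t) \<alpha> \<beta> + orth s t (BHD s t) \<alpha> \<beta>)"

definition skewop :: "('d::finite, 'm::finite) ieig \<Rightarrow> real \<Rightarrow> 'm bmat" where
  "skewop s t = (\<lambda>\<alpha> \<beta>. bskw (orth s t (NH s t)) \<alpha> \<beta> - bskw (Smat s t) \<alpha> \<beta> - KH s t \<alpha> \<beta>)"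

definition Emode :: "('d::finite, 'm::finite) ieig \<Rightarrow> real \<Rightarrow> nat \<Rightarrow> real" where
  "Emode s t \<alpha> = 1/2 * (norm (Uo s t \<alpha>))\<^sup>2"

definition Pmode :: "('d::finite, 'm::finite) ieig \<Rightarrow> real \<Rightarrow> nat \<Rightarrow> nat \<Rightarrow> real" where
  "Pmode s t \<alpha> \<beta> = - (Uo s t \<alpha> \<bullet> (skewop s t \<alpha> \<beta> *v Uo s t \<beta>))"

subsection \<open>Solutions and the convergence convention\<close>

text \<open>
  Smoothness up to the boundary means that the state extends smoothly to a neighbourhood \<open>W\<close> of
  the closed element.
\<close>

definition ieig_solution :: "('d::finite, 'm::{finite,linorder}) ieig \<Rightarrow> bool" where
  "ieig_solution s \<longleftrightarrow>
     open (times s) \<and>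
     (\<exists>W. open W \<and> closure (Elt s) \<subseteq> W \<and> smooth_on (times s \<times> W) (\<lambda>(t, x). state s t x)) \<and>
     (\<forall>t\<in>times s. \<forall>x\<in>closure (Elt s). state s t x \<in> Adm s) \<and>
     (\<forall>t\<in>times s. \<forall>x\<in>Elt s.
        vector_derivative (\<lambda>r. state s r x) (at t)
          + (\<Sum>k\<in>UNIV. Amat s k (state s t x) *v pd k (state s t) x) = 0) \<and>
     (\<forall>\<alpha>. smooth_on (times s) (\<lambda>t. coeffs s t \<alpha>)) \<and>
     (\<forall>t\<in>times s. \<forall>x\<in>closure (Elt s).
        ((\<lambda>\<alpha>. Phi s \<alpha> x *v coeffs s t \<alpha>) has_sum state s t x) UNIV) \<and>
     (\<forall>t\<in>times s. \<forall>\<alpha>.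
        (\<lambda>\<beta>. MH s t \<alpha> \<beta> *v Udot s t \<beta>) summable_on UNIV \<and>
        (\<lambda>\<beta>. NH s t \<alpha> \<beta> *v coeffs s t \<beta>) summable_on UNIV \<and>
        bapp (MH s t) (Udot s t) \<alpha> + bapp (NH s t) (coeffs s t) \<alpha> = 0) \<and>
     (\<forall>t\<in>times s. cholesky_factor (MH s t) (chol s t)) \<and>
     (\<forall>t\<in>times s. \<forall>\<alpha> \<beta>. (\<lambda>r. chol s r \<alpha> \<beta>) differentiable (at t))"

text \<open>
  The convention that infinite products converge, and that series may be rearranged,
  differentiated termwise and interchanged with integration, is made precise by the following
  predicates.

  \<open>rearrangeable\<close>: the multiple series arising from the products \<open>X (R U)\<close> and
  \<open>(R U)\<^sup>T X (R U)\<close> converge unconditionally.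
\<close>

definition rearrangeable :: "'m::finite bmat \<Rightarrow> 'm bvec \<Rightarrow> 'm bmat \<Rightarrow> bool" where
  "rearrangeable R U X \<longleftrightarrow>
     (\<forall>\<alpha>. (\<lambda>(\<beta>, \<gamma>). X \<alpha> \<beta> *v (R \<beta> \<gamma> *v U \<gamma>)) summable_on UNIV) \<and>
     (\<lambda>(\<alpha>, \<beta>, \<gamma>, \<delta>). (R \<alpha> \<gamma> *v U \<gamma>) \<bullet> (X \<alpha> \<beta> *v (R \<beta> \<delta> *v U \<delta>))) summable_on UNIV"

definition termwise_differentiable :: "real set \<Rightarrow> (nat \<Rightarrow> real \<Rightarrow> 'a::real_normed_vector) \<Rightarrow> bool" where
  "termwise_differentiable T f \<longleftrightarrow>
     (\<forall>t\<in>T. (\<lambda>n. f n t) summable_on UNIV \<and>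
        (\<lambda>n. vector_derivative (f n) (at t)) summable_on UNIV \<and>
        ((\<lambda>r. \<Sum>\<^sub>\<infinity>n. f n r) has_vector_derivative (\<Sum>\<^sub>\<infinity>n. vector_derivative (f n) (at t))) (at t))"

definition sum_integral_interchange :: "'x measure \<Rightarrow> ('i \<Rightarrow> 'x \<Rightarrow> real) \<Rightarrow> bool" where
  "sum_integral_interchange \<mu> f \<longleftrightarrow>
     ((\<lambda>i. LINT x|\<mu>. f i x) has_sum (LINT x|\<mu>. (\<Sum>\<^sub>\<infinity>i. f i x))) UNIV"

text \<open>The double series of \<open>u\<^sup>T Q u\<close> for \<open>u = (\<Sum>\<alpha>. \<Phi>\<^sub>\<alpha> U\<^sub>\<alpha>)\<close>.\<close>

definition modal_form ::
  "('d::finite, 'm::finite) ieig \<Rightarrow> real \<Rightarrow> (real^'d \<Rightarrow> real^'m^'m) \<Rightarrow> nat \<times> nat \<Rightarrow> real^'d \<Rightarrow> real" where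
  "modal_form s t Q = (\<lambda>(\<alpha>, \<beta>) x.
     (Phi s \<alpha> x *v coeffs s t \<alpha>) \<bullet> (Q x *v (Phi s \<beta> x *v coeffs s t \<beta>)))"

definition convergence_convention :: "('d::finite, 'm::{finite,linorder}) ieig \<Rightarrow> bool" where
  "convergence_convention s \<longleftrightarrow>
     (\<forall>\<alpha>. termwise_differentiable (times s) (\<lambda>\<beta> t. chol s t \<alpha> \<beta> *v coeffs s t \<beta>)) \<and>
     termwise_differentiable (times s) (\<lambda>\<alpha> t. Emode s t \<alpha>) \<and>
     (\<forall>t\<in>times s.
        rearrangeable (chol s t) (coeffs s t) (orth s t (NH s t)) \<and>
        rearrangeable (chol s t) (coeffs s t) (orth s t (VH s t)) \<and>
        rearrangeable (chol s t) (coeffs s t) (orth s t (BH s t)) \<and>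
        rearrangeable (chol s t) (coeffs s t) (orth s t (BHD s t)) \<and>
        rearrangeable (chol s t) (coeffs s t) (Smat s t)) \<and>
     (\<forall>t\<in>times s.
        sum_integral_interchange (lebesgue_on (Elt s))
          (modal_form s t (\<lambda>x. vector_derivative (\<lambda>r. Hx s r x) (at t))) \<and>
        sum_integral_interchange (lebesgue_on (Elt s)) (modal_form s t (divHA s t)) \<and>
        sum_integral_interchange (surface_measure (Elt s)) (modal_form s t (normalHDA s t)))"

definition ieig_system :: "('d::finite, 'm::{finite,linorder}) ieig \<Rightarrow> bool" where
  "ieig_system s \<longleftrightarrow>
     physical_setting s \<and> element (Elt s) (normal s) \<and> orthonormal_poly_basis (Elt s) (phi s) \<and>
     ieig_solution s"

end

theory Submission
  imports Defs
begin

text \<open>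
  Write \<open>w = R U\<close> for the \<open>H\<close>-orthogonalized coefficients and \<open>X\<^sup>o = R\<^sup>-\<^sup>T X R\<^sup>-\<^sup>1\<close>.  The rows of
  \<open>R\<^sup>-\<^sup>T\<close> are finite, so the coefficient equation \<open>M U' + N U = 0\<close> with \<open>M = R\<^sup>T R\<close> may be multiplied
  by \<open>R\<^sup>-\<^sup>T\<close>; together with the termwise derivative of \<open>R U\<close> this gives \<open>w' = (S - N\<^sup>o) w\<close>
  (\<open>Uo_evolution\<close>).  Three facts split the right-hand side into a skew-symmetric part and a boundary part.

  \<^item> \<open>H A\<^sub>k\<close> is symmetric: \<open>H\<close> is a multiple of the Hessian of \<open>e\<close>, and the Hessian of \<open>e\<close> symmetrizes
    \<open>A\<^sub>k\<close> because of the flux relation \<open>\<nabla>e\<^sup>T A\<^sub>k = \<nabla>g\<^sub>k\<^sup>T\<close> (\<open>hessian_Amat_symmetric\<close>).  The divergence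
    theorem then yields \<open>N + N\<^sup>T + V = B\<close> (\<open>integration_by_parts\<close>).  Hence the symmetric part of \<open>N\<^sup>o\<close> is
    \<open>(B\<^sup>o - V\<^sup>o)/2\<close>, and the equation becomes
    \<open>w' = - (N\<^sup>o\<^sub>s\<^sub>k\<^sub>w - S\<^sub>s\<^sub>k\<^sub>w) w - (B\<^sup>o + B\<^sub>\<Delta>\<^sup>o) w / 2 + C w\<close>, where \<open>C\<close> is the symmetric matrix
    \<open>C = (S + S\<^sup>T + V\<^sup>o + B\<^sub>\<Delta>\<^sup>o)/2\<close>.

  \<^item> \<open>w\<^sup>T C w = 0\<close> (\<open>CH_form\<close>).  This is conservation of energy.  Since
    \<open>R\<^sup>T (S + S\<^sup>T) R = M'\<close>, the number \<open>2 w\<^sup>T C w\<close> is the volume integral of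
    \<open>u\<^sup>T H\<^sub>t u + u\<^sup>T \<partial>\<^sub>k(H A\<^sub>k) u\<close> plus the surface integral of \<open>u\<^sup>T H \<Delta>A\<^sub>k u n\<^sub>k\<close>.  Because of
    \<open>e = u\<^sup>T H u / 2\<close>, \<open>g\<^sub>k = u\<^sup>T G\<^sub>k u / 2\<close> and \<open>e\<^sub>t = - \<partial>\<^sub>k g\<^sub>k\<close>, the volume integrand is
    \<open>- \<partial>\<^sub>k (u\<^sup>T H \<Delta>A\<^sub>k u)\<close> (\<open>energy_balance\<close>), so that the two integrals cancel.

  \<^item> If \<open>C\<close> is symmetric with \<open>w\<^sup>T C w = 0\<close>, then \<open>K = (C w w\<^sup>T - w w\<^sup>T C) / |w|\<^sup>2\<close> is skew-symmetric and
    \<open>K w = C w\<close> (\<open>rank_two_skew_antisymmetric\<close>, \<open>rank_two_skew_apply\<close>).  So \<open>C w\<close> can be moved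
    into the skew part.

  Taking inner products with \<open>w\<^sub>\<alpha>\<close> gives the energy equation of a mode, and the double sum of the
  transfer terms vanishes because the quadratic form of a skew-symmetric matrix does.

  Products of infinite matrices need care, since they are not associative in general.  Multiplication
  by an upper triangular matrix from the right, or by the transpose of one from the left, is a finite
  sum.  All other changes of the order of summation are instances of Fubini's theorem for
  unconditionally convergent multiple series (\<open>row_rearrange\<close>, \<open>quadratic_rearrange\<close>).
\<close>

section \<open>Upper triangular block matrices\<close>

lemma bounded_bilinear_matrix_mult:
  "bounded_bilinear ((**) :: real^'n^'m \<Rightarrow> real^'p^'n \<Rightarrow> real^'p^'m)"
  unfolding bilinear_conv_bounded_bilinear[symmetric] bilinear_def
  by (auto intro!: linearI simp:
     vec_eq_iff matrix_matrix_mult_def sum.distrib algebra_simps sum_distrib_left)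

lemma bounded_bilinear_matrix_vector_mult:
  "bounded_bilinear ((*v) :: real^'n^'m \<Rightarrow> real^'n \<Rightarrow> real^'m)"
  unfolding bilinear_conv_bounded_bilinear[symmetric] bilinear_def
  by (auto intro!: linearI simp:
     vec_eq_iff matrix_vector_mult_def sum.distrib algebra_simps sum_distrib_left)

lemma bounded_linear_transpose:
  "bounded_linear (transpose :: real^'n^'m \<Rightarrow> real^'m^'n)"
  unfolding linear_conv_bounded_linear[symmetric]
  by (auto intro!: linearI simp: vec_eq_iff transpose_def)

lemmas matrix_mult_sum_left = bounded_bilinear.sum_left[OF bounded_bilinear_matrix_mult]
lemmas matrix_mult_sum_right = bounded_bilinear.sum_right[OF bounded_bilinear_matrix_mult]
lemmas matrix_vector_sum_left = bounded_bilinear.sum_left[OF bounded_bilinear_matrix_vector_mult]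
lemmas transpose_sum = linear_sum[OF bounded_linear.linear[OF bounded_linear_transpose]]
lemmas matrix_mult_zero_left = bounded_bilinear.zero_left[OF bounded_bilinear_matrix_mult]
lemmas matrix_mult_zero_right = bounded_bilinear.zero_right[OF bounded_bilinear_matrix_mult]
lemmas transpose_zero = linear_0[OF bounded_linear.linear[OF bounded_linear_transpose]]

text \<open>
  A block row times an upper triangular matrix.  Only the terms with \<open>\<gamma> \<le> \<beta>\<close> can be nonzero, so this finite
  sum replaces the infinite one of \<^const>\<open>bmult\<close>.
\<close>

definition row_mult :: "(nat \<Rightarrow> real^'m^'m) \<Rightarrow> 'm::finite bmat \<Rightarrow> nat \<Rightarrow> real^'m^'m" where
  "row_mult Z A \<beta> = (\<Sum>\<gamma>\<le>\<beta>. Z \<gamma> ** A \<gamma> \<beta>)"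

lemma bmult_upper_right:
  assumes "bupper A"
  shows "bmult X A \<alpha> \<beta> = row_mult (X \<alpha>) A \<beta>"
proof -
  have "((\<lambda>\<gamma>. X \<alpha> \<gamma> ** A \<gamma> \<beta>) has_sum (\<Sum>\<gamma>\<le>\<beta>. X \<alpha> \<gamma> ** A \<gamma> \<beta>)) UNIV"
    by (rule has_sum_finite_neutralI)
       (use assms in \<open>auto simp: bupper_def not_le matrix_mult_zero_right\<close>)
  then show ?thesis by (simp add: bmult_def row_mult_def infsumI)
qed

lemma bmult_lower_left:
  assumes "bupper A"
  shows "bmult (btrans A) X \<alpha> \<beta> = (\<Sum>\<gamma>\<le>\<alpha>. transpose (A \<gamma> \<alpha>) ** X \<gamma> \<beta>)"
proof -
  have "((\<lambda>\<gamma>. transpose (A \<gamma> \<alpha>) ** X \<gamma> \<beta>) has_sum (\<Sum>\<gamma>\<le>\<alpha>. transpose (A \<gamma> \<alpha>) ** X \<gamma> \<beta>)) UNIV"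
    by (rule has_sum_finite_neutralI)
       (use assms in \<open>auto simp: bupper_def not_le transpose_zero matrix_mult_zero_left\<close>)
  then show ?thesis by (simp add: bmult_def btrans_def infsumI)
qed

text \<open>
  Products of infinite matrices are not associative in general; here both sides are finite double sums
  over indices up to \<open>\<beta>\<close>, whose order may be exchanged.
\<close>

lemma row_mult_assoc:
  assumes "bupper A" "bupper B"
  shows "row_mult (row_mult Z A) B = row_mult Z (bmult A B)"
proof
  fix \<beta>
  have "row_mult (row_mult Z A) B \<beta> = (\<Sum>\<gamma>\<le>\<beta>. (\<Sum>\<delta>\<le>\<gamma>. Z \<delta> ** A \<delta> \<gamma>) ** B \<gamma> \<beta>)"
    by (simp add: row_mult_def)
  also have "\<dots> = (\<Sum>\<gamma>\<le>\<beta>. (\<Sum>\<delta>\<le>\<beta>. Z \<delta> ** A \<delta> \<gamma>) ** B \<gamma> \<beta>)"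
    by (intro sum.cong refl arg_cong2[where f="(**)"] sum.mono_neutral_left)
       (use assms(1) in \<open>auto simp: bupper_def not_le matrix_mult_zero_right\<close>)
  also have "\<dots> = (\<Sum>\<gamma>\<le>\<beta>. \<Sum>\<delta>\<le>\<beta>. Z \<delta> ** (A \<delta> \<gamma> ** B \<gamma> \<beta>))"
    by (simp add: matrix_mult_sum_left matrix_mul_assoc)
  also have "\<dots> = (\<Sum>\<delta>\<le>\<beta>. \<Sum>\<gamma>\<le>\<beta>. Z \<delta> ** (A \<delta> \<gamma> ** B \<gamma> \<beta>))"
    by (rule sum.swap)
  also have "\<dots> = row_mult Z (bmult A B) \<beta>"
    by (simp add: row_mult_def bmult_upper_right[OF assms(2)] matrix_mult_sum_right)
  finally show "row_mult (row_mult Z A) B \<beta> = row_mult Z (bmult A B) \<beta>" .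
qed

lemma row_mult_bid: "row_mult Z bid = Z"
proof
  fix \<beta>
  have "row_mult Z bid \<beta> = (\<Sum>\<gamma>\<le>\<beta>. if \<gamma> = \<beta> then Z \<beta> else 0)"
    unfolding row_mult_def
    by (intro sum.cong refl) (auto simp: bid_def matrix_mult_zero_right matrix_mul_rid)
  then show "row_mult Z bid \<beta> = Z \<beta>" by simp
qed

lemma bmult_assoc_upper:
  assumes "bupper A" "bupper B"
  shows "bmult (bmult X A) B = bmult X (bmult A B)"
proof -
  have AB: "bupper (bmult A B)"
    unfolding bupper_def bmult_upper_right[OF assms(2)] row_mult_def
    using assms
    by (auto intro!: sum.neutral simp: bupper_def matrix_mult_zero_left)
  have r: "bmult X A \<alpha> = row_mult (X \<alpha>) A" for \<alpha>
    using bmult_upper_right[OF assms(1)] by blast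
  have "bmult (bmult X A) B \<alpha> \<beta> = bmult X (bmult A B) \<alpha> \<beta>" for \<alpha> \<beta>
    by (simp add: bmult_upper_right[OF assms(2)] bmult_upper_right[OF AB] r row_mult_assoc[OF assms])
  then show ?thesis by blast
qed

lemma bupper_bid: "bupper bid" by (simp add: bupper_def bid_def)

lemma bmult_bid_right: "bmult X bid = X"
  by (intro ext) (simp add: bmult_upper_right[OF bupper_bid] row_mult_bid)

lemma bmult_bid_left: "bupper X \<Longrightarrow> bmult bid X = X"
proof (intro ext)
  fix \<alpha> \<beta> assume "bupper X"
  then have "bmult bid X \<alpha> \<beta> = (\<Sum>\<gamma>\<le>\<beta>. if \<gamma> = \<alpha> then X \<alpha> \<beta> else 0)"
    unfolding bmult_upper_right[OF \<open>bupper X\<close>] row_mult_def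
    by (intro sum.cong refl) (auto simp: bid_def matrix_mult_zero_left matrix_mul_lid)
  then show "bmult bid X \<alpha> \<beta> = X \<alpha> \<beta>" using \<open>bupper X\<close> by (auto simp: bupper_def not_le)
qed

text \<open>
  Solves \<open>Y A = I\<close> by forward substitution along each row.  The case distinction inserts the zeros
  below the diagonal by hand, so that triangularity can be read off before the equation is solved.
\<close>

fun upper_left_inverse :: "'m::finite bmat \<Rightarrow> 'm bmat" where
  "upper_left_inverse A \<alpha> \<beta> =
     (bid \<alpha> \<beta> - (\<Sum>\<gamma><\<beta>. if \<gamma> < \<alpha> then 0 else upper_left_inverse A \<alpha> \<gamma> ** A \<gamma> \<beta>))
       ** matrix_inv (A \<beta> \<beta>)"
declare upper_left_inverse.simps[simp del]

lemma matrix_inv_left: "invertible A \<Longrightarrow> matrix_inv A ** A = mat 1"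
  for A :: "real^'m^'m"
  unfolding invertible_def matrix_inv_def by (rule someI2_ex) auto

lemma matrix_inv_right: "invertible A \<Longrightarrow> A ** matrix_inv A = mat 1"
  for A :: "real^'m^'m"
  unfolding invertible_def matrix_inv_def by (rule someI2_ex) auto

lemma upper_left_inverse_exists:
  assumes A: "bupper A" and inv: "\<And>\<alpha>. invertible (A \<alpha> \<alpha>)"
  shows "\<exists>Y. bupper Y \<and> bmult Y A = bid \<and> (\<forall>\<alpha>. invertible (Y \<alpha> \<alpha>))"
proof (intro exI conjI allI)
  let ?Y = "upper_left_inverse A"
  show up: "bupper ?Y"
    unfolding bupper_def
  proof (intro allI impI)
    fix \<alpha> \<beta> :: nat assume "\<beta> < \<alpha>"
    then have "(\<Sum>\<gamma><\<beta>. if \<gamma> < \<alpha> then 0 else ?Y \<alpha> \<gamma> ** A \<gamma> \<beta>) = 0"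
      by (intro sum.neutral) auto
    then show "?Y \<alpha> \<beta> = 0"
      using \<open>\<beta> < \<alpha>\<close> by (subst upper_left_inverse.simps) (simp add: bid_def matrix_mult_zero_left)
  qed
  have Y: "?Y \<alpha> \<beta> = (bid \<alpha> \<beta> - (\<Sum>\<gamma><\<beta>. ?Y \<alpha> \<gamma> ** A \<gamma> \<beta>)) ** matrix_inv (A \<beta> \<beta>)" for \<alpha> \<beta>
  proof -
    have "(\<Sum>\<gamma><\<beta>. if \<gamma> < \<alpha> then 0 else ?Y \<alpha> \<gamma> ** A \<gamma> \<beta>) = (\<Sum>\<gamma><\<beta>. ?Y \<alpha> \<gamma> ** A \<gamma> \<beta>)"
      using up by (intro sum.cong refl) (auto simp: bupper_def matrix_mult_zero_left)
    then show ?thesis using upper_left_inverse.simps[of A \<alpha> \<beta>] by simp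
  qed
  have "bmult ?Y A \<alpha> \<beta> = bid \<alpha> \<beta>" for \<alpha> \<beta>
  proof -
    have "?Y \<alpha> \<beta> ** A \<beta> \<beta> = bid \<alpha> \<beta> - (\<Sum>\<gamma><\<beta>. ?Y \<alpha> \<gamma> ** A \<gamma> \<beta>)"
      by (subst Y) (simp add: matrix_mul_assoc[symmetric] matrix_inv_left[OF inv] matrix_mul_rid)
    then show ?thesis
      by (simp add: bmult_upper_right[OF A] row_mult_def lessThan_Suc_atMost[symmetric])
  qed
  then show "bmult ?Y A = bid" by blast
  fix \<alpha>
  have "(\<Sum>\<gamma><\<alpha>. ?Y \<alpha> \<gamma> ** A \<gamma> \<alpha>) = 0"
    using up by (intro sum.neutral) (auto simp: bupper_def matrix_mult_zero_left)
  then have "?Y \<alpha> \<alpha> = matrix_inv (A \<alpha> \<alpha>)"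
    by (subst Y) (simp add: bid_def matrix_mul_lid)
  then show "invertible (?Y \<alpha> \<alpha>)"
    using matrix_inv_left[OF inv] matrix_inv_right[OF inv] unfolding invertible_def by metis
qed

text \<open>
  A left inverse \<open>Y\<close> of \<open>A\<close> is again upper triangular with invertible diagonal blocks, so it has a left
  inverse \<open>Z\<close> itself; then \<open>Z = Z (Y A) = A\<close>, that is, \<open>Y\<close> is a two-sided inverse.
\<close>

lemma binv_works:
  assumes A: "bupper A" and inv: "\<And>\<alpha>. invertible (A \<alpha> \<alpha>)"
  shows "bupper (binv A)" "bmult A (binv A) = bid" "bmult (binv A) A = bid"
proof -
  obtain Y where Y: "bupper Y" "bmult Y A = bid" "\<And>\<alpha>. invertible (Y \<alpha> \<alpha>)"
    using upper_left_inverse_exists[OF assms] by blast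
  obtain Z where Z: "bupper Z" "bmult Z Y = bid"
    using upper_left_inverse_exists[OF Y(1) Y(3)] by blast
  have "Z = bmult Z (bmult Y A)" by (simp add: Y bmult_bid_right)
  also have "\<dots> = A" 
    using bmult_assoc_upper[OF Y(1) A, of Z] Z A by (simp add: bmult_bid_left)
  finally have AY: "bmult A Y = bid" using Z by simp
  have "W = Y" if "bupper W" "bmult A W = bid" for W
  proof -
    have "W = bmult (bmult Y A) W" using that Y by (simp add: bmult_bid_left)
    also have "\<dots> = Y" using that by (simp add: bmult_assoc_upper[OF A] bmult_bid_right)
    finally show ?thesis .
  qed
  then have "\<exists>!Y. bupper Y \<and> bmult A Y = bid \<and> bmult Y A = bid"
    using Y AY by blast
  then have *: "bupper (binv A) \<and> bmult A (binv A) = bid \<and> bmult (binv A) A = bid"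
    unfolding binv_def by (rule theI')
  show "bupper (binv A)" "bmult A (binv A) = bid" "bmult (binv A) A = bid"
    using * by blast+
qed

text \<open>
  If \<open>A v = 0\<close> with \<open>v \<noteq> 0\<close> and \<open>i\<close> is the last index with \<open>v\<^sub>i \<noteq> 0\<close>, then row \<open>i\<close> of the equation reads
  \<open>A\<^sub>i\<^sub>i v\<^sub>i = 0\<close>.
\<close>

lemma upper_triangular_invertible:
  fixes A :: "real^'m::{finite,linorder}^'m::{finite,linorder}"
  assumes low: "\<And>i j. j < i \<Longrightarrow> A $ i $ j = 0" and pos: "\<And>i. 0 < A $ i $ i"
  shows "invertible A"
proof -
  have "v = 0" if "A *v v = 0" for v
  proof (rule ccontr)
    assume "v \<noteq> 0"
    then have ne: "{i. v $ i \<noteq> 0} \<noteq> {}" by (auto simp: vec_eq_iff)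
    define i where "i = Max {i. v $ i \<noteq> 0}"
    have i: "v $ i \<noteq> 0" using Max_in[OF finite ne] by (auto simp: i_def)
    have "v $ j = 0" if "i < j" for j
    proof (rule ccontr)
      assume "v $ j \<noteq> 0"
      then have "j \<le> i" unfolding i_def by (intro Max_ge) auto
      with that show False by simp
    qed
    then have "A $ i $ j * v $ j = (if j = i then A $ i $ i * v $ i else 0)" for j
      using low by (cases i j rule: linorder_cases) auto
    then have "(\<Sum>j\<in>UNIV. A $ i $ j * v $ j) = (\<Sum>j\<in>UNIV. if j = i then A $ i $ i * v $ i else 0)"
      by (intro sum.cong refl)
    then have "(A *v v) $ i = A $ i $ i * v $ i"
      by (simp add: matrix_vector_mult_def)
    then show False using that i pos[of i] by simp
  qed
  then show ?thesis
    using matrix_left_invertible_ker invertible_left_inverse by blast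
qed

lemma cholesky_factor_binv:
  assumes "cholesky_factor M R"
  shows "bupper R" "bupper (binv R)" "bmult R (binv R) = bid" "bmult (binv R) R = bid"
    "M = bmult (btrans R) R"
proof -
  show R: "bupper R" and "M = bmult (btrans R) R" using assms by (auto simp: cholesky_factor_def)
  have "invertible (R \<alpha> \<alpha>)" for \<alpha>
    using assms by (intro upper_triangular_invertible) (auto simp: cholesky_factor_def)
  from binv_works[OF R this]
  show "bupper (binv R)" "bmult R (binv R) = bid" "bmult (binv R) R = bid" by auto
qed

text \<open>
  \<open>Y\<^sup>T X Y\<close>.  For \<open>Y = R\<^sup>-\<^sup>1\<close> this is the \<open>H\<close>-orthogonalization \<^const>\<open>orth\<close>.
\<close>

definition congruence :: "'m::finite bmat \<Rightarrow> 'm bmat \<Rightarrow> 'm bmat" where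
  "congruence Y X = bmult (bmult (btrans Y) X) Y"

lemma congruence_sum:
  assumes "bupper Y"
  shows "congruence Y X \<alpha> \<beta> = (\<Sum>\<delta>\<le>\<beta>. \<Sum>\<gamma>\<le>\<alpha>. transpose (Y \<gamma> \<alpha>) ** X \<gamma> \<delta> ** Y \<delta> \<beta>)"
  using assms
  by (simp add: congruence_def bmult_upper_right bmult_lower_left row_mult_def matrix_mult_sum_left)

lemma congruence_transpose:
  assumes "bupper Y"
  shows "congruence Y (btrans X) \<alpha> \<beta> = transpose (congruence Y X \<beta> \<alpha>)"
  unfolding congruence_sum[OF assms] transpose_sum 
  by (subst sum.swap) (simp add: matrix_transpose_mul matrix_mul_assoc btrans_def)

lemma congruence_add:
  assumes "bupper Y"
  shows "congruence Y (\<lambda>\<alpha> \<beta>. X \<alpha> \<beta> + Z \<alpha> \<beta>) \<alpha> \<beta> = congruence Y X \<alpha> \<beta> + congruence Y Z \<alpha> \<beta>"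
  unfolding congruence_sum[OF assms] 
  by (simp add: matrix_add_ldistrib bounded_bilinear.add_left[OF bounded_bilinear_matrix_mult] sum.distrib)

lemma congruence_row_cancel:
  assumes R: "bupper R" "bupper Y" "bmult Y R = bid"
  shows "row_mult (congruence Y X \<alpha>) R \<gamma> = bmult (btrans Y) X \<alpha> \<gamma>"
proof -
  have "congruence Y X \<alpha> = row_mult (bmult (btrans Y) X \<alpha>) Y"
    by (rule ext) (simp add: congruence_def bmult_upper_right[OF R(2)])
  then show ?thesis using R by (simp add: row_mult_assoc row_mult_bid)
qed

text \<open>
  \<open>R\<^sup>T (Y\<^sup>T X) = X\<close> for \<open>Y = R\<^sup>-\<^sup>1\<close>, reduced by transposition to associativity of upper triangular products.
\<close>

lemma congruence_column_cancel:
  assumes R: "bupper R" "bupper Y" "bmult Y R = bid"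
  shows "(\<Sum>\<alpha>\<le>\<gamma>. transpose (R \<alpha> \<gamma>) ** bmult (btrans Y) X \<alpha> \<delta>) = X \<gamma> \<delta>"
proof -
  let ?Z = "\<lambda>\<gamma>. transpose (X \<gamma> \<delta>)"
  have "bmult (btrans Y) X \<alpha> \<delta> = transpose (row_mult ?Z Y \<alpha>)" for \<alpha>
    by (simp add: bmult_lower_left[OF R(2)] row_mult_def transpose_sum matrix_transpose_mul)
  then have "(\<Sum>\<alpha>\<le>\<gamma>. transpose (R \<alpha> \<gamma>) ** bmult (btrans Y) X \<alpha> \<delta>)
      = transpose (row_mult (row_mult ?Z Y) R \<gamma>)"
    by (simp add: row_mult_def[of _ R] transpose_sum matrix_transpose_mul)
  also have "\<dots> = X \<gamma> \<delta>" using R by (simp add: row_mult_assoc row_mult_bid)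
  finally show ?thesis .
qed

lemma congruence_cancel:
  assumes "bupper R" "bupper Y" "bmult Y R = bid"
  shows "(\<Sum>\<alpha>\<le>\<gamma>. \<Sum>\<beta>\<le>\<delta>. transpose (R \<alpha> \<gamma>) ** congruence Y X \<alpha> \<beta> ** R \<beta> \<delta>) = X \<gamma> \<delta>"
proof -
  have "(\<Sum>\<beta>\<le>\<delta>. transpose (R \<alpha> \<gamma>) ** congruence Y X \<alpha> \<beta> ** R \<beta> \<delta>)
      = transpose (R \<alpha> \<gamma>) ** bmult (btrans Y) X \<alpha> \<delta>" for \<alpha>
    using congruence_row_cancel[OF assms, of X \<alpha> \<delta>]
    by (simp add: row_mult_def matrix_mult_sum_right[symmetric] matrix_mul_assoc[symmetric])
  then show ?thesis using congruence_column_cancel[OF assms] by simp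
qed

section \<open>Rearrangement of multiple series\<close>

lemma summable_on_norm_euclidean:
  fixes f :: "'i \<Rightarrow> 'b::euclidean_space"
  assumes "f summable_on A"
  shows "(\<lambda>x. norm (f x)) summable_on A"
proof -
  have "(\<lambda>x. \<bar>f x \<bullet> b\<bar>) summable_on A" for b
    using summable_on_iff_abs_summable_on_real[THEN iffD1,
        OF summable_on_bounded_linear[OF bounded_linear_inner_left[of b] assms]]
    by (simp add: o_def)
  then have "(\<lambda>x. \<Sum>b\<in>B. \<bar>f x \<bullet> b\<bar>) summable_on A" for B
    by (induction B rule: infinite_finite_induct) (auto intro: summable_on_add)
  from this[of Basis] show ?thesis
    by (rule summable_on_comparison_test) (auto simp: norm_le_l1)
qed

text \<open>
  Unconditional summability in a Euclidean space is absolute, so the double family is dominated by the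
  product of the two families of norms; its sum is then found by summing over \<open>j\<close> first.
\<close>

lemma has_sum_bilinear:
  fixes p :: "'i \<Rightarrow> 'a::euclidean_space" and q :: "'j \<Rightarrow> 'b::euclidean_space"
    and h :: "'a \<Rightarrow> 'b \<Rightarrow> 'c::banach"
  assumes h: "bounded_bilinear h" and p: "(p has_sum P) UNIV" and q: "(q has_sum Q) UNIV"
  shows "((\<lambda>(i, j). h (p i) (q j)) has_sum h P Q) UNIV"
proof -
  obtain K where K: "norm (h a b) \<le> norm a * norm b * K" for a b
    using bounded_bilinear.bounded[OF h] by blast
  have "(\<lambda>(i, j). norm (p i) * norm (q j)) summable_on UNIV \<times> UNIV"
  proof (rule summable_on_SigmaI)
    show "((\<lambda>j. (\<lambda>(i, j). norm (p i) * norm (q j)) (i, j)) has_sum norm (p i) * (\<Sum>\<^sub>\<infinity>j. norm (q j))) UNIV" for i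
      using summable_on_norm_euclidean[OF has_sum_imp_summable[OF q]]
      by (auto intro!: has_sum_cmult_right has_sum_infsum)
    show "(\<lambda>i. norm (p i) * (\<Sum>\<^sub>\<infinity>j. norm (q j))) summable_on UNIV"
      by (intro summable_on_cmult_left summable_on_norm_euclidean[OF has_sum_imp_summable[OF p]])
  qed auto
  then have "(\<lambda>ij. K * (\<lambda>(i, j). norm (p i) * norm (q j)) ij) summable_on UNIV \<times> UNIV"
    by (rule summable_on_cmult_right)
  then have "(\<lambda>ij. norm ((\<lambda>(i, j). h (p i) (q j)) ij)) summable_on UNIV \<times> UNIV"
    by (rule summable_on_comparison_test) (use K in \<open>auto simp: mult.commute\<close>)
  then have "(\<lambda>(i, j). h (p i) (q j)) summable_on UNIV \<times> UNIV"
    by (rule abs_summable_summable)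
  then obtain S where S: "((\<lambda>(i, j). h (p i) (q j)) has_sum S) (UNIV \<times> UNIV)"
    by (auto simp: summable_on_def)
  have "((\<lambda>i. h (p i) Q) has_sum S) UNIV"
    using S by (rule has_sum_SigmaD)
      (simp, rule has_sum_bounded_linear[OF bounded_bilinear.bounded_linear_right[OF h] q, unfolded o_def])
  moreover have "((\<lambda>i. h (p i) Q) has_sum h P Q) UNIV"
    by (rule has_sum_bounded_linear[OF bounded_bilinear.bounded_linear_left[OF h] p, unfolded o_def])
  ultimately have "S = h P Q" by (rule has_sum_unique)
  with S show ?thesis by simp
qed

lemma bapp_has_sum:
  assumes "(\<lambda>\<beta>. R \<alpha> \<beta> *v U \<beta>) summable_on UNIV"
  shows "((\<lambda>\<beta>. R \<alpha> \<beta> *v U \<beta>) has_sum bapp R U \<alpha>) UNIV"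
  using assms by (simp add: bapp_def)

text \<open>
  \<open>Z (R U) = (Z R) U\<close>: both sides are iterated sums of the same unconditionally convergent double
  series.  The inner sum is a finite one when the row index of \<open>R\<close> is summed first.
\<close>

lemma row_rearrange:
  fixes R :: "'m::finite bmat" and U :: "'m bvec"
  assumes up: "bupper R" and R: "\<And>\<alpha>. (\<lambda>\<beta>. R \<alpha> \<beta> *v U \<beta>) summable_on UNIV"
    and Z: "(\<lambda>(\<beta>, \<gamma>). Z \<beta> *v (R \<beta> \<gamma> *v U \<gamma>)) summable_on UNIV"
  obtains S where "((\<lambda>\<beta>. Z \<beta> *v bapp R U \<beta>) has_sum S) UNIV"
    "((\<lambda>\<gamma>. row_mult Z R \<gamma> *v U \<gamma>) has_sum S) UNIV"
proof -
  obtain S where S: "((\<lambda>(\<beta>, \<gamma>). Z \<beta> *v (R \<beta> \<gamma> *v U \<gamma>)) has_sum S) (UNIV \<times> UNIV)"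
    using Z by (auto simp: summable_on_def)
  have "((\<lambda>\<beta>. Z \<beta> *v bapp R U \<beta>) has_sum S) UNIV"
    using S by (rule has_sum_SigmaD)
      (simp, rule has_sum_bounded_linear[OF matrix_vector_mul_bounded_linear bapp_has_sum[OF R], unfolded o_def])
  moreover have "((\<lambda>\<gamma>. row_mult Z R \<gamma> *v U \<gamma>) has_sum S) UNIV"
  proof (rule has_sum_SigmaD)
    show "((\<lambda>(\<gamma>, \<beta>). Z \<beta> *v (R \<beta> \<gamma> *v U \<gamma>)) has_sum S) (UNIV \<times> UNIV)"
      using S by (subst has_sum_swap) simp
    fix \<gamma>
    show "((\<lambda>\<beta>. (\<lambda>(\<gamma>, \<beta>). Z \<beta> *v (R \<beta> \<gamma> *v U \<gamma>)) (\<gamma>, \<beta>)) has_sum row_mult Z R \<gamma> *v U \<gamma>) UNIV"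
      by (rule has_sum_finite_neutralI[of "{..\<gamma>}"])
        (use up in \<open>auto simp: bupper_def not_le row_mult_def matrix_vector_sum_left matrix_vector_mul_assoc\<close>)
  qed
  ultimately show thesis by (rule that)
qed

lemma inner_vector_matrix_mult: "(v :: real^'n) \<bullet> (w v* A) = (A *v v) \<bullet> w"
  by (metis dot_lmul_matrix inner_commute)

text \<open>
  \<open>(R U)\<^sup>T X (R U) = U\<^sup>T (R\<^sup>T X R) U\<close>: a quadruple series is summed over \<open>(\<gamma>, \<delta>)\<close> first, which gives the left-hand
  side, or over \<open>(\<alpha>, \<beta>)\<close> first, which is a finite sum and gives the right-hand side.
\<close>

lemma quadratic_rearrange:
  fixes R :: "'m::finite bmat" and U :: "'m bvec"
  assumes up: "bupper R" and R: "\<And>\<alpha>. (\<lambda>\<beta>. R \<alpha> \<beta> *v U \<beta>) summable_on UNIV"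
    and X: "(\<lambda>(\<alpha>, \<beta>, \<gamma>, \<delta>). (R \<alpha> \<gamma> *v U \<gamma>) \<bullet> (X \<alpha> \<beta> *v (R \<beta> \<delta> *v U \<delta>))) summable_on UNIV"
  obtains S where "((\<lambda>(\<alpha>, \<beta>). bapp R U \<alpha> \<bullet> (X \<alpha> \<beta> *v bapp R U \<beta>)) has_sum S) UNIV"
    "((\<lambda>(\<gamma>, \<delta>). U \<gamma> \<bullet> ((\<Sum>\<alpha>\<le>\<gamma>. \<Sum>\<beta>\<le>\<delta>. transpose (R \<alpha> \<gamma>) ** X \<alpha> \<beta> ** R \<beta> \<delta>) *v U \<delta>)) has_sum S) UNIV"
proof -
  let ?f = "\<lambda>((\<alpha>, \<beta>), (\<gamma>, \<delta>)). (R \<alpha> \<gamma> *v U \<gamma>) \<bullet> (X \<alpha> \<beta> *v (R \<beta> \<delta> *v U \<delta>))"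
  let ?g = "\<lambda>((\<gamma>, \<delta>), (\<alpha>, \<beta>)). (R \<alpha> \<gamma> *v U \<gamma>) \<bullet> (X \<alpha> \<beta> *v (R \<beta> \<delta> *v U \<delta>))"
  have "?f summable_on UNIV"
    using X
    by (subst (asm) summable_on_reindex_bij_betw[symmetric, of "\<lambda>((\<alpha>, \<beta>), (\<gamma>, \<delta>)). (\<alpha>, \<beta>, \<gamma>, \<delta>)" UNIV])
       (auto simp: bij_betw_def inj_on_def image_def case_prod_unfold)
  then obtain S where S: "(?f has_sum S) (UNIV \<times> UNIV)"
    by (auto simp: summable_on_def)
  have bil: "bounded_bilinear (\<lambda>a b. a \<bullet> (A *v b))" for A :: "real^'m^'m"
    by (rule bounded_bilinear.comp[OF bounded_bilinear_inner bounded_linear_ident matrix_vector_mul_bounded_linear])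
  have "((\<lambda>(\<alpha>, \<beta>). bapp R U \<alpha> \<bullet> (X \<alpha> \<beta> *v bapp R U \<beta>)) has_sum S) UNIV"
    using S
    by (rule has_sum_SigmaD)
       (use has_sum_bilinear[OF bil bapp_has_sum[OF R] bapp_has_sum[OF R]] in \<open>auto simp: case_prod_unfold\<close>)
  moreover have "((\<lambda>(\<gamma>, \<delta>). U \<gamma> \<bullet> ((\<Sum>\<alpha>\<le>\<gamma>. \<Sum>\<beta>\<le>\<delta>. transpose (R \<alpha> \<gamma>) ** X \<alpha> \<beta> ** R \<beta> \<delta>) *v U \<delta>)) has_sum S) UNIV"
  proof (rule has_sum_SigmaD)
    show "(?g has_sum S) (UNIV \<times> UNIV)"
      using S by (subst has_sum_swap) (simp add: case_prod_unfold)
    fix gd :: "nat \<times> nat"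
    have zero: "R \<alpha> \<gamma> *v U \<gamma> = 0" if "\<not> \<alpha> \<le> \<gamma>" for \<alpha> \<gamma>
      using up that by (simp add: bupper_def)
    obtain \<gamma> \<delta> where gd: "gd = (\<gamma>, \<delta>)" by force
    have fin: "((\<lambda>(\<alpha>, \<beta>). (R \<alpha> \<gamma> *v U \<gamma>) \<bullet> (X \<alpha> \<beta> *v (R \<beta> \<delta> *v U \<delta>))) has_sum
         (\<Sum>(\<alpha>, \<beta>)\<in>{..\<gamma>}\<times>{..\<delta>}. (R \<alpha> \<gamma> *v U \<gamma>) \<bullet> (X \<alpha> \<beta> *v (R \<beta> \<delta> *v U \<delta>)))) UNIV"
      by (rule has_sum_finite_neutralI) (auto intro: ccontr simp: zero)
    have "(\<Sum>(\<alpha>, \<beta>)\<in>{..\<gamma>}\<times>{..\<delta>}. (R \<alpha> \<gamma> *v U \<gamma>) \<bullet> (X \<alpha> \<beta> *v (R \<beta> \<delta> *v U \<delta>)))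
       = U \<gamma> \<bullet> ((\<Sum>\<alpha>\<le>\<gamma>. \<Sum>\<beta>\<le>\<delta>. transpose (R \<alpha> \<gamma>) ** X \<alpha> \<beta> ** R \<beta> \<delta>) *v U \<delta>)"
      by (simp add: sum.cartesian_product[symmetric] matrix_vector_sum_left inner_sum_right
          matrix_vector_mul_assoc[symmetric] inner_vector_matrix_mult)
    then show "((\<lambda>ab. ?g (gd, ab)) has_sum 
       (case gd of (\<gamma>, \<delta>) \<Rightarrow> U \<gamma> \<bullet> ((\<Sum>\<alpha>\<le>\<gamma>. \<Sum>\<beta>\<le>\<delta>. transpose (R \<alpha> \<gamma>) ** X \<alpha> \<beta> ** R \<beta> \<delta>) *v U \<delta>))) UNIV"
      using fin by (simp add: gd case_prod_unfold)
  qed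
  ultimately show thesis by (rule that)
qed

section \<open>Continuously differentiable functions\<close>

text \<open>
  On a finite-dimensional domain, continuity of all directional derivatives is continuity of the
  derivative, so \<open>Ck_on 1\<close> is the usual class \<open>C\<^sup>1\<close>.
\<close>

lemma C1_on_iff:
  "Ck_on 1 S f \<longleftrightarrow> (\<forall>x\<in>S. f differentiable (at x)) \<and>
     (\<forall>v. continuous_on S (\<lambda>x. frechet_derivative f (at x) v))"
  by (simp add: One_nat_def)

lemma C1_onI:
  assumes "\<And>x. x \<in> S \<Longrightarrow> (f has_derivative D x) (at x)" "\<And>v. continuous_on S (\<lambda>x. D x v)"
  shows "Ck_on 1 S f"
  unfolding C1_on_iff
proof (intro conjI ballI allI)
  show "f differentiable (at x)" if "x \<in> S" for x
    using assms(1)[OF that] by (auto simp: differentiable_def)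
  show "continuous_on S (\<lambda>x. frechet_derivative f (at x) v)" for v
  proof (rule continuous_on_eq[OF assms(2)])
    show "D x v = frechet_derivative f (at x) v" if "x \<in> S" for x
      using frechet_derivative_at[OF assms(1)[OF that]] by (rule fun_cong)
  qed
qed

lemma C1_onD:
  assumes "Ck_on 1 S f" "x \<in> S"
  shows "(f has_derivative frechet_derivative f (at x)) (at x)"
  using assms by (auto simp: C1_on_iff frechet_derivative_works[symmetric])

lemma C1_on_continuous_derivative:
  "Ck_on 1 S f \<Longrightarrow> continuous_on S (\<lambda>x. frechet_derivative f (at x) v)"
  by (auto simp: C1_on_iff)

lemma C1_on_continuous: "Ck_on 1 S f \<Longrightarrow> continuous_on S f"
  by (auto simp: C1_on_iff differentiable_imp_continuous_within intro!: continuous_at_imp_continuous_on)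

lemma C1_on_subset: "Ck_on 1 S f \<Longrightarrow> T \<subseteq> S \<Longrightarrow> Ck_on 1 T f"
  by (auto simp: C1_on_iff intro: continuous_on_subset)

lemma C1_on_const: "Ck_on 1 S (\<lambda>x. c)"
  by (rule C1_onI[where D="\<lambda>_ _. 0"]) auto

lemma C1_on_bounded_linear:
  assumes "bounded_linear L" "Ck_on 1 S f"
  shows "Ck_on 1 S (\<lambda>x. L (f x))"
  by (rule C1_onI[where D="\<lambda>x v. L (frechet_derivative f (at x) v)"])
     (auto intro: bounded_linear.has_derivative[OF assms(1)] C1_onD[OF assms(2)]
       bounded_linear.continuous_on[OF assms(1)] C1_on_continuous_derivative[OF assms(2)])

lemma C1_on_bilinear:
  assumes h: "bounded_bilinear h" and f: "Ck_on 1 S f" and g: "Ck_on 1 S g"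
  shows "Ck_on 1 S (\<lambda>x. h (f x) (g x))"
  by (rule C1_onI[where D="\<lambda>x v. h (f x) (frechet_derivative g (at x) v) + h (frechet_derivative f (at x) v) (g x)"])
     (auto intro!: bounded_bilinear.FDERIV[OF h] C1_onD[OF f] C1_onD[OF g] continuous_on_add
       bounded_bilinear.continuous_on[OF h] C1_on_continuous[OF f] C1_on_continuous[OF g]
       C1_on_continuous_derivative[OF f] C1_on_continuous_derivative[OF g])

lemma C1_on_add:
  assumes f: "Ck_on 1 S f" and g: "Ck_on 1 S g"
  shows "Ck_on 1 S (\<lambda>x. f x + g x)"
  by (rule C1_onI[where D="\<lambda>x v. frechet_derivative f (at x) v + frechet_derivative g (at x) v"])
     (auto intro!: has_derivative_add C1_onD[OF f] C1_onD[OF g] continuous_on_add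
       C1_on_continuous_derivative[OF f] C1_on_continuous_derivative[OF g])

lemma C1_on_diff:
  assumes f: "Ck_on 1 S f" and g: "Ck_on 1 S g"
  shows "Ck_on 1 S (\<lambda>x. f x - g x)"
  using C1_on_add[OF f C1_on_bounded_linear[OF bounded_linear_minus[OF bounded_linear_ident] g]] by simp

lemma C1_on_sum:
  "(\<And>i. i \<in> I \<Longrightarrow> Ck_on 1 S (f i)) \<Longrightarrow> Ck_on 1 S (\<lambda>x. \<Sum>i\<in>I. f i x)"
  by (induction I rule: infinite_finite_induct) (auto intro: C1_on_const C1_on_add simp del: Ck_on.simps One_nat_def)

lemma C1_on_mult:
  fixes f g :: "_ \<Rightarrow> 'a::real_normed_algebra"
  shows "Ck_on 1 S f \<Longrightarrow> Ck_on 1 S g \<Longrightarrow> Ck_on 1 S (\<lambda>x. f x * g x)"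
  by (rule C1_on_bilinear[OF bounded_bilinear_mult])

lemma C1_on_prod:
  fixes f :: "'i \<Rightarrow> _ \<Rightarrow> 'a::{real_normed_algebra,comm_ring_1}"
  shows "(\<And>i. i \<in> I \<Longrightarrow> Ck_on 1 S (f i)) \<Longrightarrow> Ck_on 1 S (\<lambda>x. \<Prod>i\<in>I. f i x)"
  by (induction I rule: infinite_finite_induct) (auto intro: C1_on_const C1_on_mult simp del: Ck_on.simps One_nat_def)

lemma C1_on_power:
  fixes f :: "_ \<Rightarrow> 'a::{real_normed_algebra,comm_ring_1}"
  shows "Ck_on 1 S f \<Longrightarrow> Ck_on 1 S (\<lambda>x. f x ^ n)"
  using C1_on_prod[of "{..<n}" S "\<lambda>_. f"] by simp

lemma C1_on_divide:
  fixes f g :: "_ \<Rightarrow> real"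
  assumes f: "Ck_on 1 S f" and g: "Ck_on 1 S g" and nz: "\<And>x. x \<in> S \<Longrightarrow> g x \<noteq> 0"
  shows "Ck_on 1 S (\<lambda>x. f x / g x)"
proof -
  have "Ck_on 1 S (\<lambda>x. inverse (g x))"
    by (rule C1_onI[where D="\<lambda>x v. - (inverse (g x) * frechet_derivative g (at x) v * inverse (g x))"])
       (use nz in \<open>auto intro!: Deriv.has_derivative_inverse C1_onD[OF g] continuous_intros C1_on_continuous[OF g]
         C1_on_continuous_derivative[OF g]\<close>)
  from C1_on_mult[OF f this] show ?thesis by (simp add: divide_inverse)
qed

lemma C1_on_vec:
  fixes f :: "'a::real_normed_vector \<Rightarrow> 'b::real_normed_vector^'n"
  assumes "\<And>i. Ck_on 1 S (\<lambda>x. f x $ i)"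
  shows "Ck_on 1 S f"
proof -
  have "bounded_linear (axis i :: 'b \<Rightarrow> 'b^'n)" for i
    by (rule bounded_linear_intro[where K=1]) (auto simp: axis_def vec_eq_iff norm_vec_def L2_set_def if_distrib[of norm] if_distrib[of "\<lambda>x. x\<^sup>2"] cong: if_cong)
  then have "Ck_on 1 S (\<lambda>x. \<Sum>i\<in>UNIV. axis i (f x $ i))"
    by (intro C1_on_sum C1_on_bounded_linear[where L="axis _"] assms)
  also have "(\<lambda>x. \<Sum>i\<in>UNIV. axis i (f x $ i)) = f"
    by (auto simp: vec_eq_iff axis_def)
  finally show ?thesis .
qed

text \<open>
  In the derivative of a composition, both the point and the direction of the outer derivative vary;
  continuity follows by expanding the direction in a basis.
\<close>

lemma C1_on_compose:
  fixes g :: "'b::euclidean_space \<Rightarrow> 'c::real_normed_vector"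
  assumes g: "Ck_on 1 T g" and f: "Ck_on 1 S f" and sub: "\<And>x. x \<in> S \<Longrightarrow> f x \<in> T"
  shows "Ck_on 1 S (\<lambda>x. g (f x))"
proof (rule C1_onI)
  fix x assume x: "x \<in> S"
  have g': "(g has_derivative frechet_derivative g (at (f x))) (at (f x))"
    by (rule C1_onD[OF g sub[OF x]])
  have lin: "linear (frechet_derivative g (at (f x)))"
    using g' by (rule has_derivative_linear)
  have "frechet_derivative g (at (f x)) w = (\<Sum>b\<in>Basis. (w \<bullet> b) *\<^sub>R frechet_derivative g (at (f x)) b)" for w
    by (subst euclidean_representation[of w, symmetric]) (simp add: linear_sum[OF lin] linear_scale[OF lin])
  then have "(\<lambda>v. \<Sum>b\<in>Basis. (frechet_derivative f (at x) v \<bullet> b) *\<^sub>R frechet_derivative g (at (f x)) b)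
      = frechet_derivative g (at (f x)) \<circ> frechet_derivative f (at x)"
    by (intro ext) (metis comp_apply)
  then show "((\<lambda>x. g (f x)) has_derivative
     (\<lambda>v. \<Sum>b\<in>Basis. (frechet_derivative f (at x) v \<bullet> b) *\<^sub>R frechet_derivative g (at (f x)) b)) (at x)"
    using diff_chain_at[OF C1_onD[OF f x] g'] by (simp only: o_def)
next
  fix v
  show "continuous_on S (\<lambda>x. \<Sum>b\<in>Basis. (frechet_derivative f (at x) v \<bullet> b) *\<^sub>R frechet_derivative g (at (f x)) b)"
    by (intro continuous_intros C1_on_continuous_derivative[OF f]
        continuous_on_compose2[OF C1_on_continuous_derivative[OF g] C1_on_continuous[OF f]]) (use sub in auto)
qed

lemma frechet_derivative_compose:
  assumes "Ck_on 1 T g" "Ck_on 1 S f" "x \<in> S" "f x \<in> T"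
  shows "frechet_derivative (\<lambda>x. g (f x)) (at x) v = frechet_derivative g (at (f x)) (frechet_derivative f (at x) v)"
  using frechet_derivative_at[OF diff_chain_at[OF C1_onD[OF assms(2,3)] C1_onD[OF assms(1,4)]]]
  by (simp add: o_def fun_eq_iff)

lemma frechet_derivative_bilinear:
  assumes h: "bounded_bilinear h" and f: "Ck_on 1 S f" and g: "Ck_on 1 S g" and x: "x \<in> S"
  shows "frechet_derivative (\<lambda>x. h (f x) (g x)) (at x) v
      = h (f x) (frechet_derivative g (at x) v) + h (frechet_derivative f (at x) v) (g x)"
  using frechet_derivative_at[OF bounded_bilinear.FDERIV[OF h C1_onD[OF f x] C1_onD[OF g x]]]
  by (simp add: fun_eq_iff)

lemma frechet_derivative_bounded_linear:
  assumes h: "bounded_linear h" and f: "Ck_on 1 S f" and x: "x \<in> S"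
  shows "frechet_derivative (\<lambda>x. h (f x)) (at x) v = h (frechet_derivative f (at x) v)"
  using frechet_derivative_at[OF bounded_linear.has_derivative[OF h C1_onD[OF f x]]]
  by (simp add: fun_eq_iff)

lemma frechet_derivative_cong_open:
  assumes "open S" "x \<in> S" "\<And>y. y \<in> S \<Longrightarrow> f y = g y" "f differentiable at x"
  shows "frechet_derivative f (at x) = frechet_derivative g (at x)"
  using assms has_derivative_transform_within_open[of f "frechet_derivative f (at x)" x UNIV S g]
  by (intro frechet_derivative_at) (auto simp: frechet_derivative_works)

lemma C1_on_cong_open:
  assumes "open S" "\<And>y. y \<in> S \<Longrightarrow> f y = g y" "Ck_on 1 S f"
  shows "Ck_on 1 S g"
  by (rule C1_onI[where D="\<lambda>x. frechet_derivative f (at x)"])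
     (use assms has_derivative_transform_within_open[of f _ _ UNIV S g] in
       \<open>auto intro: C1_onD C1_on_continuous_derivative simp del: Ck_on.simps One_nat_def\<close>)

lemma smooth_on_C1: "smooth_on S f \<Longrightarrow> Ck_on 1 S f"
  unfolding smooth_on_def by blast

lemma smooth_on_derivative: "smooth_on S f \<Longrightarrow> smooth_on S (\<lambda>x. frechet_derivative f (at x) v)"
  unfolding smooth_on_def by (metis Ck_on.simps(2))

lemma smooth_on_pd: "smooth_on S f \<Longrightarrow> smooth_on S (pd i f)"
  using smooth_on_derivative[of S f "axis i 1"] by (simp add: pd_def[abs_def])

text \<open>
  By the mean value theorem in direction \<open>a\<close> and then in direction \<open>b\<close>, the second difference is \<open>h\<^sup>2\<close> times
  the mixed derivative at a nearby point.
\<close>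

lemma second_difference_quotient_limit:
  fixes f :: "'a::real_normed_vector \<Rightarrow> real"
  assumes S: "open S" "x \<in> S"
    and f: "Ck_on 1 S f" and fa: "Ck_on 1 S (\<lambda>y. frechet_derivative f (at y) a)"
  shows "((\<lambda>h. (f (x + h *\<^sub>R a + h *\<^sub>R b) - f (x + h *\<^sub>R a) - f (x + h *\<^sub>R b) + f x) / h\<^sup>2)
     \<longlongrightarrow> frechet_derivative (\<lambda>y. frechet_derivative f (at y) a) (at x) b) (at_right 0)"
proof (rule tendstoI)
  fix e :: real assume "e > 0"
  let ?Da = "\<lambda>y. frechet_derivative f (at y) a"
  let ?Dab = "\<lambda>y. frechet_derivative ?Da (at y) b"
  have "continuous_on S ?Dab" by (rule C1_on_continuous_derivative[OF fa])
  then have "isCont ?Dab x" using S continuous_on_eq_continuous_at by blast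
  then obtain d1 where d1: "d1 > 0" "\<And>y. dist y x < d1 \<Longrightarrow> dist (?Dab y) (?Dab x) < e"
    unfolding continuous_at_eps_delta using \<open>e > 0\<close> by blast
  obtain d2 where d2: "d2 > 0" "ball x d2 \<subseteq> S" using S open_contains_ball by blast
  define d where "d = min d1 d2 / (norm a + norm b + 1)"
  have pos: "norm a + norm b + 1 > 0" by (smt (verit) norm_ge_zero)
  then have "d > 0" using d1 d2 by (simp add: d_def)
  \<comment> \<open>The choice of \<open>d\<close> keeps all points \<open>x + s a + r b\<close> with \<open>s, r \<le> h < d\<close> in both balls.\<close>
  have near: "dist (x + s *\<^sub>R a + r *\<^sub>R b) x < min d1 d2" 
    if "0 \<le> s" "s \<le> h" "0 \<le> r" "r \<le> h" "h < d" for s r h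
  proof -
    have "dist (x + s *\<^sub>R a + r *\<^sub>R b) x = norm (s *\<^sub>R a + r *\<^sub>R b)" by (simp add: dist_norm)
    also have "\<dots> \<le> s * norm a + r * norm b" using norm_triangle_ineq[of "s *\<^sub>R a" "r *\<^sub>R b"] that by simp
    also have "\<dots> \<le> h * norm a + h * norm b" using that by (intro add_mono mult_right_mono) auto
    also have "\<dots> \<le> h * (norm a + norm b + 1)" using that by (simp add: algebra_simps)
    also have "\<dots> < d * (norm a + norm b + 1)" using that pos by simp
    also have "\<dots> = min d1 d2" using pos by (simp add: d_def)
    finally show ?thesis .
  qed
  have inS: "x + s *\<^sub>R a + r *\<^sub>R b \<in> S" if "0 \<le> s" "s \<le> h" "0 \<le> r" "r \<le> h" "h < d" for s r h
    using near[OF that] d2 by (auto simp: dist_commute mem_ball subset_iff)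
  have "dist ((f (x + h *\<^sub>R a + h *\<^sub>R b) - f (x + h *\<^sub>R a) - f (x + h *\<^sub>R b) + f x) / h\<^sup>2) (?Dab x) < e"
    if h: "0 < h" "h < d" for h
  proof -
    have line: "((\<lambda>s. f (x + s *\<^sub>R a + r *\<^sub>R b)) has_real_derivative ?Da (x + s *\<^sub>R a + r *\<^sub>R b)) (at s)"
      if "0 \<le> s" "s \<le> h" "0 \<le> r" "r \<le> h" for s r
    proof -
      have "((\<lambda>s. x + s *\<^sub>R a + r *\<^sub>R b) has_derivative (\<lambda>v. v *\<^sub>R a)) (at s)"
        by (auto intro!: derivative_eq_intros)
      from diff_chain_at[OF this C1_onD[OF f inS[OF that h(2)]]]
      have "((\<lambda>s. f (x + s *\<^sub>R a + r *\<^sub>R b)) has_derivative (\<lambda>v. v * ?Da (x + s *\<^sub>R a + r *\<^sub>R b))) (at s)"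
        using linear_scale[OF has_derivative_linear[OF C1_onD[OF f inS[OF that h(2)]]]]
        by (simp add: o_def)
      then show ?thesis by (rule has_derivative_imp_has_field_derivative) simp
    qed
    have line2: "((\<lambda>r. ?Da (x + s *\<^sub>R a + r *\<^sub>R b)) has_real_derivative ?Dab (x + s *\<^sub>R a + r *\<^sub>R b)) (at r)"
      if "0 \<le> s" "s \<le> h" "0 \<le> r" "r \<le> h" for s r
    proof -
      have "((\<lambda>r. x + s *\<^sub>R a + r *\<^sub>R b) has_derivative (\<lambda>v. v *\<^sub>R b)) (at r)"
        by (auto intro!: derivative_eq_intros)
      from diff_chain_at[OF this C1_onD[OF fa inS[OF that h(2)]]]
      have "((\<lambda>r. ?Da (x + s *\<^sub>R a + r *\<^sub>R b)) has_derivative (\<lambda>v. v * ?Dab (x + s *\<^sub>R a + r *\<^sub>R b))) (at r)"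
        using linear_scale[OF has_derivative_linear[OF C1_onD[OF fa inS[OF that h(2)]]]]
        by (simp add: o_def)
      then show ?thesis by (rule has_derivative_imp_has_field_derivative) simp
    qed
    let ?p = "\<lambda>s. f (x + s *\<^sub>R a + h *\<^sub>R b) - f (x + s *\<^sub>R a + 0 *\<^sub>R b)"
    have "\<exists>s>0. s < h \<and> ?p h - ?p 0 = (h - 0) * (?Da (x + s *\<^sub>R a + h *\<^sub>R b) - ?Da (x + s *\<^sub>R a + 0 *\<^sub>R b))"
      by (rule MVT2[OF h(1)]) (use h in \<open>auto intro!: DERIV_diff line line[where r=0, simplified]\<close>)
    then obtain s where s: "0 < s" "s < h"
      "?p h - ?p 0 = h * (?Da (x + s *\<^sub>R a + h *\<^sub>R b) - ?Da (x + s *\<^sub>R a + 0 *\<^sub>R b))" by auto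
    have "\<exists>r>0. r < h \<and> ?Da (x + s *\<^sub>R a + h *\<^sub>R b) - ?Da (x + s *\<^sub>R a + 0 *\<^sub>R b)
        = (h - 0) * ?Dab (x + s *\<^sub>R a + r *\<^sub>R b)"
      by (rule MVT2[OF h(1)]) (use s in \<open>auto intro!: line2 line2[where r=0, simplified]\<close>)
    then obtain r where r: "0 < r" "r < h"
      "?Da (x + s *\<^sub>R a + h *\<^sub>R b) - ?Da (x + s *\<^sub>R a + 0 *\<^sub>R b) = h * ?Dab (x + s *\<^sub>R a + r *\<^sub>R b)" by auto
    have "?p h - ?p 0 = h * (h * ?Dab (x + s *\<^sub>R a + r *\<^sub>R b))"
      unfolding s(3) r(3) ..
    then have "(f (x + h *\<^sub>R a + h *\<^sub>R b) - f (x + h *\<^sub>R a) - f (x + h *\<^sub>R b) + f x) / h\<^sup>2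
        = ?Dab (x + s *\<^sub>R a + r *\<^sub>R b)"
      using h by (simp add: field_simps power2_eq_square)
    then show ?thesis using d1(2) near[of s h r] s r h by simp
  qed
  then show "\<forall>\<^sub>F h in at_right 0. dist ((f (x + h *\<^sub>R a + h *\<^sub>R b) - f (x + h *\<^sub>R a) - f (x + h *\<^sub>R b) + f x) / h\<^sup>2) (?Dab x) < e"
    unfolding eventually_at_right_field using \<open>d > 0\<close> by blast
qed

text \<open>
  The second difference is symmetric in \<open>a\<close> and \<open>b\<close>, hence so is its limit.  Vector-valued functions are
  reduced to real-valued ones by inner products.
\<close>

lemma mixed_derivatives_commute:
  fixes f :: "'a::real_normed_vector \<Rightarrow> 'b::real_inner"
  assumes S: "open S" "x \<in> S" and f: "smooth_on S f"
  shows "frechet_derivative (\<lambda>y. frechet_derivative f (at y) a) (at x) b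
       = frechet_derivative (\<lambda>y. frechet_derivative f (at y) b) (at x) a"
proof -
  have "frechet_derivative (\<lambda>y. frechet_derivative f (at y) a) (at x) b \<bullet> c
       = frechet_derivative (\<lambda>y. frechet_derivative f (at y) b) (at x) a \<bullet> c" for c
  proof -
    let ?g = "\<lambda>y. f y \<bullet> c"
    note bl = bounded_linear_inner_left[of c]
    note f1 = smooth_on_C1[OF f]
    note f2 = smooth_on_C1[OF smooth_on_derivative[OF f]]
    have g: "Ck_on 1 S ?g" by (rule C1_on_bounded_linear[OF bl f1])
    have d: "frechet_derivative f (at y) v \<bullet> c = frechet_derivative ?g (at y) v" if "y \<in> S" for y v
      by (rule frechet_derivative_bounded_linear[OF bl f1 that, symmetric])
    have gv: "Ck_on 1 S (\<lambda>y. frechet_derivative ?g (at y) v)" for v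
      by (rule C1_on_cong_open[OF S(1) d C1_on_bounded_linear[OF bl f2]])
    have 2: "frechet_derivative (\<lambda>y. frechet_derivative f (at y) v) (at x) w \<bullet> c
        = frechet_derivative (\<lambda>y. frechet_derivative ?g (at y) v) (at x) w" for v w
    proof -
      let ?f = "\<lambda>y. frechet_derivative f (at y) v \<bullet> c"
      have "frechet_derivative ?f (at x) = frechet_derivative (\<lambda>y. frechet_derivative ?g (at y) v) (at x)"
        by (rule frechet_derivative_cong_open[OF S d])
           (use C1_onD[OF C1_on_bounded_linear[OF bl f2[of v]] S(2)] in \<open>auto simp: differentiable_def\<close>)
      then show ?thesis by (simp add: frechet_derivative_bounded_linear[OF bl f2 S(2), symmetric])
    qed
    have "frechet_derivative (\<lambda>y. frechet_derivative ?g (at y) a) (at x) b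
        = frechet_derivative (\<lambda>y. frechet_derivative ?g (at y) b) (at x) a"
    proof (rule tendsto_unique[OF _ second_difference_quotient_limit[OF S g gv]])
      show "((\<lambda>h. (f (x + h *\<^sub>R a + h *\<^sub>R b) \<bullet> c - f (x + h *\<^sub>R a) \<bullet> c - f (x + h *\<^sub>R b) \<bullet> c + f x \<bullet> c) / h\<^sup>2)
        \<longlongrightarrow> frechet_derivative (\<lambda>y. frechet_derivative ?g (at y) b) (at x) a) (at_right 0)"
        using second_difference_quotient_limit[OF S g gv, of b a]
        by (rule Lim_transform_eventually) (simp add: add.commute add.left_commute algebra_simps)
    qed simp
    then show ?thesis unfolding 2 .
  qed
  then show ?thesis by (metis vector_eq_rdot)
qed

lemma pd_commute:
  assumes "open S" "x \<in> S" "smooth_on S f"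
  shows "pd i (pd j f) x = pd j (pd i f :: _ \<Rightarrow> 'b::real_inner) x"
  using mixed_derivatives_commute[OF assms] by (simp add: pd_def[abs_def])

section \<open>Integration over an element\<close>

lemma sets_hausdorff_measure: "sets (hausdorff_measure k :: 'a::metric_space measure) = sets borel"
  using sets.sigma_sets_eq[of "borel :: 'a measure"] by (simp add: hausdorff_measure_def)

lemma space_surface_measure: "space (surface_measure \<Omega>) = frontier \<Omega>"
  by (simp add: surface_measure_def space_restrict_space sets_eq_imp_space_eq[OF sets_hausdorff_measure])

lemma measurable_surface_measure:
  fixes f :: "real^'d \<Rightarrow> 'b::topological_space"
  assumes "f \<in> borel_measurable (restrict_space borel (frontier \<Omega>))"
  shows "f \<in> borel_measurable (surface_measure \<Omega>)"
proof -
  have "sets (surface_measure \<Omega>) = sets (restrict_space borel (frontier \<Omega>))"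
    unfolding surface_measure_def by (rule sets_restrict_space_cong[OF sets_hausdorff_measure])
  with assms show ?thesis by (simp cong: measurable_cong_sets)
qed

context
  fixes \<Omega> :: "(real^'d) set" and n :: "real^'d \<Rightarrow> real^'d"
  assumes el: "element \<Omega> n"
begin

lemma element_compact_closure: "compact (closure \<Omega>)"
  using el by (simp add: element_def compact_closure)

lemma element_frontier_subset: "frontier \<Omega> \<subseteq> closure \<Omega>"
  by (simp add: frontier_def)

lemma element_norm_normal: "AE x in surface_measure \<Omega>. norm (n x) = 1"
  using el by (auto simp: element_def outward_unit_normal_at_def)

lemma continuous_bounded_on_element:
  fixes f :: "real^'d \<Rightarrow> 'b::real_normed_vector"
  assumes "continuous_on (closure \<Omega>) f"
  obtains B where "\<And>x. x \<in> closure \<Omega> \<Longrightarrow> norm (f x) \<le> B"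
  using compact_imp_bounded[OF compact_continuous_image[OF assms element_compact_closure]]
  by (auto simp: bounded_iff)

lemma integrable_element:
  fixes f :: "real^'d \<Rightarrow> 'b::euclidean_space"
  assumes f: "continuous_on (closure \<Omega>) f"
  shows "integrable (lebesgue_on \<Omega>) f"
proof -
  obtain B where B: "\<And>x. x \<in> closure \<Omega> \<Longrightarrow> norm (f x) \<le> B"
    using continuous_bounded_on_element[OF f] by blast
  have "\<Omega> \<in> lmeasurable" using el by (simp add: element_def lmeasurable_open)
  then have fin: "finite_measure (lebesgue_on \<Omega>)" by (rule finite_measure_lebesgue_on)
  have "f \<in> borel_measurable (lebesgue_on \<Omega>)"
    using el f closure_subset[of \<Omega>]
    by (intro continuous_imp_measurable_on_sets_lebesgue) (auto simp: element_def intro: continuous_on_subset lmeasurable_open)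
  then show ?thesis
    by (intro finite_measure.integrable_const_bound[OF fin, of _ B])
       (use B closure_subset[of \<Omega>] in \<open>auto intro!: AE_I2\<close>)
qed

text \<open>
  The normal has unit length almost everywhere only, hence the bound of the integrand holds almost everywhere.
\<close>

lemma integrable_surface:
  fixes f :: "real^'d \<Rightarrow> 'b::euclidean_space"
  assumes f: "continuous_on (closure \<Omega>) f"
  shows "integrable (surface_measure \<Omega>) (\<lambda>x. n x $ k *\<^sub>R f x)"
proof -
  obtain B where B: "\<And>x. x \<in> closure \<Omega> \<Longrightarrow> norm (f x) \<le> B"
    using continuous_bounded_on_element[OF f] by blast
  have fin: "finite_measure (surface_measure \<Omega>)" using el by (simp add: element_def)
  have "f \<in> borel_measurable (restrict_space borel (frontier \<Omega>))"
    using f element_frontier_subset by (intro borel_measurable_continuous_on_restrict) (auto intro: continuous_on_subset)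
  moreover have "n \<in> borel_measurable borel" using el by (simp add: element_def)
  then have "n \<in> borel_measurable (restrict_space borel (frontier \<Omega>))"
    by (rule measurable_restrict_space1)
  then have "(\<lambda>x. n x \<bullet> axis k 1) \<in> borel_measurable (restrict_space borel (frontier \<Omega>))"
    by simp
  then have "(\<lambda>x. n x $ k) \<in> borel_measurable (restrict_space borel (frontier \<Omega>))"
    by (simp add: inner_axis)
  ultimately have "(\<lambda>x. n x $ k *\<^sub>R f x) \<in> borel_measurable (restrict_space borel (frontier \<Omega>))"
    by (rule borel_measurable_scaleR[rotated])
  then have m: "(\<lambda>x. n x $ k *\<^sub>R f x) \<in> borel_measurable (surface_measure \<Omega>)"
    by (rule measurable_surface_measure)
  have "AE x in surface_measure \<Omega>. norm (n x $ k *\<^sub>R f x) \<le> B"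
    using element_norm_normal
  proof (rule AE_mp, intro AE_I2 impI)
    fix x assume x: "x \<in> space (surface_measure \<Omega>)" and "norm (n x) = 1"
    then have "\<bar>n x $ k\<bar> \<le> 1" using component_le_norm_cart[of "n x" k] by simp
    moreover have "norm (f x) \<le> B" using x B element_frontier_subset by (auto simp: space_surface_measure)
    ultimately have "\<bar>n x $ k\<bar> * norm (f x) \<le> 1 * B" by (intro mult_mono) auto
    then show "norm (n x $ k *\<^sub>R f x) \<le> B" by simp
  qed
  then show ?thesis by (rule finite_measure.integrable_const_bound[OF fin _ m])
qed

lemma divergence_theorem_fields:
  fixes Q :: "'d \<Rightarrow> real^'d \<Rightarrow> 'b::euclidean_space"
  assumes W: "open W" "closure \<Omega> \<subseteq> W" and Q: "\<And>k. Ck_on 1 W (Q k)"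
  shows "(LINT x|lebesgue_on \<Omega>. (\<Sum>k\<in>UNIV. pd k (Q k) x))
       = (LINT x|surface_measure \<Omega>. (\<Sum>k\<in>UNIV. n x $ k *\<^sub>R Q k x))"
proof (rule euclidean_eqI)
  fix b :: 'b assume "b \<in> Basis"
  \<comment> \<open>The divergence theorem is known for vector fields, hence it is applied to each component of \<open>Q\<close>.\<close>
  let ?Y = "\<lambda>y. \<chi> k. Q k y \<bullet> b"
  have Y: "Ck_on 1 W ?Y"
    using C1_on_bounded_linear[OF bounded_linear_inner_left Q] by (intro C1_on_vec) simp
  have cpd: "continuous_on (closure \<Omega>) (pd k (Q k))" for k
    unfolding pd_def by (rule continuous_on_subset[OF C1_on_continuous_derivative[OF Q] W(2)])
  have cQ: "continuous_on (closure \<Omega>) (Q k)" for k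
    by (rule continuous_on_subset[OF C1_on_continuous[OF Q] W(2)])
  have pdb: "pd k (\<lambda>y. ?Y y $ k) x = pd k (Q k) x \<bullet> b" if "x \<in> closure \<Omega>" for x k
    using frechet_derivative_bounded_linear[OF bounded_linear_inner_left[of b] Q] W that
    by (auto simp: pd_def)
  have "(LINT x|lebesgue_on \<Omega>. (\<Sum>k\<in>UNIV. pd k (Q k) x)) \<bullet> b
      = (LINT x|lebesgue_on \<Omega>. (\<Sum>k\<in>UNIV. pd k (Q k) x) \<bullet> b)"
    by (intro integral_inner_left[symmetric] impI Bochner_Integration.integrable_sum integrable_element cpd)
  also have "\<dots> = (LINT x|lebesgue_on \<Omega>. (\<Sum>k\<in>UNIV. pd k (\<lambda>y. ?Y y $ k) x))"
    using closure_subset[of \<Omega>] pdb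
    by (intro Bochner_Integration.integral_cong refl) (auto simp: inner_sum_left intro!: sum.cong)
  also have "\<dots> = (LINT x|surface_measure \<Omega>. ?Y x \<bullet> n x)"
    using el W Y unfolding element_def by blast
  also have "\<dots> = (LINT x|surface_measure \<Omega>. (\<Sum>k\<in>UNIV. n x $ k *\<^sub>R Q k x) \<bullet> b)"
    by (intro Bochner_Integration.integral_cong refl) (simp add: inner_vec_def inner_sum_left mult.commute)
  also have "\<dots> = (LINT x|surface_measure \<Omega>. (\<Sum>k\<in>UNIV. n x $ k *\<^sub>R Q k x)) \<bullet> b"
    by (intro integral_inner_left impI Bochner_Integration.integrable_sum integrable_surface cQ)
  finally show "(LINT x|lebesgue_on \<Omega>. (\<Sum>k\<in>UNIV. pd k (Q k) x)) \<bullet> b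
       = (LINT x|surface_measure \<Omega>. (\<Sum>k\<in>UNIV. n x $ k *\<^sub>R Q k x)) \<bullet> b" .
qed

text \<open>
  Dominated convergence of the difference quotients: by the mean value theorem they are bounded by the
  maximum of the time derivative over a compact time interval times the closed element.
\<close>

lemma leibniz_rule_element:
  fixes f :: "real \<times> (real^'d) \<Rightarrow> real"
  assumes I: "open I" "t \<in> I" and T: "I \<times> closure \<Omega> \<subseteq> T" and f: "Ck_on 1 T f"
  shows "((\<lambda>r. LINT x|lebesgue_on \<Omega>. f (r, x)) has_real_derivative
     (LINT x|lebesgue_on \<Omega>. frechet_derivative f (at (t, x)) (1, 0))) (at t)"
proof -
  obtain d where d: "d > 0" "cball t d \<subseteq> I" using I open_contains_cball by blast
  let ?g = "\<lambda>p. frechet_derivative f (at p) (1, 0)"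
  have K: "cball t d \<times> closure \<Omega> \<subseteq> T" using T d by blast
  have "compact (?g ` (cball t d \<times> closure \<Omega>))"
    by (rule compact_continuous_image[OF continuous_on_subset[OF C1_on_continuous_derivative[OF f] K]
          compact_Times[OF compact_cball element_compact_closure]])
  then have "bounded (?g ` (cball t d \<times> closure \<Omega>))" by (rule compact_imp_bounded)
  then obtain B where "\<forall>y\<in>?g ` (cball t d \<times> closure \<Omega>). norm y \<le> B"
    unfolding bounded_iff by (elim exE)
  then have B: "norm (?g p) \<le> B" if "p \<in> cball t d \<times> closure \<Omega>" for p
    using that by (rule bspec[OF _ imageI])
  have sl: "continuous_on (closure \<Omega>) (\<lambda>x. f (r, x))" if "r \<in> I" for r
    by (rule continuous_on_compose2[OF C1_on_continuous[OF f]]) (use T that in \<open>auto intro!: continuous_intros\<close>)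
  have int: "integrable (lebesgue_on \<Omega>) (\<lambda>x. f (r, x))" if "r \<in> I" for r
    by (rule integrable_element[OF sl[OF that]])
  have cg: "continuous_on (closure \<Omega>) (\<lambda>x. ?g (t, x))"
    by (rule continuous_on_compose2[OF C1_on_continuous_derivative[OF f, of "(1, 0)"]])
       (use T I in \<open>auto intro!: continuous_intros\<close>)
  have der: "((\<lambda>r. f (r, x)) has_real_derivative ?g (r, x)) (at r)" if "r \<in> I" "x \<in> closure \<Omega>" for r x
  proof -
    have p: "(r, x) \<in> T" using T that by blast
    have "((\<lambda>r. (r, x)) has_derivative (\<lambda>v. (v, 0))) (at r)" by (auto intro!: derivative_eq_intros)
    from diff_chain_at[OF this C1_onD[OF f p]]
    have "((\<lambda>r. f (r, x)) has_derivative (\<lambda>v. frechet_derivative f (at (r, x)) (v, 0))) (at r)"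
      by (simp add: o_def)
    moreover have "(\<lambda>v. frechet_derivative f (at (r, x)) (v, 0)) = (*) (?g (r, x))"
      by (rule ext, subst mult.commute, rule linear_scale[OF has_derivative_linear[OF C1_onD[OF f p]], of _ "(1, 0)",
            unfolded scaleR_Pair real_scaleR_def mult_1_right scaleR_zero_right])
    ultimately show ?thesis
      by (simp only: has_field_derivative_def)
  qed
  show ?thesis
    unfolding has_field_derivative_iff tendsto_at_iff_sequentially comp_def
  proof (intro allI impI)
    fix X assume X: "\<forall>i. X i \<in> UNIV - {t}" "X \<longlonglongrightarrow> t"
    obtain N where "\<forall>i\<ge>N. dist (X i) t < d"
      using X(2) d(1) unfolding lim_sequentially by blast
    then have N: "X i \<in> cball t d" if "i \<ge> N" for i
      using that by (simp add: dist_commute less_imp_le)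
    define Z where "Z i = X (i + N)" for i
    have Z: "Z i \<in> cball t d" "Z i \<noteq> t" for i using N X by (auto simp: Z_def)
    have Zt: "Z \<longlonglongrightarrow> t" unfolding Z_def by (rule LIMSEQ_ignore_initial_segment[OF X(2)])
    have ZI: "Z i \<in> I" for i using Z d by blast
    have lim: "(\<lambda>i. LINT x|lebesgue_on \<Omega>. (f (Z i, x) - f (t, x)) / (Z i - t)) \<longlonglongrightarrow> (LINT x|lebesgue_on \<Omega>. ?g (t, x))"
    proof (rule integral_dominated_convergence[where w="\<lambda>_. B"])
      show "(\<lambda>x. ?g (t, x)) \<in> borel_measurable (lebesgue_on \<Omega>)"
        using integrable_element[OF cg] by (rule borel_measurable_integrable)
      show "(\<lambda>x. (f (Z i, x) - f (t, x)) / (Z i - t)) \<in> borel_measurable (lebesgue_on \<Omega>)" for i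
        using int[OF ZI] int[OF I(2)] by (intro borel_measurable_divide borel_measurable_diff borel_measurable_integrable) auto
      show "integrable (lebesgue_on \<Omega>) (\<lambda>_. B)" by (rule integrable_element) auto
      show "AE x in lebesgue_on \<Omega>. (\<lambda>i. (f (Z i, x) - f (t, x)) / (Z i - t)) \<longlonglongrightarrow> ?g (t, x)"
      proof (intro AE_I2)
        fix x assume "x \<in> space (lebesgue_on \<Omega>)"
        then have "x \<in> closure \<Omega>" using closure_subset[of \<Omega>] by auto
        from der[OF I(2) this] show "(\<lambda>i. (f (Z i, x) - f (t, x)) / (Z i - t)) \<longlonglongrightarrow> ?g (t, x)"
          unfolding has_field_derivative_iff tendsto_at_iff_sequentially comp_def using Z Zt by blast
      qed
      show "AE x in lebesgue_on \<Omega>. norm ((f (Z i, x) - f (t, x)) / (Z i - t)) \<le> B" for i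
      proof (intro AE_I2)
        fix x assume "x \<in> space (lebesgue_on \<Omega>)"
        then have x: "x \<in> closure \<Omega>" using closure_subset[of \<Omega>] by auto
        have "norm (f (Z i, x) - f (t, x)) \<le> B * norm (Z i - t)"
        proof (rule field_differentiable_bound[of "cball t d"])
          show "((\<lambda>r. f (r, x)) has_field_derivative ?g (r, x)) (at r within cball t d)" if "r \<in> cball t d" for r
            using der[OF _ x] that d by (blast intro: has_field_derivative_at_within)
          show "norm (?g (r, x)) \<le> B" if "r \<in> cball t d" for r using B that x by blast
        qed (use Z d in auto)
        then show "norm ((f (Z i, x) - f (t, x)) / (Z i - t)) \<le> B"
          using Z(2)[of i] by (simp add: norm_divide pos_divide_le_eq)
      qed
    qed
    have eq: "(LINT x|lebesgue_on \<Omega>. (f (Z i, x) - f (t, x)) / (Z i - t)) =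
      ((LINT x|lebesgue_on \<Omega>. f (Z i, x)) - (LINT x|lebesgue_on \<Omega>. f (t, x))) / (Z i - t)" for i
      using int[OF ZI] int[OF I(2)] by simp
    from lim have "(\<lambda>i. ((LINT x|lebesgue_on \<Omega>. f (X (i + N), x)) - (LINT x|lebesgue_on \<Omega>. f (t, x))) / (X (i + N) - t))
        \<longlonglongrightarrow> (LINT x|lebesgue_on \<Omega>. ?g (t, x))"
      unfolding eq unfolding Z_def .
    then show "(\<lambda>i. ((LINT x|lebesgue_on \<Omega>. f (X i, x)) - (LINT x|lebesgue_on \<Omega>. f (t, x))) / (X i - t))
        \<longlonglongrightarrow> (LINT x|lebesgue_on \<Omega>. ?g (t, x))"
      by (rule LIMSEQ_offset)
  qed
qed

end

section \<open>Energy, flux and symmetrizer\<close>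

lemma inner_symmetric_matrix:
  "transpose X = X \<Longrightarrow> v \<bullet> (X *v w) = w \<bullet> (X *v (v :: real^'n))"
  by (metis dot_lmul_matrix inner_commute transpose_matrix_vector)

lemma C1_on_differentiable: "Ck_on 1 S f \<Longrightarrow> x \<in> S \<Longrightarrow> f differentiable (at x)"
  by (simp add: C1_on_iff)

lemmas transpose_scaleR = linear_scale[OF bounded_linear.linear[OF bounded_linear_transpose]]
lemmas transpose_diff = linear_diff[OF bounded_linear.linear[OF bounded_linear_transpose]]

lemma frechet_derivative_grad:
  assumes "Ck_on 1 S f" "x \<in> S"
  shows "frechet_derivative f (at x) v = grad f x \<bullet> v"
proof -
  have lin: "linear (frechet_derivative f (at x))"
    by (rule has_derivative_linear[OF C1_onD[OF assms]])
  have "frechet_derivative f (at x) v = frechet_derivative f (at x) (\<Sum>i\<in>UNIV. v $ i *\<^sub>R axis i 1)"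
    using basis_expansion[of v] by (simp add: scalar_mult_eq_scaleR)
  also have "\<dots> = (\<Sum>i\<in>UNIV. v $ i * frechet_derivative f (at x) (axis i 1))"
    by (simp add: linear_sum[OF lin] linear_scale[OF lin])
  also have "\<dots> = grad f x \<bullet> v"
    by (simp add: grad_def pd_def inner_vec_def mult.commute)
  finally show ?thesis .
qed

lemma C1_on_slice:
  fixes f :: "real \<times> 'a::euclidean_space \<Rightarrow> 'b::real_normed_vector"
  assumes "Ck_on 1 T f"
  shows "Ck_on 1 {x. (t, x) \<in> T} (\<lambda>x. f (t, x))" "Ck_on 1 {r. (r, x) \<in> T} (\<lambda>r. f (r, x))"
proof -
  have "Ck_on 1 {x. (t, x) \<in> T} (Pair t)"
    by (rule C1_onI[where D="\<lambda>_ v. (0, v)"]) (auto intro!: derivative_eq_intros)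
  from C1_on_compose[OF assms this] show "Ck_on 1 {x. (t, x) \<in> T} (\<lambda>x. f (t, x))" by simp
  have "Ck_on 1 {r. (r, x) \<in> T} (\<lambda>r. (r, x))"
    by (rule C1_onI[where D="\<lambda>_ v. (v, 0)"]) (auto intro!: derivative_eq_intros)
  from C1_on_compose[OF assms this] show "Ck_on 1 {r. (r, x) \<in> T} (\<lambda>r. f (r, x))" by simp
qed

lemma open_slice:
  assumes "open T"
  shows "open {x. (t, x) \<in> T}" "open {r. (r, x) \<in> T}"
  using open_vimage[OF assms, of "Pair t"] open_vimage[OF assms, of "\<lambda>r. (r, x)"]
  by (auto simp: vimage_def continuous_intros)

lemma vector_derivative_C1:
  fixes f :: "real \<Rightarrow> 'b::real_normed_vector"
  assumes "Ck_on 1 S f" "t \<in> S"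
  shows "vector_derivative f (at t) = frechet_derivative f (at t) 1"
  using frechet_derivative_eq_vector_derivative[OF C1_on_differentiable[OF assms]] by simp

context
  fixes s :: "('d::finite, 'm::finite) ieig"
  assumes phys: "physical_setting s"
begin

lemma Adm_open: "open (Adm s)" using phys by (simp add: physical_setting_def)

lemma energy_smooth: "smooth_on (Adm s) (energy s)" using phys by (simp add: physical_setting_def)

lemma flux_smooth: "smooth_on (Adm s) (flux s k)" "smooth_on (Adm s) (eflux s k)" "smooth_on (Adm s) (Gfield s k)"
  using phys by (auto simp: physical_setting_def)

lemma hessian_symmetric: "w \<in> Adm s \<Longrightarrow> transpose (hessian (energy s) w) = hessian (energy s) w"
  using phys by (auto simp: physical_setting_def spd_def)

text \<open>
  Division by zero gives \<open>H(0) = 0\<close>, which contradicts the positive lower bound for the eigenvalues of \<open>H\<close>.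
  So the denominator \<open>u\<^sup>T \<H>\<^sub>e u\<close> of \<open>H\<close> is positive on all of the admissible set.
\<close>

lemma zero_not_admissible: "0 \<notin> Adm s"
proof
  assume "0 \<in> Adm s"
  then obtain c where "0 < c" "\<And>v l. v \<noteq> 0 \<Longrightarrow> Hmat s 0 *v v = l *\<^sub>R v \<Longrightarrow> c \<le> l"
    using phys unfolding physical_setting_def by metis
  from this(1) this(2)[of "\<chi> i. 1" 0] show False by (simp add: Hmat_def vec_eq_iff)
qed

lemma hessian_positive: "w \<in> Adm s \<Longrightarrow> 0 < w \<bullet> (hessian (energy s) w *v w)"
  using phys zero_not_admissible unfolding physical_setting_def spd_def by metis

lemma Hmat_symmetric: "w \<in> Adm s \<Longrightarrow> transpose (Hmat s w) = Hmat s w"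
  using hessian_symmetric by (simp add: Hmat_def transpose_scaleR)

lemma energy_quadratic:
  assumes "w \<in> Adm s"
  shows "energy s w = 1/2 * (w \<bullet> (Hmat s w *v w))"
  using hessian_positive[OF assms]
  by (simp add: Hmat_def scaleR_matrix_vector_assoc[symmetric])

lemma hessian_C1: "Ck_on 1 (Adm s) (hessian (energy s))"
proof (intro C1_on_vec)
  fix i j
  have "Ck_on 1 (Adm s) (pd j (pd i (energy s)))"
    by (intro smooth_on_C1 smooth_on_pd energy_smooth)
  then show "Ck_on 1 (Adm s) (\<lambda>w. hessian (energy s) w $ i $ j)"
    by (simp add: hessian_def del: Ck_on.simps One_nat_def)
qed

lemma Hmat_C1: "Ck_on 1 (Adm s) (Hmat s)"
proof -
  have id: "Ck_on 1 (Adm s) (\<lambda>w. w)"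
    by (rule C1_onI[where D="\<lambda>_ v. v"]) auto
  have "Ck_on 1 (Adm s) (\<lambda>w. 2 * energy s w / (w \<bullet> (hessian (energy s) w *v w)))"
    by (intro C1_on_divide C1_on_mult C1_on_const smooth_on_C1[OF energy_smooth]
      C1_on_bilinear[OF bounded_bilinear_inner] C1_on_bilinear[OF bounded_bilinear_matrix_vector_mult]
      id hessian_C1) (use hessian_positive in force)
  from C1_on_bilinear[OF bounded_bilinear_scaleR this hessian_C1]
  show ?thesis by (simp only: Hmat_def[abs_def])
qed

lemma Amat_entry: "Amat s k w $ i $ j = pd j (flux s k) w $ i"
  by (simp add: Amat_def jacobian_def matrix_def pd_def)

lemma Amat_C1: "Ck_on 1 (Adm s) (Amat s k)"
  unfolding Amat_entry
proof (intro C1_on_vec)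
  fix i j
  have "Ck_on 1 (Adm s) (pd j (flux s k))" by (intro smooth_on_C1 smooth_on_pd flux_smooth)
  from C1_on_bounded_linear[OF bounded_linear_vec_nth this]
  show "Ck_on 1 (Adm s) (\<lambda>w. Amat s k w $ i $ j)" by (simp only: Amat_entry)
qed

lemma grad_energy_flux: "w \<in> Adm s \<Longrightarrow> grad (energy s) w v* Amat s k w = grad (eflux s k) w"
  using phys by (auto simp: physical_setting_def)

text \<open>
  This turns \<open>u\<^sub>t = - A\<^sub>k \<partial>\<^sub>k u\<close> into \<open>e\<^sub>t = - \<partial>\<^sub>k g\<^sub>k\<close>.
\<close>

lemma energy_derivative_flux:
  assumes "w \<in> Adm s"
  shows "frechet_derivative (energy s) (at w) (Amat s k w *v v) = frechet_derivative (eflux s k) (at w) v"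
  using grad_energy_flux[OF assms, of k] dot_lmul_matrix[of "grad (energy s) w" "Amat s k w" v]
  by (simp add: frechet_derivative_grad[OF smooth_on_C1[OF energy_smooth] assms]
      frechet_derivative_grad[OF smooth_on_C1[OF flux_smooth(2)] assms])

text \<open>
  Differentiating \<open>\<Sum>\<^sub>i \<partial>\<^sub>i e \<partial>\<^sub>j F\<^sub>i = \<partial>\<^sub>j g\<close> in direction \<open>l\<close> gives
  \<open>(\<H>\<^sub>e A)\<^sub>l\<^sub>j = \<partial>\<^sub>l \<partial>\<^sub>j g - \<Sum>\<^sub>i \<partial>\<^sub>i e \<partial>\<^sub>l \<partial>\<^sub>j F\<^sub>i\<close>, and the right-hand side is symmetric in \<open>l\<close> and \<open>j\<close>.
\<close>

lemma hessian_Amat_symmetric: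
  assumes w: "w \<in> Adm s"
  shows "transpose (hessian (energy s) w ** Amat s k w) = hessian (energy s) w ** Amat s k w"
proof -
  let ?e = "energy s" and ?F = "flux s k" and ?g = "eflux s k"
  have gradC1: "Ck_on 1 (Adm s) (grad ?e)"
  proof (rule C1_on_vec)
    show "Ck_on 1 (Adm s) (\<lambda>w. grad ?e w $ i)" for i
      using smooth_on_C1[OF smooth_on_pd[OF energy_smooth, of i]]
      by (simp add: grad_def del: Ck_on.simps One_nat_def)
  qed
  have FC1: "Ck_on 1 (Adm s) (pd j ?F)" for j by (intro smooth_on_C1 smooth_on_pd flux_smooth)
  have gC1: "Ck_on 1 (Adm s) (pd j ?g)" for j by (intro smooth_on_C1 smooth_on_pd flux_smooth)
  have comp: "pd j ?g y = pd j ?F y \<bullet> grad ?e y" if "y \<in> Adm s" for j y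
  proof -
    have "pd j ?g y = (grad ?e y v* Amat s k y) $ j"
      using grad_energy_flux[OF that, of k] by (simp add: grad_def)
    also have "\<dots> = pd j ?F y \<bullet> grad ?e y"
      by (simp add: vector_matrix_mult_def inner_vec_def Amat_entry mult.commute)
    finally show ?thesis .
  qed
  have entry: "(hessian ?e w ** Amat s k w) $ l $ j = pd l (pd j ?g) w - pd l (pd j ?F) w \<bullet> grad ?e w" for l j
  proof -
    have col: "pd l (grad ?e) w $ i = hessian ?e w $ i $ l" for i
      using frechet_derivative_bounded_linear[OF bounded_linear_vec_nth gradC1 w, of i "axis l 1"]
      by (simp add: pd_def hessian_def grad_def cong: if_cong) (simp add: pd_def[abs_def])
    have "pd l (pd j ?g) w = pd l (\<lambda>y. pd j ?F y \<bullet> grad ?e y) w"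
      unfolding pd_def[of l]
      by (rule fun_cong[OF frechet_derivative_cong_open[OF Adm_open w comp C1_on_differentiable[OF gC1 w]]])
    also have "\<dots> = pd j ?F w \<bullet> pd l (grad ?e) w + pd l (pd j ?F) w \<bullet> grad ?e w"
      using frechet_derivative_bilinear[OF bounded_bilinear_inner FC1 gradC1 w]
      by (simp add: pd_def[of l])
    also have "pd j ?F w \<bullet> pd l (grad ?e) w = (\<Sum>i\<in>UNIV. hessian ?e w $ i $ l * Amat s k w $ i $ j)"
      by (simp add: inner_vec_def col Amat_entry mult.commute)
    also have "\<dots> = (transpose (hessian ?e w) ** Amat s k w) $ l $ j"
      by (simp add: matrix_matrix_mult_def transpose_def)
    finally show ?thesis using hessian_symmetric[OF w] by simp
  qed
  have "(hessian ?e w ** Amat s k w) $ l $ j = (hessian ?e w ** Amat s k w) $ j $ l" for l j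
    unfolding entry
    by (simp add: pd_commute[OF Adm_open w flux_smooth(2), of l j] pd_commute[OF Adm_open w flux_smooth(1), of l j])
  then show ?thesis by (simp add: vec_eq_iff transpose_def)
qed

lemma Hmat_Amat_symmetric:
  assumes "w \<in> Adm s"
  shows "transpose (Hmat s w ** Amat s k w) = Hmat s w ** Amat s k w"
  using hessian_Amat_symmetric[OF assms, of k]
  by (simp add: Hmat_def bounded_bilinear.scaleR_left[OF bounded_bilinear_matrix_mult]
     transpose_scaleR)

lemma Gfield_properties:
  assumes "w \<in> Adm s"
  shows "transpose (Gfield s k w) = Gfield s k w"
    "eflux s k w = 1/2 * (w \<bullet> (Gfield s k w *v w))"
    "Gfield s k w = Hmat s w ** (Amat s k w + DA s k w)"
  using phys assms unfolding physical_setting_def by blast+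

lemma Hmat_DA:
  assumes "w \<in> Adm s"
  shows "Hmat s w ** DA s k w = Gfield s k w - Hmat s w ** Amat s k w"
  using Gfield_properties(3)[OF assms, of k] by (simp add: matrix_add_ldistrib)

lemma Hmat_DA_symmetric:
  assumes "w \<in> Adm s"
  shows "transpose (Hmat s w ** DA s k w) = Hmat s w ** DA s k w"
  using Hmat_Amat_symmetric[OF assms, of k] Gfield_properties(1)[OF assms, of k]
  by (simp add: Hmat_DA[OF assms] transpose_diff)

lemma Hmat_DA_quadratic:
  assumes "w \<in> Adm s"
  shows "w \<bullet> ((Hmat s w ** DA s k w) *v w) = 2 * eflux s k w - w \<bullet> ((Hmat s w ** Amat s k w) *v w)"
  using Gfield_properties(2)[OF assms, of k]
  by (simp add: Hmat_DA[OF assms] matrix_vector_mult_diff_rdistrib inner_diff_right)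

lemma Hmat_Amat_C1: "Ck_on 1 (Adm s) (\<lambda>w. Hmat s w ** Amat s k w)"
  by (rule C1_on_bilinear[OF bounded_bilinear_matrix_mult Hmat_C1 Amat_C1])

text \<open>
  The field \<open>\<Delta>A\<^sub>k\<close> is only given as a solution of \<open>G\<^sub>k = H (A\<^sub>k + \<Delta>A\<^sub>k)\<close>; the product \<open>H \<Delta>A\<^sub>k\<close> inherits its
  regularity from \<open>G\<^sub>k - H A\<^sub>k\<close>.
\<close>

lemma Hmat_DA_C1: "Ck_on 1 (Adm s) (\<lambda>w. Hmat s w ** DA s k w)"
  by (rule C1_on_cong_open[OF Adm_open Hmat_DA[symmetric]
        C1_on_diff[OF smooth_on_C1[OF flux_smooth(3)] Hmat_Amat_C1]])

text \<open>
  \<open>T\<close> stands for a neighbourhood of the closed space-time cylinder, so that derivatives make sense up to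
  the boundary of the element.
\<close>

context
  fixes T :: "(real \<times> (real^'d)) set"
  assumes T: "open T" and st: "Ck_on 1 T (\<lambda>(t, x). state s t x)"
    and adm: "\<And>t x. (t, x) \<in> T \<Longrightarrow> state s t x \<in> Adm s"
begin

lemma Hx_C1: "Ck_on 1 T (\<lambda>(t, x). Hx s t x)"
  using C1_on_compose[OF Hmat_C1 st] adm by (auto simp: Hx_def case_prod_unfold simp del: Ck_on.simps One_nat_def)

lemma HAx_C1: "Ck_on 1 T (\<lambda>(t, x). HAx s k t x)"
  using C1_on_compose[OF Hmat_Amat_C1 st] adm by (auto simp: HAx_def case_prod_unfold simp del: Ck_on.simps One_nat_def)

lemma HDAx_C1: "Ck_on 1 T (\<lambda>(t, x). HDAx s k t x)"
  using C1_on_compose[OF Hmat_DA_C1 st] adm by (auto simp: HDAx_def case_prod_unfold simp del: Ck_on.simps One_nat_def)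

text \<open>
  Two expressions for \<open>e\<^sub>t\<close> are compared: \<open>e = u\<^sup>T H u / 2\<close> gives \<open>u\<^sup>T H u\<^sub>t + u\<^sup>T H\<^sub>t u / 2\<close>, and the differential
  equation gives \<open>- \<partial>\<^sub>k g\<^sub>k\<close>.  The flux is then removed by \<open>2 g\<^sub>k = u\<^sup>T H A\<^sub>k u + u\<^sup>T H \<Delta>A\<^sub>k u\<close>, and \<open>u\<^sup>T H u\<^sub>t\<close> by
  the differential equation; the derivatives of \<open>u\<close> cancel because \<open>H A\<^sub>k\<close> is symmetric.
\<close>

lemma energy_balance:
  assumes tx: "(t, x) \<in> T"
    and pde: "vector_derivative (\<lambda>r. state s r x) (at t)
          + (\<Sum>k\<in>UNIV. Amat s k (state s t x) *v pd k (state s t) x) = 0"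
  shows "state s t x \<bullet> (vector_derivative (\<lambda>r. Hx s r x) (at t) *v state s t x)
      + state s t x \<bullet> (divHA s t x *v state s t x)
    = - (\<Sum>k\<in>UNIV. pd k (\<lambda>y. state s t y \<bullet> (HDAx s k t y *v state s t y)) x)"
proof -
  define u where "u = state s t x"
  define X where "X = {x. (t, x) \<in> T}"
  define I where "I = {r. (r, x) \<in> T}"
  have X: "open X" "x \<in> X" and I: "open I" "t \<in> I"
    using open_slice[OF T] tx by (auto simp: X_def I_def)
  have u: "u \<in> Adm s" using adm[OF tx] by (simp add: u_def)
  have ux: "Ck_on 1 X (state s t)" and HAX: "Ck_on 1 X (HAx s k t)" and HDAX: "Ck_on 1 X (HDAx s k t)" for k
    using C1_on_slice(1)[OF st, of t] C1_on_slice(1)[OF HAx_C1, of t k] C1_on_slice(1)[OF HDAx_C1, of t k]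
    by (simp_all add: X_def del: Ck_on.simps One_nat_def)
  have ut: "Ck_on 1 I (\<lambda>r. state s r x)" and Ht: "Ck_on 1 I (\<lambda>r. Hx s r x)"
    using C1_on_slice(2)[OF st, of x] C1_on_slice(2)[OF Hx_C1, of x]
    by (simp_all add: I_def del: Ck_on.simps One_nat_def)
  define du where "du = frechet_derivative (\<lambda>r. state s r x) (at t) 1"
  define dH where "dH = frechet_derivative (\<lambda>r. Hx s r x) (at t) 1"
  define w where "w k = pd k (state s t) x" for k
  have du: "du = - (\<Sum>k\<in>UNIV. Amat s k u *v w k)"
    using pde vector_derivative_C1[OF ut I(2)] by (simp add: du_def w_def u_def eq_neg_iff_add_eq_0)
  have e: "Ck_on 1 (Adm s) (energy s)" and g: "Ck_on 1 (Adm s) (eflux s k)" for k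
    by (intro smooth_on_C1 energy_smooth flux_smooth)+
  have lin: "linear (frechet_derivative (energy s) (at u))"
    by (rule has_derivative_linear[OF C1_onD[OF e u]])
  have Hsym: "transpose (Hx s t x) = Hx s t x" using Hmat_symmetric[OF u] by (simp add: Hx_def u_def)
  have HAsym: "transpose (HAx s k t x) = HAx s k t x" for k
    using Hmat_Amat_symmetric[OF u] by (simp add: HAx_def u_def)
  \<comment> \<open>The rate of \<open>u\<^sup>T H u / 2\<close>.\<close>
  have rate1: "frechet_derivative (energy s) (at u) du = u \<bullet> (Hx s t x *v du) + 1/2 * (u \<bullet> (dH *v u))"
  proof -
    let ?q = "\<lambda>r. state s r x \<bullet> (Hx s r x *v state s r x)"
    note C = C1_on_bilinear[OF bounded_bilinear_matrix_vector_mult Ht ut]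
    have eq: "energy s (state s r x) = 1/2 * ?q r" if "r \<in> I" for r
      using energy_quadratic[OF adm] that by (simp add: I_def Hx_def)
    have q: "Ck_on 1 I ?q" by (rule C1_on_bilinear[OF bounded_bilinear_inner ut C])
    have eC: "Ck_on 1 I (\<lambda>r. energy s (state s r x))"
      by (rule C1_on_compose[OF e ut]) (auto simp: I_def intro: adm)
    have "frechet_derivative (energy s) (at u) du = frechet_derivative (\<lambda>r. energy s (state s r x)) (at t) 1"
      unfolding du_def u_def
      by (rule frechet_derivative_compose[OF e ut I(2), symmetric]) (use u in \<open>simp add: u_def\<close>)
    also have "\<dots> = frechet_derivative (\<lambda>r. 1/2 * ?q r) (at t) 1"
      by (rule fun_cong[OF frechet_derivative_cong_open[OF I eq C1_on_differentiable[OF eC I(2)]]])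
    also have "\<dots> = 1/2 * frechet_derivative ?q (at t) 1"
      by (rule frechet_derivative_bounded_linear[OF bounded_linear_mult_right q I(2)])
    also have "frechet_derivative ?q (at t) 1 = u \<bullet> (Hx s t x *v du + dH *v u) + du \<bullet> (Hx s t x *v u)"
      by (simp only: frechet_derivative_bilinear[OF bounded_bilinear_inner ut C I(2)]
        frechet_derivative_bilinear[OF bounded_bilinear_matrix_vector_mult Ht ut I(2)] du_def dH_def u_def)
    finally show ?thesis using inner_symmetric_matrix[OF Hsym, of u du] by (simp add: inner_add_right)
  qed
  \<comment> \<open>The rate prescribed by the differential equation.\<close>
  have rate2: "frechet_derivative (energy s) (at u) du = - (\<Sum>k\<in>UNIV. frechet_derivative (eflux s k) (at u) (w k))"
    by (simp add: du linear_neg[OF lin] linear_sum[OF lin] energy_derivative_flux[OF u])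
  have Q: "pd k (\<lambda>y. state s t y \<bullet> (HDAx s k t y *v state s t y)) x
     = 2 * frechet_derivative (eflux s k) (at u) (w k) - 2 * (u \<bullet> (Hx s t x *v (Amat s k u *v w k)))
        - u \<bullet> (pd k (HAx s k t) x *v u)" for k
  proof -
    let ?q = "\<lambda>y. state s t y \<bullet> (HAx s k t y *v state s t y)"
    let ?p = "\<lambda>y. state s t y \<bullet> (HDAx s k t y *v state s t y)"
    note C = C1_on_bilinear[OF bounded_bilinear_matrix_vector_mult HAX ux]
    have q: "Ck_on 1 X ?q" by (rule C1_on_bilinear[OF bounded_bilinear_inner ux C])
    have p: "Ck_on 1 X ?p"
      by (rule C1_on_bilinear[OF bounded_bilinear_inner ux
           C1_on_bilinear[OF bounded_bilinear_matrix_vector_mult HDAX ux]])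
    have gC: "Ck_on 1 X (\<lambda>y. eflux s k (state s t y))"
      by (rule C1_on_compose[OF g ux]) (auto simp: X_def intro: adm)
    have eq: "?p y = 2 * eflux s k (state s t y) - ?q y" if "y \<in> X" for y
      using Hmat_DA_quadratic[OF adm] that by (simp add: X_def HDAx_def HAx_def)
    have "pd k ?p x = frechet_derivative (\<lambda>y. 2 * eflux s k (state s t y) - ?q y) (at x) (axis k 1)"
      unfolding pd_def
      by (rule fun_cong[OF frechet_derivative_cong_open[OF X eq C1_on_differentiable[OF p X(2)]]])
    also have "\<dots> = 2 * frechet_derivative (\<lambda>y. eflux s k (state s t y)) (at x) (axis k 1) - frechet_derivative ?q (at x) (axis k 1)"
      using frechet_derivative_at[OF has_derivative_diff[OF bounded_linear.has_derivative[OF bounded_linear_mult_right C1_onD[OF gC X(2)]]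
           C1_onD[OF q X(2)]], of 2] by (rule fun_cong[OF sym])
    also have "frechet_derivative (\<lambda>y. eflux s k (state s t y)) (at x) (axis k 1) = frechet_derivative (eflux s k) (at u) (w k)"
      using frechet_derivative_compose[OF g ux X(2)] u by (simp add: u_def w_def pd_def)
    also have "frechet_derivative ?q (at x) (axis k 1) = u \<bullet> (HAx s k t x *v w k + pd k (HAx s k t) x *v u) + w k \<bullet> (HAx s k t x *v u)"
      by (simp only: frechet_derivative_bilinear[OF bounded_bilinear_inner ux C X(2)]
        frechet_derivative_bilinear[OF bounded_bilinear_matrix_vector_mult HAX ux X(2)] u_def w_def pd_def)
    finally show ?thesis
      using inner_symmetric_matrix[OF HAsym, of u k "w k"]
      by (simp add: inner_add_right HAx_def Hx_def u_def matrix_vector_mul_assoc)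
  qed
  have Hdu: "u \<bullet> (Hx s t x *v du) = - (\<Sum>k\<in>UNIV. u \<bullet> (Hx s t x *v (Amat s k u *v w k)))"
    by (simp add: du linear_neg[OF matrix_vector_mul_linear] linear_sum[OF matrix_vector_mul_linear] inner_sum_right)
  have "vector_derivative (\<lambda>r. Hx s r x) (at t) = dH"
    unfolding dH_def by (rule vector_derivative_C1[OF Ht I(2)])
  moreover have "u \<bullet> (divHA s t x *v u) = (\<Sum>k\<in>UNIV. u \<bullet> (pd k (HAx s k t) x *v u))"
    by (simp add: divHA_def matrix_vector_sum_left inner_sum_right)
  ultimately show ?thesis
    using rate1 rate2 Hdu unfolding Q u_def[symmetric]
    by (simp add: sum_subtractf sum_distrib_left[symmetric])
qed

end

end

section \<open>Modal matrices\<close>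

lemma poly_space_C1:
  assumes "f \<in> poly_space p"
  shows "Ck_on 1 S (f :: real^'d \<Rightarrow> real)"
proof -
  obtain c where c: "f = (\<lambda>x. \<Sum>a\<in>{a. (\<Sum>k\<in>UNIV. a k) \<le> p}. c a * (\<Prod>k\<in>UNIV. x $ k ^ a k))"
    using assms by (auto simp: poly_space_def)
  have "Ck_on 1 S (\<lambda>x :: real^'d. x $ k)" for k
    by (rule C1_onI[where D="\<lambda>_ v. v $ k"]) (auto intro: bounded_linear_imp_has_derivative bounded_linear_vec_nth)
  then show ?thesis unfolding c
    by (intro C1_on_sum C1_on_mult C1_on_prod C1_on_power C1_on_const)
qed

lemma vector_derivative_slice:
  fixes f :: "real \<times> 'a::euclidean_space \<Rightarrow> 'b::real_normed_vector"
  assumes f: "Ck_on 1 T f" and tx: "(t, x) \<in> T"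
  shows "vector_derivative (\<lambda>r. f (r, x)) (at t) = frechet_derivative f (at (t, x)) (1, 0)"
proof -
  have d: "((\<lambda>r. (r, x)) has_derivative (\<lambda>v. (v, 0))) (at t)" by (auto intro!: derivative_eq_intros)
  have "vector_derivative (\<lambda>r. f (r, x)) (at t) = frechet_derivative (\<lambda>r. f (r, x)) (at t) 1"
    using vector_derivative_C1[OF C1_on_slice(2)[OF f]] tx by simp
  also have "\<dots> = frechet_derivative f (at (t, x)) (1, 0)"
    using fun_cong[OF frechet_derivative_at[OF diff_chain_at[OF d C1_onD[OF f tx]]], of 1] by (simp add: o_def)
  finally show ?thesis .
qed

lemma integral_matrix_form:
  fixes F :: "'a \<Rightarrow> real^'m^'m"
  assumes "integrable M F"
  shows "v \<bullet> ((LINT x|M. F x) *v w) = (LINT x|M. v \<bullet> (F x *v w))"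
proof -
  have "bounded_linear (\<lambda>A. v \<bullet> (A *v w))"
    by (rule bounded_linear_compose[OF bounded_linear_inner_right
       bounded_bilinear.bounded_linear_left[OF bounded_bilinear_matrix_vector_mult], unfolded o_def])
  from integral_bounded_linear[OF this assms] show ?thesis by simp
qed

lemma integral_transpose:
  fixes F :: "'a \<Rightarrow> real^'m^'m"
  assumes "integrable M F"
  shows "transpose (LINT x|M. F x) = (LINT x|M. transpose (F x))"
  using integral_bounded_linear[OF bounded_linear_transpose assms] by simp

context
  fixes s :: "('d::finite, 'm::finite) ieig" and T :: "(real \<times> (real^'d)) set"
  assumes phys: "physical_setting s"
    and el: "element (Elt s) (normal s)"
    and basis: "orthonormal_poly_basis (Elt s) (phi s)"
    and T: "open T" and st: "Ck_on 1 T (\<lambda>(t, x). state s t x)"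
    and adm: "\<And>t x. (t, x) \<in> T \<Longrightarrow> state s t x \<in> Adm s"
    and times: "open (times s)"
    and TT: "times s \<times> closure (Elt s) \<subseteq> T"
begin

lemma phi_C1: "Ck_on 1 S (phi s \<alpha>)"
proof -
  obtain p where "phi s \<alpha> \<in> poly_space p" using basis unfolding orthonormal_poly_basis_def by blast
  then show ?thesis by (rule poly_space_C1)
qed

lemma phi2_C1: "Ck_on 1 S (\<lambda>x. phi s \<alpha> x * phi s \<beta> x)"
  by (intro C1_on_mult phi_C1)

lemma Phi_sandwich: "transpose (Phi s \<alpha> x) ** Q ** Phi s \<beta> x = (phi s \<alpha> x * phi s \<beta> x) *\<^sub>R Q"
  by (simp add: Phi_def transpose_scaleR transpose_mat matrix_mul_lid matrix_mul_rid
     bounded_bilinear.scaleR_left[OF bounded_bilinear_matrix_mult]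
     bounded_bilinear.scaleR_right[OF bounded_bilinear_matrix_mult] mult.commute)

lemma Phi_vector: "Phi s \<alpha> x *v v = phi s \<alpha> x *\<^sub>R v"
  by (simp add: Phi_def scaleR_matrix_vector_assoc[symmetric])

lemma pd_Phi: "pd k (Phi s \<beta>) x = pd k (phi s \<beta>) x *\<^sub>R mat 1"
  unfolding pd_def Phi_def[abs_def]
  using frechet_derivative_bounded_linear[OF bounded_linear_scaleR_left phi_C1[of UNIV \<beta>], of x "mat 1" "axis k 1"]
  by simp

lemma Phi_sandwich_pd: "transpose (Phi s \<alpha> x) ** Q ** pd k (Phi s \<beta>) x = (phi s \<alpha> x * pd k (phi s \<beta>) x) *\<^sub>R Q"
  by (simp add: pd_Phi) (simp add: Phi_def transpose_scaleR transpose_mat matrix_mul_lid matrix_mul_rid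
     bounded_bilinear.scaleR_left[OF bounded_bilinear_matrix_mult]
     bounded_bilinear.scaleR_right[OF bounded_bilinear_matrix_mult] mult.commute)

lemma phi_continuous: "continuous_on S (phi s \<alpha>)" "continuous_on S (pd k (phi s \<alpha>))"
  using C1_on_continuous[OF phi_C1] C1_on_continuous_derivative[OF phi_C1] by (auto simp: pd_def[abs_def])

context
  fixes t and X
  assumes t: "t \<in> times s" and X_def: "X = {x. (t, x) \<in> T}"
begin

lemma X: "open X" "closure (Elt s) \<subseteq> X"
  using open_slice(1)[OF T, of t] TT t by (auto simp: X_def)

lemma slices_C1:
  "Ck_on 1 X (state s t)" "Ck_on 1 X (HAx s k t)" "Ck_on 1 X (HDAx s k t)"
  using C1_on_slice(1)[OF st, of t] C1_on_slice(1)[OF HAx_C1[OF phys T st adm], of t k]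
      C1_on_slice(1)[OF HDAx_C1[OF phys T st adm], of t k]
  by (simp_all add: X_def del: Ck_on.simps One_nat_def)

lemma state_admissible: "x \<in> X \<Longrightarrow> state s t x \<in> Adm s"
  using adm by (simp add: X_def)

lemma pd_continuous_closure: "Ck_on 1 X f \<Longrightarrow> continuous_on (closure (Elt s)) (pd k f)"
  unfolding pd_def[abs_def] using continuous_on_subset[OF C1_on_continuous_derivative X(2)] .

lemma continuous_closure: "Ck_on 1 X f \<Longrightarrow> continuous_on (closure (Elt s)) f"
  using continuous_on_subset[OF C1_on_continuous X(2)] .

lemma continuous_closure_fields:
  "continuous_on (closure (Elt s)) (state s t)"
  "continuous_on (closure (Elt s)) (HAx s k t)"
  "continuous_on (closure (Elt s)) (HDAx s k t)"
  "continuous_on (closure (Elt s)) (divHA s t)"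
  using slices_C1 by (auto simp: divHA_def[abs_def] intro!: continuous_closure pd_continuous_closure continuous_on_sum simp del: Ck_on.simps One_nat_def)

text \<open>
  The divergence theorem for \<open>\<phi>\<^sub>\<alpha> \<phi>\<^sub>\<beta> H A\<^sub>k\<close>.  The three terms of the product rule are \<open>N\<^sub>\<alpha>\<^sub>\<beta>\<close>, the transpose of
  \<open>N\<^sub>\<beta>\<^sub>\<alpha>\<close> (because \<open>H A\<^sub>k\<close> is symmetric) and \<open>V\<^sub>\<alpha>\<^sub>\<beta>\<close>.
\<close>

lemma integration_by_parts:
  "NH s t \<alpha> \<beta> + transpose (NH s t \<beta> \<alpha>) + VH s t \<alpha> \<beta> = BH s t \<alpha> \<beta>"
proof -
  have iN: "integrable (lebesgue_on (Elt s)) (\<lambda>x. \<Sum>k\<in>UNIV. (phi s \<alpha> x * pd k (phi s \<beta>) x) *\<^sub>R HAx s k t x)" for \<alpha> \<beta>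
    by (rule integrable_element[OF el]) (intro continuous_intros phi_continuous continuous_closure_fields)
  have iV: "integrable (lebesgue_on (Elt s)) (\<lambda>x. (phi s \<alpha> x * phi s \<beta> x) *\<^sub>R divHA s t x)"
    by (rule integrable_element[OF el]) (intro continuous_intros phi_continuous continuous_closure_fields)
  have tr: "transpose (NH s t \<beta> \<alpha>) = (LINT x|lebesgue_on (Elt s). (\<Sum>k\<in>UNIV. (phi s \<beta> x * pd k (phi s \<alpha>) x) *\<^sub>R HAx s k t x))"
    unfolding NH_def Phi_sandwich_pd integral_transpose[OF iN]
  proof (intro Bochner_Integration.integral_cong refl)
    fix x assume "x \<in> space (lebesgue_on (Elt s))"
    then have "x \<in> X" using X closure_subset[of "Elt s"] by auto
    then have "transpose (HAx s k t x) = HAx s k t x" for k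
      using Hmat_Amat_symmetric[OF phys state_admissible] by (simp add: HAx_def)
    then show "transpose (\<Sum>k\<in>UNIV. (phi s \<beta> x * pd k (phi s \<alpha>) x) *\<^sub>R HAx s k t x)
        = (\<Sum>k\<in>UNIV. (phi s \<beta> x * pd k (phi s \<alpha>) x) *\<^sub>R HAx s k t x)"
      by (simp add: transpose_sum transpose_scaleR)
  qed
  have pd: "pd k (\<lambda>x. (phi s \<alpha> x * phi s \<beta> x) *\<^sub>R HAx s k t x) x
     = (phi s \<alpha> x * pd k (phi s \<beta>) x) *\<^sub>R HAx s k t x + (phi s \<beta> x * pd k (phi s \<alpha>) x) *\<^sub>R HAx s k t x
       + (phi s \<alpha> x * phi s \<beta> x) *\<^sub>R pd k (HAx s k t) x" if "x \<in> X" for x k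
    unfolding pd_def
    by (simp add: frechet_derivative_bilinear[OF bounded_bilinear_scaleR phi2_C1 slices_C1(2) that]
          frechet_derivative_bilinear[OF bounded_bilinear_mult phi_C1 phi_C1 that] algebra_simps)
  have "NH s t \<alpha> \<beta> + transpose (NH s t \<beta> \<alpha>) + VH s t \<alpha> \<beta> =
     (LINT x|lebesgue_on (Elt s). (\<Sum>k\<in>UNIV. (phi s \<alpha> x * pd k (phi s \<beta>) x) *\<^sub>R HAx s k t x)
         + (\<Sum>k\<in>UNIV. (phi s \<beta> x * pd k (phi s \<alpha>) x) *\<^sub>R HAx s k t x)
         + (phi s \<alpha> x * phi s \<beta> x) *\<^sub>R divHA s t x)"
    unfolding tr unfolding NH_def VH_def Phi_sandwich Phi_sandwich_pd
    using iN iV by (simp add: Bochner_Integration.integral_add)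
  also have "\<dots> = (LINT x|lebesgue_on (Elt s). (\<Sum>k\<in>UNIV. pd k (\<lambda>x. (phi s \<alpha> x * phi s \<beta> x) *\<^sub>R HAx s k t x) x))"
  proof (intro Bochner_Integration.integral_cong refl)
    fix x assume "x \<in> space (lebesgue_on (Elt s))"
    then have "x \<in> X" using X closure_subset[of "Elt s"] by auto
    then show "(\<Sum>k\<in>UNIV. (phi s \<alpha> x * pd k (phi s \<beta>) x) *\<^sub>R HAx s k t x)
         + (\<Sum>k\<in>UNIV. (phi s \<beta> x * pd k (phi s \<alpha>) x) *\<^sub>R HAx s k t x)
         + (phi s \<alpha> x * phi s \<beta> x) *\<^sub>R divHA s t x = (\<Sum>k\<in>UNIV. pd k (\<lambda>x. (phi s \<alpha> x * phi s \<beta> x) *\<^sub>R HAx s k t x) x)"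
      by (simp add: pd sum.distrib divHA_def scaleR_sum_right)
  qed
  also have "\<dots> = BH s t \<alpha> \<beta>"
    unfolding BH_def Phi_sandwich
    by (rule divergence_theorem_fields[OF el X C1_on_bilinear[OF bounded_bilinear_scaleR phi2_C1 slices_C1(2)]])
  finally show ?thesis .
qed

lemma integrable_VH: "integrable (lebesgue_on (Elt s)) (\<lambda>x. (phi s \<alpha> x * phi s \<beta> x) *\<^sub>R divHA s t x)"
  by (rule integrable_element[OF el]) (intro continuous_intros phi_continuous continuous_closure_fields)

lemma integrable_BHD: "integrable (surface_measure (Elt s)) (\<lambda>x. (phi s \<alpha> x * phi s \<beta> x) *\<^sub>R normalHDA s t x)"
proof -
  have "(\<lambda>x. (phi s \<alpha> x * phi s \<beta> x) *\<^sub>R normalHDA s t x)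
    = (\<lambda>x. \<Sum>k\<in>UNIV. normal s x $ k *\<^sub>R ((phi s \<alpha> x * phi s \<beta> x) *\<^sub>R HDAx s k t x))"
    by (simp add: normalHDA_def scaleR_sum_right mult.commute)
  then show ?thesis
    by (simp only:) (intro Bochner_Integration.integrable_sum integrable_surface[OF el]
       continuous_intros phi_continuous continuous_closure_fields)
qed

lemma VH_symmetric: "transpose (VH s t \<beta> \<alpha>) = VH s t \<alpha> \<beta>"
  unfolding VH_def Phi_sandwich integral_transpose[OF integrable_VH]
proof (intro Bochner_Integration.integral_cong refl)
  fix x assume "x \<in> space (lebesgue_on (Elt s))"
  then have x: "x \<in> X" using X closure_subset[of "Elt s"] by auto
  have "transpose (pd k (HAx s k t) x) = pd k (HAx s k t) x" for k
  proof -
    have sym: "transpose (HAx s k t y) = HAx s k t y" if "y \<in> X" for y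
      using Hmat_Amat_symmetric[OF phys state_admissible[OF that]] by (simp add: HAx_def)
    have "transpose (pd k (HAx s k t) x) = pd k (\<lambda>y. transpose (HAx s k t y)) x"
      unfolding pd_def
      by (rule frechet_derivative_bounded_linear[OF bounded_linear_transpose slices_C1(2) x, symmetric])
    also have "\<dots> = pd k (HAx s k t) x"
      unfolding pd_def
      by (rule fun_cong[OF frechet_derivative_cong_open[OF X(1) x sym
           C1_on_differentiable[OF C1_on_bounded_linear[OF bounded_linear_transpose slices_C1(2)] x]]])
    finally show ?thesis .
  qed
  then show "transpose ((phi s \<beta> x * phi s \<alpha> x) *\<^sub>R divHA s t x) = (phi s \<alpha> x * phi s \<beta> x) *\<^sub>R divHA s t x"
    by (simp add: divHA_def transpose_sum transpose_scaleR mult.commute)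
qed

lemma BHD_symmetric: "transpose (BHD s t \<beta> \<alpha>) = BHD s t \<alpha> \<beta>"
  unfolding BHD_def Phi_sandwich integral_transpose[OF integrable_BHD]
proof (intro Bochner_Integration.integral_cong refl)
  fix x assume "x \<in> space (surface_measure (Elt s))"
  then have "x \<in> X" using X element_frontier_subset[OF el] by (auto simp: space_surface_measure)
  then have "transpose (HDAx s k t x) = HDAx s k t x" for k
    using Hmat_DA_symmetric[OF phys state_admissible] by (simp add: HDAx_def)
  then show "transpose ((phi s \<beta> x * phi s \<alpha> x) *\<^sub>R normalHDA s t x) = (phi s \<alpha> x * phi s \<beta> x) *\<^sub>R normalHDA s t x"
    by (simp add: normalHDA_def transpose_sum transpose_scaleR mult.commute)
qed

lemma modal_form_matrix:
  assumes "integrable M (\<lambda>x. (phi s \<alpha> x * phi s \<beta> x) *\<^sub>R Q x)"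
  shows "(LINT x|M. modal_form s t Q (\<alpha>, \<beta>) x)
     = coeffs s t \<alpha> \<bullet> ((LINT x|M. (phi s \<alpha> x * phi s \<beta> x) *\<^sub>R Q x) *v coeffs s t \<beta>)"
  unfolding integral_matrix_form[OF assms]
  by (simp add: modal_form_def Phi_vector scaleR_matrix_vector_assoc[symmetric]
     linear_scale[OF matrix_vector_mul_linear] mult_ac)

text \<open>
  The double series of a quadratic form in the modes sums pointwise to the form in the state, and the
  sum may be taken out of the integral.
\<close>

lemma modal_form_has_sum:
  assumes int: "sum_integral_interchange M (modal_form s t Q)"
    and sp: "space M \<subseteq> closure (Elt s)"
    and u: "\<And>x. x \<in> closure (Elt s) \<Longrightarrow> ((\<lambda>\<alpha>. Phi s \<alpha> x *v coeffs s t \<alpha>) has_sum state s t x) UNIV"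
  shows "((\<lambda>i. LINT x|M. modal_form s t Q i x) has_sum (LINT x|M. state s t x \<bullet> (Q x *v state s t x))) UNIV"
proof -
  have bil: "bounded_bilinear (\<lambda>a b. a \<bullet> (A *v b))" for A :: "real^'m^'m"
    by (rule bounded_bilinear.comp[OF bounded_bilinear_inner bounded_linear_ident matrix_vector_mul_bounded_linear])
  have "(\<Sum>\<^sub>\<infinity>i. modal_form s t Q i x) = state s t x \<bullet> (Q x *v state s t x)" if "x \<in> space M" for x
    unfolding modal_form_def case_prod_unfold
    using infsumI[OF has_sum_bilinear[OF bil u u, of x x "Q x"]] sp that by (auto simp: case_prod_unfold)
  then have "(LINT x|M. (\<Sum>\<^sub>\<infinity>i. modal_form s t Q i x)) = (LINT x|M. state s t x \<bullet> (Q x *v state s t x))"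
    by (intro Bochner_Integration.integral_cong refl)
  then show ?thesis using int by (simp add: sum_integral_interchange_def)
qed

lemma Hdot_slice: "x \<in> X \<Longrightarrow> vector_derivative (\<lambda>r. Hx s r x) (at t)
    = frechet_derivative (\<lambda>(t, x). Hx s t x) (at (t, x)) (1, 0)"
  using vector_derivative_slice[OF Hx_C1[OF phys T st adm]] by (simp add: X_def)

lemma Hdot_continuous: "continuous_on (closure (Elt s)) (\<lambda>x. vector_derivative (\<lambda>r. Hx s r x) (at t))"
proof (rule continuous_on_eq)
  show "continuous_on (closure (Elt s)) (\<lambda>x. frechet_derivative (\<lambda>(t, x). Hx s t x) (at (t, x)) (1, 0))"
    by (rule continuous_on_compose2[OF C1_on_continuous_derivative[OF Hx_C1[OF phys T st adm], of "(1, 0)"]])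
       (use TT t in \<open>auto intro!: continuous_intros\<close>)
qed (use Hdot_slice X in auto)

lemma energy_balance_integrated:
  assumes pde: "\<And>x. x \<in> Elt s \<Longrightarrow> vector_derivative (\<lambda>r. state s r x) (at t)
          + (\<Sum>k\<in>UNIV. Amat s k (state s t x) *v pd k (state s t) x) = 0"
  shows "(LINT x|lebesgue_on (Elt s). state s t x \<bullet> (vector_derivative (\<lambda>r. Hx s r x) (at t) *v state s t x))
     + (LINT x|lebesgue_on (Elt s). state s t x \<bullet> (divHA s t x *v state s t x))
     + (LINT x|surface_measure (Elt s). state s t x \<bullet> (normalHDA s t x *v state s t x)) = 0"
proof -
  let ?q = "\<lambda>k y. state s t y \<bullet> (HDAx s k t y *v state s t y)"
  note mv = bounded_bilinear.continuous_on[OF bounded_bilinear_matrix_vector_mult]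
  have q: "Ck_on 1 X (?q k)" for k
    by (intro C1_on_bilinear[OF bounded_bilinear_inner] C1_on_bilinear[OF bounded_bilinear_matrix_vector_mult] slices_C1)
  have i1: "integrable (lebesgue_on (Elt s)) (\<lambda>x. state s t x \<bullet> (vector_derivative (\<lambda>r. Hx s r x) (at t) *v state s t x))"
    by (rule integrable_element[OF el]) (intro continuous_on_inner mv continuous_closure_fields Hdot_continuous)
  have i2: "integrable (lebesgue_on (Elt s)) (\<lambda>x. state s t x \<bullet> (divHA s t x *v state s t x))"
    by (rule integrable_element[OF el]) (intro continuous_on_inner mv continuous_closure_fields)
  have "(LINT x|lebesgue_on (Elt s). state s t x \<bullet> (vector_derivative (\<lambda>r. Hx s r x) (at t) *v state s t x))
     + (LINT x|lebesgue_on (Elt s). state s t x \<bullet> (divHA s t x *v state s t x))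
     = (LINT x|lebesgue_on (Elt s). state s t x \<bullet> (vector_derivative (\<lambda>r. Hx s r x) (at t) *v state s t x)
         + state s t x \<bullet> (divHA s t x *v state s t x))"
    by (rule Bochner_Integration.integral_add[OF i1 i2, symmetric])
  also have "\<dots> = (LINT x|lebesgue_on (Elt s). - (\<Sum>k\<in>UNIV. pd k (?q k) x))"
  proof (intro Bochner_Integration.integral_cong refl)
    fix x assume "x \<in> space (lebesgue_on (Elt s))"
    then have x: "x \<in> Elt s" "(t, x) \<in> T" using TT t closure_subset[of "Elt s"] by auto
    show "state s t x \<bullet> (vector_derivative (\<lambda>r. Hx s r x) (at t) *v state s t x)
         + state s t x \<bullet> (divHA s t x *v state s t x) = - (\<Sum>k\<in>UNIV. pd k (?q k) x)"
      by (rule energy_balance[OF phys T st adm x(2) pde[OF x(1)]])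
  qed
  also have "\<dots> = - (LINT x|surface_measure (Elt s). (\<Sum>k\<in>UNIV. normal s x $ k *\<^sub>R ?q k x))"
    using divergence_theorem_fields[OF el X, of ?q] q by simp
  also have "\<dots> = - (LINT x|surface_measure (Elt s). state s t x \<bullet> (normalHDA s t x *v state s t x))"
    by (simp add: normalHDA_def matrix_vector_sum_left inner_sum_right scaleR_matrix_vector_assoc[symmetric])
  finally show ?thesis by simp
qed

lemma MH_derivative:
  "((\<lambda>r. v \<bullet> (MH s r \<alpha> \<beta> *v w)) has_real_derivative
    (LINT x|lebesgue_on (Elt s). (phi s \<alpha> x *\<^sub>R v) \<bullet> (vector_derivative (\<lambda>r. Hx s r x) (at t) *v (phi s \<beta> x *\<^sub>R w)))) (at t)"
proof -
  let ?f = "\<lambda>(r, x). (phi s \<alpha> x * phi s \<beta> x) * (v \<bullet> (Hx s r x *v w))"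
  have sndC: "Ck_on 1 T snd"
    by (rule C1_onI[where D="\<lambda>_. snd"]) (auto intro!: derivative_eq_intros)
  have bl: "bounded_linear (\<lambda>A. v \<bullet> (A *v w))"
    by (rule bounded_linear_compose[OF bounded_linear_inner_right
       bounded_bilinear.bounded_linear_left[OF bounded_bilinear_matrix_vector_mult], unfolded o_def])
  have f: "Ck_on 1 T ?f"
    using C1_on_mult[OF C1_on_compose[OF phi2_C1[of UNIV \<alpha> \<beta>] sndC] C1_on_bounded_linear[OF bl Hx_C1[OF phys T st adm]]]
    by (simp add: case_prod_unfold del: Ck_on.simps One_nat_def)
  have eq: "v \<bullet> (MH s r \<alpha> \<beta> *v w) = (LINT x|lebesgue_on (Elt s). ?f (r, x))" if r: "r \<in> times s" for r
  proof -
    have "continuous_on (closure (Elt s)) (Hx s r)"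
      by (rule continuous_on_compose2[OF C1_on_continuous[OF Hx_C1[OF phys T st adm]], of _ "\<lambda>x. (r, x)", simplified])
         (use TT r in \<open>auto intro!: continuous_intros\<close>)
    then have "integrable (lebesgue_on (Elt s)) (\<lambda>x. (phi s \<alpha> x * phi s \<beta> x) *\<^sub>R Hx s r x)"
      by (intro integrable_element[OF el] continuous_intros phi_continuous)
    from integral_matrix_form[OF this] show ?thesis
      by (simp add: MH_def Phi_sandwich scaleR_matrix_vector_assoc[symmetric])
  qed
  have "((\<lambda>r. v \<bullet> (MH s r \<alpha> \<beta> *v w)) has_real_derivative
     (LINT x|lebesgue_on (Elt s). frechet_derivative ?f (at (t, x)) (1, 0))) (at t)"
    using leibniz_rule_element[OF el times t TT f] eq t times
    by (auto intro: has_field_derivative_transform_within_open)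
  also have "(LINT x|lebesgue_on (Elt s). frechet_derivative ?f (at (t, x)) (1, 0))
     = (LINT x|lebesgue_on (Elt s). (phi s \<alpha> x *\<^sub>R v) \<bullet> (vector_derivative (\<lambda>r. Hx s r x) (at t) *v (phi s \<beta> x *\<^sub>R w)))"
  proof (intro Bochner_Integration.integral_cong refl)
    fix x assume "x \<in> space (lebesgue_on (Elt s))"
    then have x: "(t, x) \<in> T" using TT t closure_subset[of "Elt s"] by auto
    let ?I = "{r. (r, x) \<in> T}"
    have H: "Ck_on 1 ?I (\<lambda>r. Hx s r x)" using C1_on_slice(2)[OF Hx_C1[OF phys T st adm], of x] by simp
    have bl2: "bounded_linear (\<lambda>A. (phi s \<alpha> x * phi s \<beta> x) * (v \<bullet> (A *v w)))"
      by (rule bounded_linear_compose[OF bounded_linear_mult_right bl, unfolded o_def])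
    have "frechet_derivative ?f (at (t, x)) (1, 0) = vector_derivative (\<lambda>r. ?f (r, x)) (at t)"
      by (rule vector_derivative_slice[OF f x, symmetric])
    also have "\<dots> = (phi s \<alpha> x * phi s \<beta> x) * (v \<bullet> (vector_derivative (\<lambda>r. Hx s r x) (at t) *v w))"
      using vector_derivative_C1[OF C1_on_bounded_linear[OF bl2 H]] vector_derivative_C1[OF H]
        frechet_derivative_bounded_linear[OF bl2 H] x by simp
    finally show "frechet_derivative ?f (at (t, x)) (1, 0)
       = (phi s \<alpha> x *\<^sub>R v) \<bullet> (vector_derivative (\<lambda>r. Hx s r x) (at t) *v (phi s \<beta> x *\<^sub>R w))"
      by (simp add: linear_scale[OF matrix_vector_mul_linear])
  qed
  finally show ?thesis .
qed

end

end

section \<open>Skew rank-two matrices\<close>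

lemma bupper_bmult: "bupper A \<Longrightarrow> bupper B \<Longrightarrow> bupper (bmult A B)"
  by (auto simp: bupper_def[of "bmult A B"] bmult_upper_right row_mult_def intro!: sum.neutral)
     (auto simp: bupper_def matrix_mult_zero_left)

lemma inner_transpose: "v \<bullet> (transpose X *v w) = w \<bullet> (X *v (v :: real^'n))"
  by (metis dot_lmul_matrix inner_commute transpose_matrix_vector)

text \<open>
  The pairs \<open>(\<alpha>, \<beta>)\<close> and \<open>(\<beta>, \<alpha>)\<close> are exchanged.
\<close>

lemma has_sum_transposed_form:
  fixes X :: "'m::finite bmat"
  assumes "((\<lambda>(\<alpha>, \<beta>). w \<alpha> \<bullet> (X \<alpha> \<beta> *v w \<beta>)) has_sum S) UNIV"
  shows "((\<lambda>(\<alpha>, \<beta>). w \<alpha> \<bullet> (transpose (X \<beta> \<alpha>) *v w \<beta>)) has_sum S) UNIV"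
  using assms has_sum_swap[of "\<lambda>(\<alpha>, \<beta>). w \<alpha> \<bullet> (X \<alpha> \<beta> *v w \<beta>)" UNIV UNIV S]
  unfolding inner_transpose by simp

lemma has_sum_diff:
  fixes f g :: "'i \<Rightarrow> 'b::real_normed_vector"
  assumes "(f has_sum a) A" "(g has_sum b) A"
  shows "((\<lambda>x. f x - g x) has_sum (a - b)) A"
  using has_sum_add[OF assms(1), of "\<lambda>x. - g x" "- b"] assms(2) by (simp add: has_sum_uminus)

definition outer :: "real^'m \<Rightarrow> real^'m \<Rightarrow> real^'m^'m" where
  "outer v w = (\<chi> i j. v $ i * w $ j)"

lemma bouter_eq: "bouter v w \<alpha> \<beta> = outer (v \<alpha>) (w \<beta>)"
  by (simp add: bouter_def outer_def)

lemma matrix_mult_outer: "A ** outer v w = outer (A *v v) w"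
  by (simp add: outer_def matrix_matrix_mult_def matrix_vector_mult_def vec_eq_iff sum_distrib_right mult.assoc)

lemma outer_matrix_mult: "outer v w ** A = outer v (transpose A *v w)"
  by (simp add: outer_def matrix_matrix_mult_def matrix_vector_mult_def transpose_def vec_eq_iff sum_distrib_left mult_ac)

lemma outer_vector_mult: "outer v w *v x = (w \<bullet> x) *\<^sub>R v"
  by (simp add: outer_def matrix_vector_mult_def inner_vec_def vec_eq_iff sum_distrib_left mult_ac)

lemma transpose_outer: "transpose (outer v w) = outer w v"
  by (simp add: outer_def transpose_def vec_eq_iff mult.commute)

lemma bounded_bilinear_outer: "bounded_bilinear outer"
  unfolding bilinear_conv_bounded_bilinear[symmetric] bilinear_def
  by (auto intro!: linearI simp: outer_def vec_eq_iff algebra_simps)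

text \<open>
  For \<open>w = U\<^sup>(\<^sup>o\<^sup>)\<close> and \<open>C = C\<^sub>H\<close> this is \<open>K\<^sub>H\<close>.
\<close>

definition rank_two_skew :: "'m::finite bvec \<Rightarrow> 'm bmat \<Rightarrow> 'm bmat" where
  "rank_two_skew w C = (\<lambda>\<alpha> \<beta>. (1 / (bnorm w)\<^sup>2) *\<^sub>R (bmult C (bouter w w) \<alpha> \<beta> - bmult (bouter w w) C \<alpha> \<beta>))"

context
  fixes w c :: "'m::finite bvec" and C :: "'m bmat" and e :: real
  assumes sym: "\<And>\<alpha> \<beta>. transpose (C \<beta> \<alpha>) = C \<alpha> \<beta>"
    and rows: "\<And>\<alpha>. ((\<lambda>\<beta>. C \<alpha> \<beta> *v w \<beta>) has_sum c \<alpha>) UNIV"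
    and norm: "((\<lambda>\<alpha>. (norm (w \<alpha>))\<^sup>2) has_sum e) UNIV"
    and form: "((\<lambda>(\<alpha>, \<beta>). w \<alpha> \<bullet> (C \<alpha> \<beta> *v w \<beta>)) has_sum 0) UNIV"
    and nz: "\<exists>\<alpha>. w \<alpha> \<noteq> 0"
begin

lemma bnorm_square: "(bnorm w)\<^sup>2 = e" "0 < e"
proof -
  obtain \<alpha> where "w \<alpha> \<noteq> 0" using nz by blast
  then have "0 < (norm (w \<alpha>))\<^sup>2" by simp
  also have "\<dots> \<le> e" using finite_sum_le_has_sum[OF norm, of "{\<alpha>}"] by simp
  finally show "0 < e" .
  then show "(bnorm w)\<^sup>2 = e" using infsumI[OF norm] by (simp add: bnorm_def)
qed

text \<open>
  Row \<open>\<alpha>\<close> of \<open>C w w\<^sup>T\<close> only needs the row sums \<open>c = C w\<close>; by symmetry of \<open>C\<close> the same sums give \<open>w w\<^sup>T C\<close>.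
\<close>

lemma rank_two_skew_outer:
  "rank_two_skew w C \<alpha> \<beta> = (1 / e) *\<^sub>R (outer (c \<alpha>) (w \<beta>) - outer (w \<alpha>) (c \<beta>))"
proof -
  have "bmult C (bouter w w) \<alpha> \<beta> = outer (c \<alpha>) (w \<beta>)"
    unfolding bmult_def bouter_eq matrix_mult_outer
    by (rule infsumI[OF has_sum_bounded_linear[OF bounded_bilinear.bounded_linear_left[OF bounded_bilinear_outer] rows, unfolded o_def]])
  moreover have "bmult (bouter w w) C \<alpha> \<beta> = outer (w \<alpha>) (c \<beta>)"
    unfolding bmult_def bouter_eq outer_matrix_mult sym
    by (rule infsumI[OF has_sum_bounded_linear[OF bounded_bilinear.bounded_linear_right[OF bounded_bilinear_outer] rows, unfolded o_def]])
  ultimately show ?thesis by (simp add: rank_two_skew_def bnorm_square)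
qed

lemma rank_two_skew_antisymmetric: "transpose (rank_two_skew w C \<beta> \<alpha>) = - rank_two_skew w C \<alpha> \<beta>"
  by (simp add: rank_two_skew_outer transpose_scaleR transpose_diff transpose_outer scaleR_diff_right)

lemma diagonal_form: "((\<lambda>\<alpha>. c \<alpha> \<bullet> w \<alpha>) has_sum 0) UNIV"
proof -
  have "((\<lambda>(\<alpha>, \<beta>). w \<alpha> \<bullet> (C \<alpha> \<beta> *v w \<beta>)) has_sum 0) (UNIV \<times> UNIV)" using form by simp
  then have "((\<lambda>\<alpha>. w \<alpha> \<bullet> c \<alpha>) has_sum 0) UNIV"
    by (rule has_sum_SigmaD) (simp, rule has_sum_bounded_linear[OF bounded_linear_inner_right rows, unfolded o_def])
  then show ?thesis by (simp add: inner_commute)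
qed

text \<open>
  \<open>K w = (c |w|\<^sup>2 - w (c\<^sup>T w)) / |w|\<^sup>2\<close>, and \<open>c\<^sup>T w = w\<^sup>T C w = 0\<close>.
\<close>

lemma rank_two_skew_apply: "((\<lambda>\<beta>. rank_two_skew w C \<alpha> \<beta> *v w \<beta>) has_sum c \<alpha>) UNIV"
proof -
  have "((\<lambda>\<beta>. (1 / e) *\<^sub>R ((norm (w \<beta>))\<^sup>2 *\<^sub>R c \<alpha> - (c \<beta> \<bullet> w \<beta>) *\<^sub>R w \<alpha>)) has_sum (1 / e) *\<^sub>R (e *\<^sub>R c \<alpha> - 0 *\<^sub>R w \<alpha>)) UNIV"
    by (intro has_sum_scaleR has_sum_diff norm diagonal_form
      has_sum_bounded_linear[OF bounded_linear_scaleR_left, unfolded o_def])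
  then show ?thesis using bnorm_square(2)
    by (simp add: rank_two_skew_outer scaleR_matrix_vector_assoc[symmetric] matrix_vector_mult_diff_rdistrib
        outer_vector_mult power2_norm_eq_inner)
qed

lemma rank_two_skew_form: "((\<lambda>(\<alpha>, \<beta>). w \<alpha> \<bullet> (rank_two_skew w C \<alpha> \<beta> *v w \<beta>)) has_sum 0) UNIV"
proof -
  have "((\<lambda>(\<alpha>, \<beta>). (c \<alpha> \<bullet> w \<alpha>) * (norm (w \<beta>))\<^sup>2) has_sum (0 * e)) UNIV"
    "((\<lambda>(\<alpha>, \<beta>). (norm (w \<alpha>))\<^sup>2 * (c \<beta> \<bullet> w \<beta>)) has_sum (e * 0)) UNIV"
    by (intro has_sum_bilinear[OF bounded_bilinear_mult] norm diagonal_form)+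
  from has_sum_cmult_right[OF has_sum_diff[OF this], of "1 / e"]
  show ?thesis
    by (simp add: rank_two_skew_outer scaleR_matrix_vector_assoc[symmetric] matrix_vector_mult_diff_rdistrib
        outer_vector_mult power2_norm_eq_inner inner_diff_right inner_commute case_prod_unfold mult.commute)
qed

end

lemma has_sum_sum_finite:
  fixes f :: "'i \<Rightarrow> 'j \<Rightarrow> 'b::real_normed_vector"
  assumes "finite I" "\<And>i. i \<in> I \<Longrightarrow> (f i has_sum S i) A"
  shows "((\<lambda>j. \<Sum>i\<in>I. f i j) has_sum (\<Sum>i\<in>I. S i)) A"
  using assms by (induction I rule: finite_induct) (auto intro: has_sum_add)

section \<open>Evolution of the H-orthogonalized coefficients\<close>

context
  fixes s :: "('d::finite, 'm::{finite,linorder}) ieig" and t :: real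
  assumes sys: "ieig_system s" and t: "t \<in> times s"
begin

lemma system_parts:
  "physical_setting s" "element (Elt s) (normal s)" "orthonormal_poly_basis (Elt s) (phi s)" "open (times s)"
  "\<And>x. x \<in> Elt s \<Longrightarrow> vector_derivative (\<lambda>r. state s r x) (at t)
          + (\<Sum>k\<in>UNIV. Amat s k (state s t x) *v pd k (state s t) x) = 0"
  "\<And>x. x \<in> closure (Elt s) \<Longrightarrow> ((\<lambda>\<alpha>. Phi s \<alpha> x *v coeffs s t \<alpha>) has_sum state s t x) UNIV"
  "\<And>\<alpha>. (\<lambda>\<beta>. MH s t \<alpha> \<beta> *v Udot s t \<beta>) summable_on UNIV"
  "\<And>\<alpha>. (\<lambda>\<beta>. NH s t \<alpha> \<beta> *v coeffs s t \<beta>) summable_on UNIV"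
  "\<And>\<alpha>. bapp (MH s t) (Udot s t) \<alpha> + bapp (NH s t) (coeffs s t) \<alpha> = 0"
  "\<And>r. r \<in> times s \<Longrightarrow> cholesky_factor (MH s r) (chol s r)"
  using sys t unfolding ieig_system_def ieig_solution_def by blast+

text \<open>
  The state extends smoothly to a neighbourhood of the closed element, but it may leave the admissible
  set there; removing those points leaves an open set.
\<close>

lemma smooth_domain:
  obtains T where "open T" "Ck_on 1 T (\<lambda>(t, x). state s t x)"
    "\<And>t x. (t, x) \<in> T \<Longrightarrow> state s t x \<in> Adm s" "times s \<times> closure (Elt s) \<subseteq> T"
proof -
  obtain W where W: "open W" "closure (Elt s) \<subseteq> W" "smooth_on (times s \<times> W) (\<lambda>(t, x). state s t x)"
    and adm: "\<forall>t\<in>times s. \<forall>x\<in>closure (Elt s). state s t x \<in> Adm s"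
    using sys unfolding ieig_system_def ieig_solution_def by blast
  let ?T = "times s \<times> W \<inter> (\<lambda>(t, x). state s t x) -` Adm s"
  have C: "Ck_on 1 (times s \<times> W) (\<lambda>(t, x). state s t x)" by (rule smooth_on_C1[OF W(3)])
  have "open ?T"
    by (rule continuous_open_preimage[OF C1_on_continuous[OF C] open_Times[OF system_parts(4) W(1)]
          Adm_open[OF system_parts(1)]])
  moreover have "Ck_on 1 ?T (\<lambda>(t, x). state s t x)" by (rule C1_on_subset[OF C]) blast
  moreover have "times s \<times> closure (Elt s) \<subseteq> ?T" using W adm by auto
  ultimately show thesis by (intro that[of ?T]) auto
qed

lemma modal_matrix_identities:
  "NH s t \<alpha> \<beta> + transpose (NH s t \<beta> \<alpha>) + VH s t \<alpha> \<beta> = BH s t \<alpha> \<beta>"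
  "transpose (VH s t \<beta> \<alpha>) = VH s t \<alpha> \<beta>" "transpose (BHD s t \<beta> \<alpha>) = BHD s t \<alpha> \<beta>"
proof -
  obtain T where T: "open T" "Ck_on 1 T (\<lambda>(t, x). state s t x)"
    "\<And>t x. (t, x) \<in> T \<Longrightarrow> state s t x \<in> Adm s" "times s \<times> closure (Elt s) \<subseteq> T"
    using smooth_domain by blast
  note * = system_parts(1,2,3) T(1-3) system_parts(4) T(4) t refl
  show "NH s t \<alpha> \<beta> + transpose (NH s t \<beta> \<alpha>) + VH s t \<alpha> \<beta> = BH s t \<alpha> \<beta>"
    by (rule integration_by_parts[OF *])
  show "transpose (VH s t \<beta> \<alpha>) = VH s t \<alpha> \<beta>" by (rule VH_symmetric[OF *])
  show "transpose (BHD s t \<beta> \<alpha>) = BHD s t \<alpha> \<beta>" by (rule BHD_symmetric[OF *])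
qed

text \<open>
  Here \<open>h\<close>, \<open>v\<close> and \<open>b\<close> are \<open>U\<^sup>T M' U\<close>, \<open>U\<^sup>T V U\<close> and \<open>U\<^sup>T B\<^sub>\<Delta> U\<close>.  As integrals they are the three terms of the
  integrated energy balance.  The entries of \<open>M'\<close> are described by derivatives, so that they can be
  compared with those obtained from the Cholesky factor.
\<close>

lemma modal_energy_balance:
  assumes conv: "convergence_convention s"
  obtains D h v b where
    "\<forall>\<gamma> \<delta>. ((\<lambda>r. coeffs s t \<gamma> \<bullet> (MH s r \<gamma> \<delta> *v coeffs s t \<delta>)) has_real_derivative D \<gamma> \<delta>) (at t)"
    "((\<lambda>(\<gamma>, \<delta>). D \<gamma> \<delta>) has_sum h) UNIV"
    "((\<lambda>(\<gamma>, \<delta>). coeffs s t \<gamma> \<bullet> (VH s t \<gamma> \<delta> *v coeffs s t \<delta>)) has_sum v) UNIV"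
    "((\<lambda>(\<gamma>, \<delta>). coeffs s t \<gamma> \<bullet> (BHD s t \<gamma> \<delta> *v coeffs s t \<delta>)) has_sum b) UNIV"
    "h + v + b = 0"
proof -
  obtain T where T: "open T" "Ck_on 1 T (\<lambda>(t, x). state s t x)"
    "\<And>t x. (t, x) \<in> T \<Longrightarrow> state s t x \<in> Adm s" "times s \<times> closure (Elt s) \<subseteq> T"
    using smooth_domain by blast
  note * = system_parts(1,2,3) T(1-3) system_parts(4) T(4) t refl
  let ?H = "\<lambda>x. vector_derivative (\<lambda>r. Hx s r x) (at t)"
  let ?D = "\<lambda>\<gamma> \<delta>. LINT x|lebesgue_on (Elt s). modal_form s t ?H (\<gamma>, \<delta>) x"
  have int: "sum_integral_interchange (lebesgue_on (Elt s)) (modal_form s t ?H)"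
    "sum_integral_interchange (lebesgue_on (Elt s)) (modal_form s t (divHA s t))"
    "sum_integral_interchange (surface_measure (Elt s)) (modal_form s t (normalHDA s t))"
    using conv t unfolding convergence_convention_def by blast+
  have sp: "space (lebesgue_on (Elt s)) \<subseteq> closure (Elt s)" "space (surface_measure (Elt s)) \<subseteq> closure (Elt s)"
    using closure_subset element_frontier_subset[OF system_parts(2)] by (auto simp: space_surface_measure)
  show thesis
  proof (rule that[of ?D])
    show "\<forall>\<gamma> \<delta>. ((\<lambda>r. coeffs s t \<gamma> \<bullet> (MH s r \<gamma> \<delta> *v coeffs s t \<delta>)) has_real_derivative ?D \<gamma> \<delta>) (at t)"
      using MH_derivative[OF *] by (simp add: modal_form_def Phi_vector[OF *(1-8)])
    show "((\<lambda>(\<gamma>, \<delta>). ?D \<gamma> \<delta>) has_sum (LINT x|lebesgue_on (Elt s). state s t x \<bullet> (?H x *v state s t x))) UNIV"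
      using modal_form_has_sum[OF * int(1) sp(1) system_parts(6)] by (simp add: case_prod_unfold)
    show "((\<lambda>(\<gamma>, \<delta>). coeffs s t \<gamma> \<bullet> (VH s t \<gamma> \<delta> *v coeffs s t \<delta>)) has_sum
        (LINT x|lebesgue_on (Elt s). state s t x \<bullet> (divHA s t x *v state s t x))) UNIV"
      using modal_form_has_sum[OF * int(2) sp(1) system_parts(6)]
      by (simp add: VH_def Phi_sandwich[OF *(1-8)] modal_form_matrix[OF * integrable_VH[OF *], symmetric] case_prod_unfold)
    show "((\<lambda>(\<gamma>, \<delta>). coeffs s t \<gamma> \<bullet> (BHD s t \<gamma> \<delta> *v coeffs s t \<delta>)) has_sum
        (LINT x|surface_measure (Elt s). state s t x \<bullet> (normalHDA s t x *v state s t x))) UNIV"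
      using modal_form_has_sum[OF * int(3) sp(2) system_parts(6)]
      by (simp add: BHD_def Phi_sandwich[OF *(1-8)] modal_form_matrix[OF * integrable_BHD[OF *], symmetric] case_prod_unfold)
    show "(LINT x|lebesgue_on (Elt s). state s t x \<bullet> (?H x *v state s t x))
      + (LINT x|lebesgue_on (Elt s). state s t x \<bullet> (divHA s t x *v state s t x))
      + (LINT x|surface_measure (Elt s). state s t x \<bullet> (normalHDA s t x *v state s t x)) = 0"
      by (rule energy_balance_integrated[OF * system_parts(5)])
  qed
qed

lemmas chol_inverse = cholesky_factor_binv[OF system_parts(10)[OF t]]

lemma orth_congr: "orth s t X = congruence (binv (chol s t)) X"
  by (simp add: orth_def congruence_def)

lemma chol_derivative: "((\<lambda>r. chol s r \<alpha> \<beta>) has_vector_derivative Rdot s t \<alpha> \<beta>) (at t)"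
proof -
  have "\<forall>t\<in>times s. \<forall>\<alpha> \<beta>. (\<lambda>r. chol s r \<alpha> \<beta>) differentiable (at t)"
    using sys unfolding ieig_system_def ieig_solution_def by (elim conjE)
  then have "(\<lambda>r. chol s r \<alpha> \<beta>) differentiable (at t)"
    using t by blast
  then show ?thesis by (simp only: Rdot_def vector_derivative_works)
qed

lemma coeffs_derivative: "((\<lambda>r. coeffs s r \<alpha>) has_vector_derivative Udot s t \<alpha>) (at t)"
proof -
  have "smooth_on (times s) (\<lambda>t. coeffs s t \<alpha>)"
    using sys unfolding ieig_system_def ieig_solution_def by blast
  from C1_on_differentiable[OF smooth_on_C1[OF this] t] show ?thesis
    by (simp only: Udot_def vector_derivative_works)
qed

lemma bupper_Rdot: "bupper (Rdot s t)"
  unfolding bupper_def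
proof (intro allI impI)
  fix \<alpha> \<beta> :: nat assume "\<beta> < \<alpha>"
  then have "chol s r \<alpha> \<beta> = 0" if "r \<in> times s" for r
    using system_parts(10)[OF that] by (auto simp: cholesky_factor_def bupper_def)
  then have "((\<lambda>r. chol s r \<alpha> \<beta>) has_vector_derivative 0) (at t)"
    by (intro has_vector_derivative_transform_within_open[OF has_vector_derivative_const system_parts(4) t]) simp
  then show "Rdot s t \<alpha> \<beta> = 0"
    by (rule vector_derivative_unique_at[OF chol_derivative])
qed

lemma bupper_Smat: "bupper (Smat s t)"
  unfolding Smat_def by (rule bupper_bmult[OF bupper_Rdot chol_inverse(2)])

lemma Smat_chol: "row_mult (Smat s t \<alpha>) (chol s t) = Rdot s t \<alpha>"
proof -
  have "Smat s t \<alpha> = row_mult (Rdot s t \<alpha>) (binv (chol s t))"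
    by (rule ext) (simp add: Smat_def bmult_upper_right[OF chol_inverse(2)])
  then show ?thesis
    by (simp add: row_mult_assoc[OF chol_inverse(2,1)] chol_inverse(4) row_mult_bid)
qed

text \<open>
  \<open>M' = R\<^sup>T R' + R'\<^sup>T R\<close>, from the Cholesky factorization at all times near \<open>t\<close>.
\<close>

lemma MH_form_derivative:
  "((\<lambda>r. v \<bullet> (MH s r \<gamma> \<delta> *v w)) has_real_derivative
      v \<bullet> ((\<Sum>\<alpha>\<le>\<gamma>. transpose (chol s t \<alpha> \<gamma>) ** Rdot s t \<alpha> \<delta>) *v w)
    + w \<bullet> ((\<Sum>\<alpha>\<le>\<delta>. transpose (chol s t \<alpha> \<delta>) ** Rdot s t \<alpha> \<gamma>) *v v)) (at t)"
proof -
  let ?f = "\<lambda>r. \<Sum>\<alpha>\<le>\<gamma>. (chol s r \<alpha> \<gamma> *v v) \<bullet> (chol s r \<alpha> \<delta> *v w)"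
  let ?N = "max \<gamma> \<delta>"
  have mv: "((\<lambda>r. chol s r \<alpha> \<beta> *v x) has_vector_derivative Rdot s t \<alpha> \<beta> *v x) (at t)" for \<alpha> \<beta> x
    by (rule bounded_linear.has_vector_derivative[OF
       bounded_bilinear.bounded_linear_left[OF bounded_bilinear_matrix_vector_mult] chol_derivative])
  have eq: "v \<bullet> (MH s r \<gamma> \<delta> *v w) = ?f r" if "r \<in> times s" for r
  proof -
    note c = cholesky_factor_binv[OF system_parts(10)[OF that]]
    show ?thesis
      unfolding c(5) bmult_lower_left[OF c(1)] matrix_vector_sum_left inner_sum_right
      by (simp add: matrix_vector_mul_assoc[symmetric] inner_vector_matrix_mult)
  qed
  have "(?f has_vector_derivative (\<Sum>\<alpha>\<le>\<gamma>. (chol s t \<alpha> \<gamma> *v v) \<bullet> (Rdot s t \<alpha> \<delta> *v w)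
       + (Rdot s t \<alpha> \<gamma> *v v) \<bullet> (chol s t \<alpha> \<delta> *v w))) (at t)"
    by (intro has_vector_derivative_sum bounded_bilinear.has_vector_derivative[OF bounded_bilinear_inner] mv)
  also have "(\<Sum>\<alpha>\<le>\<gamma>. (chol s t \<alpha> \<gamma> *v v) \<bullet> (Rdot s t \<alpha> \<delta> *v w)
       + (Rdot s t \<alpha> \<gamma> *v v) \<bullet> (chol s t \<alpha> \<delta> *v w))
    = (\<Sum>\<alpha>\<le>\<gamma>. (chol s t \<alpha> \<gamma> *v v) \<bullet> (Rdot s t \<alpha> \<delta> *v w))
      + (\<Sum>\<alpha>\<le>\<gamma>. (chol s t \<alpha> \<delta> *v w) \<bullet> (Rdot s t \<alpha> \<gamma> *v v))"
    by (simp add: sum.distrib inner_commute)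
  also have "(\<Sum>\<alpha>\<le>\<gamma>. (chol s t \<alpha> \<delta> *v w) \<bullet> (Rdot s t \<alpha> \<gamma> *v v))
      = (\<Sum>\<alpha>\<le>?N. (chol s t \<alpha> \<delta> *v w) \<bullet> (Rdot s t \<alpha> \<gamma> *v v))"
    using bupper_Rdot by (intro sum.mono_neutral_left) (auto simp: bupper_def not_le)
  also have "\<dots> = (\<Sum>\<alpha>\<le>\<delta>. (chol s t \<alpha> \<delta> *v w) \<bullet> (Rdot s t \<alpha> \<gamma> *v v))"
    using chol_inverse(1) by (intro sum.mono_neutral_right) (auto simp: bupper_def not_le)
  finally have "(?f has_real_derivative v \<bullet> ((\<Sum>\<alpha>\<le>\<gamma>. transpose (chol s t \<alpha> \<gamma>) ** Rdot s t \<alpha> \<delta>) *v w)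
    + w \<bullet> ((\<Sum>\<alpha>\<le>\<delta>. transpose (chol s t \<alpha> \<delta>) ** Rdot s t \<alpha> \<gamma>) *v v)) (at t)"
    by (simp add: has_real_derivative_iff_has_vector_derivative matrix_vector_sum_left inner_sum_right
         matrix_vector_mul_assoc[symmetric] inner_vector_matrix_mult)
  then show ?thesis
    using eq system_parts(4) t by (auto intro: has_field_derivative_transform_within_open)
qed

lemma bapp_Uo: "bapp (chol s t) (coeffs s t) = Uo s t" by (simp add: Uo_def)

context
  assumes conv: "convergence_convention s"
begin

lemma chol_rows: "(\<lambda>\<beta>. chol s t \<alpha> \<beta> *v coeffs s t \<beta>) summable_on UNIV"
  using conv t unfolding convergence_convention_def termwise_differentiable_def by blast

lemma rearrangements:
  "rearrangeable (chol s t) (coeffs s t) (orth s t (NH s t))"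
  "rearrangeable (chol s t) (coeffs s t) (orth s t (VH s t))"
  "rearrangeable (chol s t) (coeffs s t) (orth s t (BH s t))"
  "rearrangeable (chol s t) (coeffs s t) (orth s t (BHD s t))"
  "rearrangeable (chol s t) (coeffs s t) (Smat s t)"
  using conv t unfolding convergence_convention_def by blast+

lemma row_sums:
  assumes "rearrangeable (chol s t) (coeffs s t) X"
  shows "((\<lambda>\<beta>. X \<alpha> \<beta> *v Uo s t \<beta>) has_sum bapp X (Uo s t) \<alpha>) UNIV"
    "((\<lambda>\<gamma>. row_mult (X \<alpha>) (chol s t) \<gamma> *v coeffs s t \<gamma>) has_sum bapp X (Uo s t) \<alpha>) UNIV"
proof -
  have Z: "(\<lambda>(\<beta>, \<gamma>). X \<alpha> \<beta> *v (chol s t \<beta> \<gamma> *v coeffs s t \<gamma>)) summable_on UNIV"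
    using assms by (simp add: rearrangeable_def)
  obtain S where S: "((\<lambda>\<beta>. X \<alpha> \<beta> *v Uo s t \<beta>) has_sum S) UNIV"
     "((\<lambda>\<gamma>. row_mult (X \<alpha>) (chol s t) \<gamma> *v coeffs s t \<gamma>) has_sum S) UNIV"
    by (rule row_rearrange[OF chol_inverse(1) chol_rows Z, unfolded bapp_Uo])
  have "S = bapp X (Uo s t) \<alpha>" using infsumI[OF S(1)] by (simp add: bapp_def)
  with S show "((\<lambda>\<beta>. X \<alpha> \<beta> *v Uo s t \<beta>) has_sum bapp X (Uo s t) \<alpha>) UNIV"
    "((\<lambda>\<gamma>. row_mult (X \<alpha>) (chol s t) \<gamma> *v coeffs s t \<gamma>) has_sum bapp X (Uo s t) \<alpha>) UNIV" by simp_all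
qed

lemma form_sums:
  assumes "rearrangeable (chol s t) (coeffs s t) X"
  obtains S where "((\<lambda>(\<alpha>, \<beta>). Uo s t \<alpha> \<bullet> (X \<alpha> \<beta> *v Uo s t \<beta>)) has_sum S) UNIV"
    "((\<lambda>(\<gamma>, \<delta>). coeffs s t \<gamma> \<bullet> ((\<Sum>\<alpha>\<le>\<gamma>. \<Sum>\<beta>\<le>\<delta>. transpose (chol s t \<alpha> \<gamma>) ** X \<alpha> \<beta> ** chol s t \<beta> \<delta>) *v coeffs s t \<delta>)) has_sum S) UNIV"
proof -
  have "(\<lambda>(\<alpha>, \<beta>, \<gamma>, \<delta>). (chol s t \<alpha> \<gamma> *v coeffs s t \<gamma>) \<bullet> (X \<alpha> \<beta> *v (chol s t \<beta> \<delta> *v coeffs s t \<delta>))) summable_on UNIV"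
    using assms by (simp add: rearrangeable_def)
  then show thesis
    by (rule quadratic_rearrange[OF chol_inverse(1) chol_rows, unfolded bapp_Uo]) (rule that)
qed

lemma orth_form_sums:
  assumes "rearrangeable (chol s t) (coeffs s t) (orth s t X)"
    and "((\<lambda>(\<gamma>, \<delta>). coeffs s t \<gamma> \<bullet> (X \<gamma> \<delta> *v coeffs s t \<delta>)) has_sum S) UNIV"
  shows "((\<lambda>(\<alpha>, \<beta>). Uo s t \<alpha> \<bullet> (orth s t X \<alpha> \<beta> *v Uo s t \<beta>)) has_sum S) UNIV"
proof -
  obtain S' where S': "((\<lambda>(\<alpha>, \<beta>). Uo s t \<alpha> \<bullet> (orth s t X \<alpha> \<beta> *v Uo s t \<beta>)) has_sum S') UNIV"
    and "((\<lambda>(\<gamma>, \<delta>). coeffs s t \<gamma> \<bullet> ((\<Sum>\<alpha>\<le>\<gamma>. \<Sum>\<beta>\<le>\<delta>. transpose (chol s t \<alpha> \<gamma>) ** orth s t X \<alpha> \<beta> ** chol s t \<beta> \<delta>)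
         *v coeffs s t \<delta>)) has_sum S') UNIV"
    by (rule form_sums[OF assms(1)])
  from this(2) have "((\<lambda>(\<gamma>, \<delta>). coeffs s t \<gamma> \<bullet> (X \<gamma> \<delta> *v coeffs s t \<delta>)) has_sum S') UNIV"
    unfolding orth_congr congruence_cancel[OF chol_inverse(1,2,4)] .
  then have "S' = S" by (rule has_sum_unique[OF _ assms(2)])
  with S' show ?thesis by (simp only:)
qed

text \<open>
  \<open>R U' = R\<^sup>-\<^sup>T (M U') = - R\<^sup>-\<^sup>T (N U) = - N\<^sup>o w\<close>.  Multiplication by a row of \<open>R\<^sup>-\<^sup>T\<close> is a finite combination of
  the rows of the coefficient equation, which also shows that the series \<open>R U'\<close> converges.
\<close>

lemma chol_Udot_rows:
  "((\<lambda>\<beta>. chol s t \<alpha> \<beta> *v Udot s t \<beta>) has_sum - bapp (orth s t (NH s t)) (Uo s t) \<alpha>) UNIV"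
proof -
  let ?Y = "binv (chol s t)" and ?R = "chol s t"
  have tb: "bounded_linear (\<lambda>v. transpose (?Y \<gamma> \<alpha>) *v v)" for \<gamma> by (rule matrix_vector_mul_bounded_linear)
  have M: "(\<Sum>\<gamma>\<le>\<alpha>. transpose (?Y \<gamma> \<alpha>) ** MH s t \<gamma> \<beta>) = ?R \<alpha> \<beta>" for \<beta>
    using congruence_column_cancel[OF chol_inverse(2,1,3), of \<alpha> ?R \<beta>] by (simp add: chol_inverse(5)[symmetric])
  have N: "(\<Sum>\<gamma>\<le>\<alpha>. transpose (?Y \<gamma> \<alpha>) ** NH s t \<gamma> \<beta>) = row_mult (orth s t (NH s t) \<alpha>) ?R \<beta>" for \<beta>
    by (simp add: orth_congr congruence_row_cancel[OF chol_inverse(1,2,4)] bmult_lower_left[OF chol_inverse(2)])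
  have "((\<lambda>\<beta>. \<Sum>\<gamma>\<le>\<alpha>. transpose (?Y \<gamma> \<alpha>) *v (NH s t \<gamma> \<beta> *v coeffs s t \<beta>)) has_sum
      (\<Sum>\<gamma>\<le>\<alpha>. transpose (?Y \<gamma> \<alpha>) *v bapp (NH s t) (coeffs s t) \<gamma>)) UNIV"
    by (intro has_sum_sum_finite has_sum_bounded_linear[OF tb, unfolded o_def] bapp_has_sum system_parts(8)) auto
  then have "((\<lambda>\<beta>. row_mult (orth s t (NH s t) \<alpha>) ?R \<beta> *v coeffs s t \<beta>) has_sum
      (\<Sum>\<gamma>\<le>\<alpha>. transpose (?Y \<gamma> \<alpha>) *v bapp (NH s t) (coeffs s t) \<gamma>)) UNIV"
    unfolding N[symmetric] matrix_vector_sum_left matrix_vector_mul_assoc .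
  from has_sum_unique[OF this row_sums(2)[OF rearrangements(1)]]
  \<comment> \<open>Both numbers are sums of the series with row \<open>R\<^sup>-\<^sup>T N = N\<^sup>o R\<close> applied to \<open>U\<close>.\<close>
  have NU: "(\<Sum>\<gamma>\<le>\<alpha>. transpose (?Y \<gamma> \<alpha>) *v bapp (NH s t) (coeffs s t) \<gamma>) = bapp (orth s t (NH s t)) (Uo s t) \<alpha>" .
  have "((\<lambda>\<beta>. \<Sum>\<gamma>\<le>\<alpha>. transpose (?Y \<gamma> \<alpha>) *v (MH s t \<gamma> \<beta> *v Udot s t \<beta>)) has_sum
      (\<Sum>\<gamma>\<le>\<alpha>. transpose (?Y \<gamma> \<alpha>) *v bapp (MH s t) (Udot s t) \<gamma>)) UNIV"
    by (intro has_sum_sum_finite has_sum_bounded_linear[OF tb, unfolded o_def] bapp_has_sum system_parts(7)) auto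
  then have "((\<lambda>\<beta>. ?R \<alpha> \<beta> *v Udot s t \<beta>) has_sum
      (\<Sum>\<gamma>\<le>\<alpha>. transpose (?Y \<gamma> \<alpha>) *v bapp (MH s t) (Udot s t) \<gamma>)) UNIV"
    unfolding M[symmetric] matrix_vector_sum_left matrix_vector_mul_assoc .
  also have "bapp (MH s t) (Udot s t) = (\<lambda>\<gamma>. - bapp (NH s t) (coeffs s t) \<gamma>)"
    using system_parts(9) by (auto simp: eq_neg_iff_add_eq_0)
  finally show ?thesis
    unfolding linear_neg[OF matrix_vector_mul_linear] sum_negf NU .
qed

text \<open>
  The termwise derivative of \<open>R U\<close> is \<open>R' U + R U'\<close>, and \<open>R' U = (S R) U = S w\<close>.
\<close>

lemma Uo_evolution:
  "((\<lambda>r. Uo s r \<alpha>) has_vector_derivative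
     (bapp (Smat s t) (Uo s t) \<alpha> - bapp (orth s t (NH s t)) (Uo s t) \<alpha>)) (at t)"
proof -
  let ?f = "\<lambda>\<beta> r. chol s r \<alpha> \<beta> *v coeffs s r \<beta>"
  have "termwise_differentiable (times s) ?f"
    using conv unfolding convergence_convention_def by blast
  then have der: "((\<lambda>r. \<Sum>\<^sub>\<infinity>\<beta>. ?f \<beta> r) has_vector_derivative (\<Sum>\<^sub>\<infinity>\<beta>. vector_derivative (?f \<beta>) (at t))) (at t)"
    using t unfolding termwise_differentiable_def by blast
  have "vector_derivative (?f \<beta>) (at t) = chol s t \<alpha> \<beta> *v Udot s t \<beta> + Rdot s t \<alpha> \<beta> *v coeffs s t \<beta>" for \<beta>
    by (intro vector_derivative_at bounded_bilinear.has_vector_derivative[OF bounded_bilinear_matrix_vector_mult]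
        chol_derivative coeffs_derivative)
  moreover have "((\<lambda>\<beta>. chol s t \<alpha> \<beta> *v Udot s t \<beta> + Rdot s t \<alpha> \<beta> *v coeffs s t \<beta>) has_sum
     (- bapp (orth s t (NH s t)) (Uo s t) \<alpha> + bapp (Smat s t) (Uo s t) \<alpha>)) UNIV"
    by (intro has_sum_add chol_Udot_rows row_sums(2)[OF rearrangements(5), unfolded Smat_chol])
  ultimately have "(\<Sum>\<^sub>\<infinity>\<beta>. vector_derivative (?f \<beta>) (at t)) = bapp (Smat s t) (Uo s t) \<alpha> - bapp (orth s t (NH s t)) (Uo s t) \<alpha>"
    by (simp add: infsumI)
  with der show ?thesis by (simp add: Uo_def bapp_def)
qed

end

end

section \<open>Energy transfer between modes\<close>

context
  fixes s :: "('d::finite, 'm::{finite,linorder}) ieig" and t :: real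
  assumes sys: "ieig_system s" and t: "t \<in> times s" and conv: "convergence_convention s"
begin

lemma orth_transpose: "orth s t (btrans X) \<alpha> \<beta> = transpose (orth s t X \<beta> \<alpha>)"
  unfolding orth_congr[OF sys t] by (rule congruence_transpose[OF chol_inverse(2)[OF sys t]])

lemma orth_symmetric:
  "transpose (orth s t (VH s t) \<beta> \<alpha>) = orth s t (VH s t) \<alpha> \<beta>"
  "transpose (orth s t (BHD s t) \<beta> \<alpha>) = orth s t (BHD s t) \<alpha> \<beta>"
proof -
  have "btrans (VH s t) = VH s t" "btrans (BHD s t) = BHD s t"
    by (intro ext, simp add: btrans_def modal_matrix_identities[OF sys t])+
  then show "transpose (orth s t (VH s t) \<beta> \<alpha>) = orth s t (VH s t) \<alpha> \<beta>"
    "transpose (orth s t (BHD s t) \<beta> \<alpha>) = orth s t (BHD s t) \<alpha> \<beta>"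
    using orth_transpose[of "VH s t" \<alpha> \<beta>] orth_transpose[of "BHD s t" \<alpha> \<beta>] by simp_all
qed

lemma orth_integration_by_parts:
  "transpose (orth s t (NH s t) \<beta> \<alpha>) = orth s t (BH s t) \<alpha> \<beta> - orth s t (VH s t) \<alpha> \<beta> - orth s t (NH s t) \<alpha> \<beta>"
proof -
  note add = congruence_add[OF chol_inverse(2)[OF sys t]]
  have BH: "BH s t = (\<lambda>\<alpha> \<beta>. NH s t \<alpha> \<beta> + btrans (NH s t) \<alpha> \<beta> + VH s t \<alpha> \<beta>)"
    by (intro ext) (simp add: btrans_def modal_matrix_identities(1)[OF sys t])
  have "orth s t (BH s t) \<alpha> \<beta> = orth s t (\<lambda>\<alpha> \<beta>. NH s t \<alpha> \<beta> + btrans (NH s t) \<alpha> \<beta>) \<alpha> \<beta> + orth s t (VH s t) \<alpha> \<beta>"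
    unfolding BH orth_congr[OF sys t] by (rule add)
  also have "orth s t (\<lambda>\<alpha> \<beta>. NH s t \<alpha> \<beta> + btrans (NH s t) \<alpha> \<beta>) \<alpha> \<beta>
      = orth s t (NH s t) \<alpha> \<beta> + orth s t (btrans (NH s t)) \<alpha> \<beta>"
    unfolding orth_congr[OF sys t] by (rule add)
  finally show ?thesis by (simp add: orth_transpose)
qed

text \<open>
  \<open>S\<close> is upper triangular, so the rows of \<open>S\<^sup>T\<close> are finite.
\<close>

lemma Smat_transposed_rows:
  "((\<lambda>\<beta>. transpose (Smat s t \<beta> \<alpha>) *v v \<beta>) has_sum (\<Sum>\<beta>\<le>\<alpha>. transpose (Smat s t \<beta> \<alpha>) *v v \<beta>)) UNIV"
  using bupper_Smat[OF sys t]
  by (intro has_sum_finite_neutralI[of "{..\<alpha>}"]) (auto simp: bupper_def not_le transpose_zero)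

lemma CH_symmetric: "transpose (CH s t \<beta> \<alpha>) = CH s t \<alpha> \<beta>"
  using orth_symmetric[of \<beta> \<alpha>]
  by (simp add: CH_def btrans_def transpose_scaleR linear_add[OF bounded_linear.linear[OF bounded_linear_transpose]] ac_simps)

text \<open>
  \<open>2 w\<^sup>T C w = 2 w\<^sup>T S w + w\<^sup>T V\<^sup>o w + w\<^sup>T B\<^sub>\<Delta>\<^sup>o w\<close>.  In the original coefficients the last two terms are \<open>U\<^sup>T V U\<close> and
  \<open>U\<^sup>T B\<^sub>\<Delta> U\<close>, and the first one is \<open>2 U\<^sup>T R\<^sup>T R' U = U\<^sup>T M' U\<close>; their sum vanishes by the energy balance.
\<close>

lemma CH_form: "((\<lambda>(\<alpha>, \<beta>). Uo s t \<alpha> \<bullet> (CH s t \<alpha> \<beta> *v Uo s t \<beta>)) has_sum 0) UNIV"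
proof -
  let ?T = "\<lambda>\<gamma> \<delta>. \<Sum>\<alpha>\<le>\<gamma>. transpose (chol s t \<alpha> \<gamma>) ** Rdot s t \<alpha> \<delta>"
  let ?U = "coeffs s t" and ?w = "Uo s t"
  obtain D h v b where bal:
    "\<forall>\<gamma> \<delta>. ((\<lambda>r. ?U \<gamma> \<bullet> (MH s r \<gamma> \<delta> *v ?U \<delta>)) has_real_derivative D \<gamma> \<delta>) (at t)"
    "((\<lambda>(\<gamma>, \<delta>). D \<gamma> \<delta>) has_sum h) UNIV"
    "((\<lambda>(\<gamma>, \<delta>). ?U \<gamma> \<bullet> (VH s t \<gamma> \<delta> *v ?U \<delta>)) has_sum v) UNIV"
    "((\<lambda>(\<gamma>, \<delta>). ?U \<gamma> \<bullet> (BHD s t \<gamma> \<delta> *v ?U \<delta>)) has_sum b) UNIV"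
    "h + v + b = 0"
    by (rule modal_energy_balance[OF sys t conv])
  obtain a where a: "((\<lambda>(\<alpha>, \<beta>). ?w \<alpha> \<bullet> (Smat s t \<alpha> \<beta> *v ?w \<beta>)) has_sum a) UNIV"
    and aT: "((\<lambda>(\<gamma>, \<delta>). ?U \<gamma> \<bullet> ((\<Sum>\<alpha>\<le>\<gamma>. \<Sum>\<beta>\<le>\<delta>. transpose (chol s t \<alpha> \<gamma>) ** Smat s t \<alpha> \<beta> ** chol s t \<beta> \<delta>) *v ?U \<delta>)) has_sum a) UNIV"
    by (rule form_sums[OF sys t conv rearrangements(5)[OF sys t conv]])
  have "(\<Sum>\<alpha>\<le>\<gamma>. \<Sum>\<beta>\<le>\<delta>. transpose (chol s t \<alpha> \<gamma>) ** Smat s t \<alpha> \<beta> ** chol s t \<beta> \<delta>) = ?T \<gamma> \<delta>" for \<gamma> \<delta>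
    by (simp add: Smat_chol[OF sys t, symmetric] row_mult_def matrix_mult_sum_right matrix_mul_assoc)
  with aT have aT: "((\<lambda>(\<gamma>, \<delta>). ?U \<gamma> \<bullet> (?T \<gamma> \<delta> *v ?U \<delta>)) has_sum a) UNIV"
    by (simp only:)
  have D: "D \<gamma> \<delta> = ?U \<gamma> \<bullet> (?T \<gamma> \<delta> *v ?U \<delta>) + ?U \<delta> \<bullet> (?T \<delta> \<gamma> *v ?U \<gamma>)" for \<gamma> \<delta>
    by (rule DERIV_unique[OF bal(1)[rule_format] MH_form_derivative[OF sys t]])
  have "((\<lambda>(\<gamma>, \<delta>). ?U \<gamma> \<bullet> (?T \<gamma> \<delta> *v ?U \<delta>) + ?U \<delta> \<bullet> (?T \<delta> \<gamma> *v ?U \<gamma>)) has_sum (a + a)) UNIV"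
    using has_sum_add[OF aT has_sum_transposed_form[OF aT]]
    by (simp add: inner_transpose case_prod_unfold del: transpose_matrix_vector)
  then have "h = a + a"
    using bal(2) unfolding D by (rule has_sum_unique[symmetric])
  have "((\<lambda>(\<alpha>, \<beta>). 1/2 * (?w \<alpha> \<bullet> (Smat s t \<alpha> \<beta> *v ?w \<beta>) + ?w \<alpha> \<bullet> (transpose (Smat s t \<beta> \<alpha>) *v ?w \<beta>)
      + ?w \<alpha> \<bullet> (orth s t (VH s t) \<alpha> \<beta> *v ?w \<beta>) + ?w \<alpha> \<bullet> (orth s t (BHD s t) \<alpha> \<beta> *v ?w \<beta>)))
     has_sum (1/2 * (a + a + v + b))) UNIV"
    using has_sum_cmult_right[OF has_sum_add[OF has_sum_add[OF has_sum_add[OF a has_sum_transposed_form[OF a]]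
        orth_form_sums[OF sys t conv rearrangements(2)[OF sys t conv] bal(3)]]
        orth_form_sums[OF sys t conv rearrangements(4)[OF sys t conv] bal(4)]], of "1/2"]
    by (simp only: case_prod_unfold)
  moreover have "a + a + v + b = 0" using bal(5) \<open>h = a + a\<close> by simp
  ultimately show ?thesis
    by (simp add: CH_def btrans_def matrix_vector_mult_add_rdistrib inner_add_right
        scaleR_matrix_vector_assoc[symmetric] case_prod_unfold del: transpose_matrix_vector)
qed

lemma Emode_summable: "(\<lambda>\<alpha>. Emode s t \<alpha>) summable_on UNIV"
  using conv t unfolding convergence_convention_def termwise_differentiable_def by blast

context
  assumes nz: "\<exists>\<alpha>. Uo s t \<alpha> \<noteq> 0"
begin

text \<open>
  In these names \<open>U\<close> stands for \<open>U\<^sup>(\<^sup>o\<^sup>)\<close>, \<open>D\<close> for \<open>B\<^sub>\<Delta>\<close> and \<open>St\<close> for \<open>S\<^sup>T\<close>.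
\<close>

abbreviation (input) "NU \<equiv> bapp (orth s t (NH s t)) (Uo s t)"
abbreviation (input) "BU \<equiv> bapp (orth s t (BH s t)) (Uo s t)"
abbreviation (input) "VU \<equiv> bapp (orth s t (VH s t)) (Uo s t)"
abbreviation (input) "DU \<equiv> bapp (orth s t (BHD s t)) (Uo s t)"
abbreviation (input) "SU \<equiv> bapp (Smat s t) (Uo s t)"
abbreviation (input) "StU \<equiv> \<lambda>\<alpha>. (\<Sum>\<beta>\<le>\<alpha>. transpose (Smat s t \<beta> \<alpha>) *v Uo s t \<beta>)"
abbreviation (input) "CU \<equiv> \<lambda>\<alpha>. (1/2) *\<^sub>R (SU \<alpha> + StU \<alpha> + VU \<alpha> + DU \<alpha>)"

lemmas rows = row_sums(1)[OF sys t conv rearrangements(1)[OF sys t conv]]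
  row_sums(1)[OF sys t conv rearrangements(2)[OF sys t conv]]
  row_sums(1)[OF sys t conv rearrangements(3)[OF sys t conv]]
  row_sums(1)[OF sys t conv rearrangements(4)[OF sys t conv]]
  row_sums(1)[OF sys t conv rearrangements(5)[OF sys t conv]]

lemma CH_rows: "((\<lambda>\<beta>. CH s t \<alpha> \<beta> *v Uo s t \<beta>) has_sum CU \<alpha>) UNIV"
proof -
  have "((\<lambda>\<beta>. (1/2) *\<^sub>R (Smat s t \<alpha> \<beta> *v Uo s t \<beta> + transpose (Smat s t \<beta> \<alpha>) *v Uo s t \<beta>
     + orth s t (VH s t) \<alpha> \<beta> *v Uo s t \<beta> + orth s t (BHD s t) \<alpha> \<beta> *v Uo s t \<beta>)) has_sum CU \<alpha>) UNIV"
    by (intro has_sum_scaleR has_sum_add rows Smat_transposed_rows)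
  then show ?thesis
    by (simp add: CH_def btrans_def matrix_vector_mult_add_rdistrib
        scaleR_matrix_vector_assoc[symmetric] del: transpose_matrix_vector)
qed

lemma Uo_norm_sum: "((\<lambda>\<alpha>. (norm (Uo s t \<alpha>))\<^sup>2) has_sum (2 * (\<Sum>\<^sub>\<infinity>\<alpha>. Emode s t \<alpha>))) UNIV"
  using has_sum_cmult_right[OF has_sum_infsum[OF Emode_summable], of 2] by (simp add: Emode_def)

lemma KH_rank_two: "KH s t = rank_two_skew (Uo s t) (CH s t)"
  by (simp add: KH_def rank_two_skew_def)

lemmas KH_facts =
  rank_two_skew_antisymmetric[OF CH_symmetric CH_rows Uo_norm_sum CH_form nz, folded KH_rank_two]
  rank_two_skew_apply[OF CH_symmetric CH_rows Uo_norm_sum CH_form nz, folded KH_rank_two]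
  rank_two_skew_form[OF CH_symmetric CH_rows Uo_norm_sum CH_form nz, folded KH_rank_two]

lemma skewop_expand:
  "skewop s t \<alpha> \<beta> = (1/2) *\<^sub>R (orth s t (NH s t) \<alpha> \<beta> - transpose (orth s t (NH s t) \<beta> \<alpha>))
     - (1/2) *\<^sub>R (Smat s t \<alpha> \<beta> - transpose (Smat s t \<beta> \<alpha>)) - KH s t \<alpha> \<beta>"
  by (simp add: skewop_def bskw_def btrans_def)

lemma skewop_antisymmetric: "transpose (skewop s t \<beta> \<alpha>) = - skewop s t \<alpha> \<beta>"
  unfolding skewop_expand transpose_diff transpose_scaleR transpose_transpose KH_facts(1)
  by (simp add: algebra_simps)

text \<open>
  Equivalently \<open>- skewop w - (B\<^sup>o + B\<^sub>\<Delta>\<^sup>o) w / 2 = (S - N\<^sup>o) w\<close>: the row sums of the transpose of \<open>N\<^sup>o\<close> come from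
  integration by parts, and \<open>K w = C w\<close>.
\<close>

lemma skewop_rows:
  "((\<lambda>\<beta>. skewop s t \<alpha> \<beta> *v Uo s t \<beta>) has_sum (NU \<alpha> - SU \<alpha> - (1/2) *\<^sub>R (BU \<alpha> + DU \<alpha>))) UNIV"
proof -
  have "((\<lambda>\<beta>. transpose (orth s t (NH s t) \<beta> \<alpha>) *v Uo s t \<beta>) has_sum (BU \<alpha> - VU \<alpha> - NU \<alpha>)) UNIV"
    unfolding orth_integration_by_parts matrix_vector_mult_diff_rdistrib
    by (intro has_sum_diff rows)
  then have "((\<lambda>\<beta>. skewop s t \<alpha> \<beta> *v Uo s t \<beta>) has_sum
     ((1/2) *\<^sub>R (NU \<alpha> - (BU \<alpha> - VU \<alpha> - NU \<alpha>)) - (1/2) *\<^sub>R (SU \<alpha> - StU \<alpha>) - CU \<alpha>)) UNIV"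
    unfolding skewop_expand matrix_vector_mult_diff_rdistrib scaleR_matrix_vector_assoc[symmetric]
    by (intro has_sum_diff has_sum_scaleR rows Smat_transposed_rows KH_facts(2))
  moreover have "(1/2) *\<^sub>R (NU \<alpha> - (BU \<alpha> - VU \<alpha> - NU \<alpha>)) - (1/2) *\<^sub>R (SU \<alpha> - StU \<alpha>) - CU \<alpha>
     = NU \<alpha> - SU \<alpha> - (1/2) *\<^sub>R (BU \<alpha> + DU \<alpha>)"
    by (simp add: vec_eq_iff field_simps del: transpose_matrix_vector)
  ultimately show ?thesis by simp
qed

text \<open>
  The form of a matrix and that of its transpose have the same sum.
\<close>

lemma skewop_form: "((\<lambda>(\<alpha>, \<beta>). Uo s t \<alpha> \<bullet> (skewop s t \<alpha> \<beta> *v Uo s t \<beta>)) has_sum 0) UNIV"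
proof -
  obtain n where n: "((\<lambda>(\<alpha>, \<beta>). Uo s t \<alpha> \<bullet> (orth s t (NH s t) \<alpha> \<beta> *v Uo s t \<beta>)) has_sum n) UNIV"
    by (rule form_sums[OF sys t conv rearrangements(1)[OF sys t conv]])
  obtain a where a: "((\<lambda>(\<alpha>, \<beta>). Uo s t \<alpha> \<bullet> (Smat s t \<alpha> \<beta> *v Uo s t \<beta>)) has_sum a) UNIV"
    by (rule form_sums[OF sys t conv rearrangements(5)[OF sys t conv]])
  from has_sum_diff[OF has_sum_diff[OF
      has_sum_cmult_right[OF has_sum_diff[OF n has_sum_transposed_form[OF n]], of "1/2"]
      has_sum_cmult_right[OF has_sum_diff[OF a has_sum_transposed_form[OF a]], of "1/2"]] KH_facts(3)]
  show ?thesis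
    by (simp add: skewop_expand matrix_vector_mult_diff_rdistrib scaleR_matrix_vector_assoc[symmetric]
        inner_diff_right case_prod_unfold del: transpose_matrix_vector)
qed

lemma BHGo_rows: "((\<lambda>\<beta>. BHGo s t \<alpha> \<beta> *v Uo s t \<beta>) has_sum (BU \<alpha> + DU \<alpha>)) UNIV"
  unfolding BHGo_def matrix_vector_mult_add_rdistrib by (intro has_sum_add rows)

lemma BHGo_form:
  obtains b where "((\<lambda>(\<alpha>, \<beta>). Uo s t \<alpha> \<bullet> (BHGo s t \<alpha> \<beta> *v Uo s t \<beta>)) has_sum b) UNIV"
proof -
  obtain b1 where b1: "((\<lambda>(\<alpha>, \<beta>). Uo s t \<alpha> \<bullet> (orth s t (BH s t) \<alpha> \<beta> *v Uo s t \<beta>)) has_sum b1) UNIV"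
    by (rule form_sums[OF sys t conv rearrangements(3)[OF sys t conv]])
  obtain b2 where b2: "((\<lambda>(\<alpha>, \<beta>). Uo s t \<alpha> \<bullet> (orth s t (BHD s t) \<alpha> \<beta> *v Uo s t \<beta>)) has_sum b2) UNIV"
    by (rule form_sums[OF sys t conv rearrangements(4)[OF sys t conv]])
  show thesis
    using that[of "b1 + b2"] has_sum_add[OF b1 b2]
    by (simp add: BHGo_def matrix_vector_mult_add_rdistrib inner_add_right case_prod_unfold)
qed

lemma Pmode_rows: "((\<lambda>\<beta>. Pmode s t \<alpha> \<beta>) has_sum - (Uo s t \<alpha> \<bullet> (NU \<alpha> - SU \<alpha> - (1/2) *\<^sub>R (BU \<alpha> + DU \<alpha>)))) UNIV"
  unfolding Pmode_def
  by (intro has_sum_uminusI has_sum_bounded_linear[OF bounded_linear_inner_right skewop_rows, unfolded o_def])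

lemma Pmode_antisymmetric: "Pmode s t \<alpha> \<beta> = - Pmode s t \<beta> \<alpha>"
  using inner_transpose[of "Uo s t \<alpha>" "skewop s t \<beta> \<alpha>" "Uo s t \<beta>"]
  by (simp add: Pmode_def skewop_antisymmetric bounded_bilinear.minus_left[OF bounded_bilinear_matrix_vector_mult] del: transpose_matrix_vector)

lemma Pmode_form: "((\<lambda>(\<alpha>, \<beta>). Pmode s t \<alpha> \<beta>) has_sum 0) UNIV"
  using has_sum_uminusI[OF skewop_form] by (simp add: Pmode_def case_prod_unfold)

lemma BHGo_form_rows: "((\<lambda>\<beta>. Uo s t \<alpha> \<bullet> (BHGo s t \<alpha> \<beta> *v Uo s t \<beta>)) has_sum (Uo s t \<alpha> \<bullet> (BU \<alpha> + DU \<alpha>))) UNIV"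
  by (rule has_sum_bounded_linear[OF bounded_linear_inner_right BHGo_rows, unfolded o_def])

lemma Emode_evolution:
  "((\<lambda>r. Emode s r \<alpha>) has_real_derivative Uo s t \<alpha> \<bullet> (SU \<alpha> - NU \<alpha>)) (at t)"
proof -
  have "((\<lambda>r. Uo s r \<alpha> \<bullet> Uo s r \<alpha>) has_vector_derivative (Uo s t \<alpha> \<bullet> (SU \<alpha> - NU \<alpha>) + (SU \<alpha> - NU \<alpha>) \<bullet> Uo s t \<alpha>)) (at t)"
    by (intro bounded_bilinear.has_vector_derivative[OF bounded_bilinear_inner] Uo_evolution[OF sys t conv])
  from DERIV_cmult[OF this[folded has_real_derivative_iff_has_vector_derivative], of "1/2"]
  show ?thesis by (simp add: Emode_def power2_norm_eq_inner inner_commute)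
qed

text \<open>
  Summing the modal balances over \<open>\<alpha>\<close> leaves the boundary terms only, since the transfer terms sum to zero.
\<close>

lemma total_energy_evolution:
  assumes b: "((\<lambda>(\<alpha>, \<beta>). Uo s t \<alpha> \<bullet> (BHGo s t \<alpha> \<beta> *v Uo s t \<beta>)) has_sum b) UNIV"
  shows "((\<lambda>r. \<Sum>\<^sub>\<infinity>\<alpha>. Emode s r \<alpha>) has_real_derivative - 1/2 * b) (at t)"
proof -
  have vd: "vector_derivative (\<lambda>r. Emode s r \<alpha>) (at t) = Uo s t \<alpha> \<bullet> (SU \<alpha> - NU \<alpha>)" for \<alpha>
    by (intro vector_derivative_at Emode_evolution[unfolded has_real_derivative_iff_has_vector_derivative])
  have "((\<lambda>r. \<Sum>\<^sub>\<infinity>\<alpha>. Emode s r \<alpha>) has_vector_derivative (\<Sum>\<^sub>\<infinity>\<alpha>. Uo s t \<alpha> \<bullet> (SU \<alpha> - NU \<alpha>))) (at t)"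
  proof -
    have "termwise_differentiable (times s) (\<lambda>\<alpha> r. Emode s r \<alpha>)"
      using conv unfolding convergence_convention_def by blast
    from bspec[OF this[unfolded termwise_differentiable_def] t] show ?thesis by (simp add: vd)
  qed
  moreover have "((\<lambda>\<alpha>. - (Uo s t \<alpha> \<bullet> (NU \<alpha> - SU \<alpha> - (1/2) *\<^sub>R (BU \<alpha> + DU \<alpha>)))) has_sum 0) UNIV"
    using Pmode_form[folded UNIV_Times_UNIV] by (rule has_sum_SigmaD) (simp only: prod.case Pmode_rows)
  moreover have "((\<lambda>\<alpha>. Uo s t \<alpha> \<bullet> (BU \<alpha> + DU \<alpha>)) has_sum b) UNIV"
    using b[folded UNIV_Times_UNIV] by (rule has_sum_SigmaD) (simp only: prod.case BHGo_form_rows)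
  then have "((\<lambda>\<alpha>. 1/2 * (Uo s t \<alpha> \<bullet> (BU \<alpha> + DU \<alpha>))) has_sum (1/2 * b)) UNIV"
    by (rule has_sum_cmult_right)
  ultimately have "((\<lambda>\<alpha>. - (Uo s t \<alpha> \<bullet> (NU \<alpha> - SU \<alpha> - (1/2) *\<^sub>R (BU \<alpha> + DU \<alpha>))) - 1/2 * (Uo s t \<alpha> \<bullet> (BU \<alpha> + DU \<alpha>)))
      has_sum (0 - 1/2 * b)) UNIV"
    by (intro has_sum_diff)
  then have "((\<lambda>\<alpha>. Uo s t \<alpha> \<bullet> (SU \<alpha> - NU \<alpha>)) has_sum (- 1/2 * b)) UNIV"
    by (simp add: inner_diff_right inner_add_right algebra_simps)
  with \<open>(_ has_vector_derivative _) _\<close> show ?thesis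
    by (simp add: infsumI has_real_derivative_iff_has_vector_derivative)
qed

end

end

theorem theorem4p11:
  fixes s :: "('d::finite, 'm::{finite,linorder}) ieig" and t :: real
  assumes "ieig_system s"
    and "convergence_convention s"
    and "t \<in> times s"
    and "\<exists>\<alpha>. Uo s t \<alpha> \<noteq> 0"
  shows
    "(\<forall>\<alpha>. (\<lambda>\<beta>. skewop s t \<alpha> \<beta> *v Uo s t \<beta>) summable_on UNIV \<and>
          (\<lambda>\<beta>. BHGo s t \<alpha> \<beta> *v Uo s t \<beta>) summable_on UNIV \<and>
          ((\<lambda>r. Uo s r \<alpha>) has_vector_derivative
             (- (\<Sum>\<^sub>\<infinity>\<beta>. skewop s t \<alpha> \<beta> *v Uo s t \<beta>)
              - (1/2) *\<^sub>R (\<Sum>\<^sub>\<infinity>\<beta>. BHGo s t \<alpha> \<beta> *v Uo s t \<beta>))) (at t)) \<and>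
     (\<forall>\<alpha>. (\<lambda>\<beta>. Pmode s t \<alpha> \<beta>) summable_on UNIV \<and>
          (\<lambda>\<beta>. Uo s t \<alpha> \<bullet> (BHGo s t \<alpha> \<beta> *v Uo s t \<beta>)) summable_on UNIV \<and>
          ((\<lambda>r. Emode s r \<alpha>) has_real_derivative
             ((\<Sum>\<^sub>\<infinity>\<beta>. Pmode s t \<alpha> \<beta>)
              - 1/2 * (\<Sum>\<^sub>\<infinity>\<beta>. Uo s t \<alpha> \<bullet> (BHGo s t \<alpha> \<beta> *v Uo s t \<beta>)))) (at t)) \<and>
     (\<forall>\<alpha> \<beta>. Pmode s t \<alpha> \<beta> = - Pmode s t \<beta> \<alpha>) \<and>
     ((\<lambda>(\<alpha>, \<beta>). Pmode s t \<alpha> \<beta>) has_sum 0) UNIV \<and>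
     (\<lambda>\<alpha>. Emode s t \<alpha>) summable_on UNIV \<and>
     (\<lambda>(\<alpha>, \<beta>). Uo s t \<alpha> \<bullet> (BHGo s t \<alpha> \<beta> *v Uo s t \<beta>)) summable_on UNIV \<and>
     ((\<lambda>r. \<Sum>\<^sub>\<infinity>\<alpha>. Emode s r \<alpha>) has_real_derivative
        (- 1/2 * (\<Sum>\<^sub>\<infinity>\<alpha>. \<Sum>\<^sub>\<infinity>\<beta>. Uo s t \<alpha> \<bullet> (BHGo s t \<alpha> \<beta> *v Uo s t \<beta>)))) (at t)"
proof -
  note sys = assms(1) and conv = assms(2) and t = assms(3) and nz = assms(4)
  note * = sys t conv nz
  obtain b where b: "((\<lambda>(\<alpha>, \<beta>). Uo s t \<alpha> \<bullet> (BHGo s t \<alpha> \<beta> *v Uo s t \<beta>)) has_sum b) UNIV"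
    by (rule BHGo_form[OF *])
  have bb: "(\<Sum>\<^sub>\<infinity>\<alpha>. \<Sum>\<^sub>\<infinity>\<beta>. Uo s t \<alpha> \<bullet> (BHGo s t \<alpha> \<beta> *v Uo s t \<beta>)) = b"
    using infsum_Sigma'_banach[of "\<lambda>\<alpha> \<beta>. Uo s t \<alpha> \<bullet> (BHGo s t \<alpha> \<beta> *v Uo s t \<beta>)" UNIV "\<lambda>_. UNIV"]
      infsumI[OF b] has_sum_imp_summable[OF b] by simp
  show ?thesis
    unfolding bb
    using Uo_evolution[OF sys t conv] Emode_evolution[OF *]
    by (intro conjI allI has_sum_imp_summable[OF skewop_rows[OF *]] has_sum_imp_summable[OF BHGo_rows[OF *]]
        has_sum_imp_summable[OF Pmode_rows[OF *]] has_sum_imp_summable[OF BHGo_form_rows[OF *]]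
        Pmode_antisymmetric[OF *] Pmode_form[OF *] Emode_summable[OF sys t conv]
        has_sum_imp_summable[OF b] total_energy_evolution[OF * b])
      (simp_all add: infsumI[OF skewop_rows[OF *]] infsumI[OF BHGo_rows[OF *]]
        infsumI[OF Pmode_rows[OF *]] infsumI[OF BHGo_form_rows[OF *]] inner_diff_right inner_add_right algebra_simps)
qed

end
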